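(* Consider the 3P-SPIDER iterates $\{\widehat S_{t,k},\ 1\le t\le k^{\mathrm{out}},\ 1\le k\le k^{\mathrm{in}}_t\}$ described in the context (with variable metric $B_{t,k+1}=\mathsf B(\widehat S_{t,k})$), and assume A1, A2, A3 and A4 of the context. Let $\{k^{\mathrm{in}}_t,\ 1\le t\le k^{\mathrm{out}}\}$ be a deterministic positive sequence. Define $$\Lambda_{t,k+1}=\frac{\gamma_{t,k}L_{\dot W}}{v_{\min}}+\gamma_{t,k}^2L^2\,\frac{2v_{\max}k^{\mathrm{in}}_t}{v_{\min}\,\mathsf b}\Big(1+\frac{2C_{vb}}{\sqrt{\mathsf b}\,\bar M_{t,k+1}}\Big)$$ for $1\le t\le k^{\mathrm{out}}$ and $0\le k\le k^{\mathrm{in}}_t$. Assume that the step sizes satisfy, for all $1\le t\le k^{\mathrm{out}}$ and $0\le k\le k^{\mathrm{in}}_t-1$, $$\gamma_{t,k+1}\Big(1+\frac{2C_b}{m_{t,k+1}}\Big)\le\gamma_{t,k},\qquad \Lambda_{t,k+1}\in(0,1/2).$$ Then $$\sum_{t=1}^{k^{\mathrm{out}}}\sum_{k=1}^{k^{\mathrm{in}}_t}\gamma_{t,k}\Big(\frac12-\Lambda_{t,k+1}\Big)\big\{\mathbb E[\Delta^\star_{t,k}]+\mathbb E[\mathcal D^\star_{t,k}]\big\}\le \mathbb E\big[W(\widehat S_{1,0})+g(\widehat S_{1,0})\big]-\min_{\mathcal S}(W+g)$$ $$\qquad+v_{\max}\sum_{t=1}^{k^{\mathrm{out}}}\gamma_{t,0}\,k^{\mathrm{in}}_t\,\mathbb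 E\big[\|\mathcal E_t\|^2\big]+v_{\max}\sum_{t=1}^{k^{\mathrm{out}}}\sum_{k=1}^{k^{\mathrm{in}}_t}(k^{\mathrm{in}}_t-k+1)\,\gamma_{t,k}\,\mathcal U_{t,k},$$ where $\mathcal E_t=\mathsf S_{t,0}-\bar{\mathsf h}(\widehat S_{t,0})$ and $$\mathcal U_{t,k}=\frac{2C_b}{m_{t,k}}+\frac{C_b^2}{m_{t,k}^2}+\frac{C_v}{\mathsf b\,M_{t,k}}+\frac{2C_{vb}}{\sqrt{\mathsf b}\,\bar M_{t,k}}+\frac{C_{vb}^2}{\mathsf b\,\bar M_{t,k}^2}.$$
   Context: **Notation.** $\mathcal P_+^q$ is the set of $q\times q$ positive definite matrices; for $B\in\mathcal P_+^q$, $\langle x,y\rangle_B=\langle Bx,y\rangle$ and $\|x\|_B^2=\langle x,x\rangle_B$. For $\gamma>0$, $\mathrm{prox}^B_{\gamma g}(s)=\operatorname{argmin}_{x\in\mathbb R^q}\big(\gamma g(x)+\tfrac12\|x-s\|_B^2\big)$. **Data.** $n\ge1$; $g:\mathbb R^q\to(-\infty,+\infty]$ with domain $\mathcal S=\{g<+\infty\}$; $G_i:\mathcal S\to\mathbb R^q$ ($1\le i\le n$); $\mathsf B:\mathcal S\to\mathcal P_+^q$; $\bar{\mathsf h}_i(s)=-\mathsf B(s)^{-1}G_i(s)$ and $\bar{\mathsf h}(s)=n^{-1}\sum_{i=1}^n\bar{\mathsf h}_i(s)$. **Algorithm (3P-SPIDER).** Inputs: positive integers $k^{\mathrm{out}}$,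 $k^{\mathrm{in}}_t$, $\mathsf b$, $\mathsf b'_t$; step sizes $\gamma_{t,k}>0$; $\widehat S_{\mathrm{init}}\in\mathcal S$. Set $\widehat S_{0,k^{\mathrm{in}}_0}=\widehat S_{\mathrm{init}}$. For $t=1,\dots,k^{\mathrm{out}}$: set $\widehat S_{t,0}=\widehat S_{t,-1}=\widehat S_{t-1,k^{\mathrm{in}}_{t-1}}$; sample a batch $\mathcal B_{t,0}$ of size $\mathsf b'_t$ in $\{1,\dots,n\}$, with or without replacement; for all $i\in\mathcal B_{t,0}$ compute $\delta_{t,0,i}$ equal to or approximating $\bar{\mathsf h}_i(\widehat S_{t,0})$; set $\mathsf S_{t,0}=(\mathsf b'_t)^{-1}\sum_{i\in\mathcal B_{t,0}}\delta_{t,0,i}$. For $k=0,\dots,k^{\mathrm{in}}_t-1$: sample uniformly at random a mini-batch $\mathcal B_{t,k+1}$ of size $\mathsf b$ in $\{1,\dots,n\}$, with or without replacement; for all $i\in\mathcal B_{t,k+1}$ compute $\delta_{t,k+1,i}$ equal to or approximating $\bar{\mathsf h}_i(\widehat S_{t,k})-\bar{\mathsf h}_i(\widehat S_{t,k-1})$; set $\mathsf S_{t,k+1}=\mathsf S_{t,k}+\mathsf b^{-1}\sum_{i\in\mathcal B_{t,k+1}}\delta_{t,k+1,i}$ and $\widehat S_{t,k+1}=\mathrm{prox}^{\mathsf B(\widehat S_{t,k})}_{\gamma_{t,k+1}g}\big(\widehat S_{t,k}+\gamma_{t,k+1}\mathsf S_{t,k+1}\big)$. **Errors.** $\xi_{t,k+1,i}=\delta_{t,k+1,i}-\bar{\mathsf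 h}_i(\widehat S_{t,k})+\bar{\mathsf h}_i(\widehat S_{t,k-1})$; with $\mathcal P_{t,k+1/2}=\sigma(\mathcal B_{t,k+1},\widehat S_{t,k},\widehat S_{t,k-1})$, set $\mu_{t,k+1,i}=\mathbb E[\xi_{t,k+1,i}\mid\mathcal P_{t,k+1/2}]$ and $\sigma^2_{t,k+1,i}=\mathbb E[\|\xi_{t,k+1,i}-\mu_{t,k+1,i}\|^2\mid\mathcal P_{t,k+1/2}]$. **Assumptions.** A1: $g$ is proper, lower semicontinuous and convex. A2: for each $i$, $\bar{\mathsf h}_i$ is globally Lipschitz on $\mathcal S$ with constant $L_i>0$; $L^2=n^{-1}\sum_{i=1}^nL_i^2$. A3: (a) there is $W:\mathbb R^q\to\mathbb R$, continuously differentiable on $\mathcal S$, with $\nabla W(s)=n^{-1}\sum_{i=1}^nG_i(s)$ for all $s\in\mathcal S$; (b) $\nabla W$ is globally $L_{\dot W}$-Lipschitz on $\mathcal S$; (c) there are $0<v_{\min}\le v_{\max}<\infty$ with $v_{\min}\|\cdot\|^2\le\|\cdot\|^2_{\mathsf B(s)}\le v_{\max}\|\cdot\|^2$ for all $s\in\mathcal S$. A4: (a) conditionally on $\mathcal B_{t,k+1}$, $\widehat S_{t,k}$ and $\widehat S_{t,k-1}$, the approximations $\{\delta_{t,k+1,i},\ i\in\mathcal B_{t,k+1}\}$ are independent; (b) there are $C_b\ge0$ and, for each $1\le t\le k^{\mathrm{out}}$, a non-decreasing deterministic sequence $\{m_{t,k},k\ge1\}$ such that for $0\le k\le k^{\mathrm{in}}_t-1$,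 with probability one, $\|n^{-1}\sum_{i=1}^n\mu_{t,k+1,i}\|\le C_b/m_{t,k+1}$; (c) there are $C_v,C_{vb}\ge0$ and, for each $1\le t\le k^{\mathrm{out}}$, non-decreasing deterministic sequences $\{M_{t,k},k\ge1\}$, $\{\bar M_{t,k},k\ge1\}$ such that for $0\le k\le k^{\mathrm{in}}_t-1$, with probability one, $n^{-1}\sum_{i=1}^n\sigma^2_{t,k+1,i}\le C_v/M_{t,k+1}$ and $n^{-1}\sum_{i=1}^n\|\mu_{t,k+1,i}-n^{-1}\sum_{j=1}^n\mu_{t,k+1,j}\|^2\le C_{vb}^2/\bar M_{t,k+1}^2$. **Criteria.** For $0\le k\le k^{\mathrm{in}}_t-1$, with $p_{t,k}=\mathrm{prox}^{\mathsf B(\widehat S_{t,k})}_{\gamma_{t,k+1}g}\big(\widehat S_{t,k}+\gamma_{t,k+1}\bar{\mathsf h}(\widehat S_{t,k})\big)$: $\Delta^\star_{t,k+1}=\gamma_{t,k+1}^{-2}\|p_{t,k}-\widehat S_{t,k}\|^2_{\mathsf B(\widehat S_{t,k})}$ and $\mathcal D^\star_{t,k+1}=\gamma_{t,k+1}^{-2}\|\widehat S_{t,k+1}-p_{t,k}\|^2_{\mathsf B(\widehat S_{t,k})}$.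
   Formalization: Adds: given the last two iterates, the approximations are independent of the history and the mini-batch; repeated draws are approximated afresh with equal conditional means; mini-batches are independent of the past; B is Borel and the errors ξ are integrable. *)

theory Defs
  imports "HOL-Probability.Probability"
begin

section \<open>Matrices, convex analysis, proximal operator\<close>

definition pos_def_matrix :: "real^'q^'q \<Rightarrow> bool" where
  "pos_def_matrix A \<longleftrightarrow> transpose A = A \<and> (\<forall>x. x \<noteq> 0 \<longrightarrow> 0 < (A *v x) \<bullet> x)"

definition sqnorm_wrt :: "real^'q^'q \<Rightarrow> real^'q \<Rightarrow> real" where
  "sqnorm_wrt A x = (A *v x) \<bullet> x"

definition proper_fun :: "('a \<Rightarrow> ereal) \<Rightarrow> bool" where
  "proper_fun g \<longleftrightarrow> (\<forall>x. g x \<noteq> -\<infinity>) \<and> (\<exists>x. g x < \<infinity>)"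

definition lower_semicontinuous :: "('a::topological_space \<Rightarrow> ereal) \<Rightarrow> bool" where
  "lower_semicontinuous g \<longleftrightarrow> (\<forall>x. g x \<le> Liminf (at x) g)"

definition convex_ereal_fun :: "('a::real_vector \<Rightarrow> ereal) \<Rightarrow> bool" where
  "convex_ereal_fun g \<longleftrightarrow>
     (\<forall>x y. \<forall>u::real. 0 \<le> u \<and> u \<le> 1 \<longrightarrow>
        g ((1 - u) *\<^sub>R x + u *\<^sub>R y) \<le> ereal (1 - u) * g x + ereal u * g y)"

definition prox :: "real^'q^'q \<Rightarrow> real \<Rightarrow> (real^'q \<Rightarrow> ereal) \<Rightarrow> real^'q \<Rightarrow> real^'q" where
  "prox A \<gamma> g s =
     (ARG_MIN (\<lambda>x. ereal \<gamma> * g x + ereal (1 / 2 * sqnorm_wrt A (x - s))) x. True)"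

definition hbar_i ::
  "(real^'q \<Rightarrow> real^'q^'q) \<Rightarrow> (nat \<Rightarrow> real^'q \<Rightarrow> real^'q) \<Rightarrow> nat \<Rightarrow> real^'q \<Rightarrow> real^'q" where
  "hbar_i B G i s = - (matrix_inv (B s) *v G i s)"

definition hbar ::
  "nat \<Rightarrow> (real^'q \<Rightarrow> real^'q^'q) \<Rightarrow> (nat \<Rightarrow> real^'q \<Rightarrow> real^'q) \<Rightarrow> real^'q \<Rightarrow> real^'q" where
  "hbar n B G s = (1 / real n) *\<^sub>R (\<Sum>i=1..n. hbar_i B G i s)"

section \<open>Probability\<close>

text \<open>Extended expectation of a nonnegative random variable; it may be infinite.\<close>

definition expect :: "'w measure \<Rightarrow> ('w \<Rightarrow> real) \<Rightarrow> ereal" where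
  "expect M X = enn2ereal (\<integral>\<^sup>+ \<omega>. ennreal (X \<omega>) \<partial>M)"

definition vec_cond_exp ::
  "'w measure \<Rightarrow> 'w measure \<Rightarrow> ('w \<Rightarrow> real^'q) \<Rightarrow> 'w \<Rightarrow> real^'q" where
  "vec_cond_exp M F X \<omega> = (\<chi> a. real_cond_exp M F (\<lambda>\<omega>. X \<omega> $ a) \<omega>)"

text \<open>Conditional counterparts, given the sub-sigma-algebra \<open>F\<close>, of the library's
  \<open>indep_sets\<close> and \<open>indep_set\<close>.\<close>

definition cond_indep_sets ::
  "'w measure \<Rightarrow> 'w measure \<Rightarrow> ('i \<Rightarrow> 'w set set) \<Rightarrow> 'i set \<Rightarrow> bool" where
  "cond_indep_sets M F \<A> I \<longleftrightarrow>
     (\<forall>J\<subseteq>I. J \<noteq> {} \<longrightarrow> finite J \<longrightarrow> (\<forall>A\<in>Pi J \<A>.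
        AE \<omega> in M. real_cond_exp M F (indicator (\<Inter>j\<in>J. A j)) \<omega>
                  = (\<Prod>j\<in>J. real_cond_exp M F (indicator (A j)) \<omega>)))"

definition cond_indep_set ::
  "'w measure \<Rightarrow> 'w measure \<Rightarrow> 'w set set \<Rightarrow> 'w set set \<Rightarrow> bool" where
  "cond_indep_set M F \<A> \<B> \<longleftrightarrow> cond_indep_sets M F (case_bool \<A> \<B>) UNIV"

section \<open>The 3P-SPIDER algorithm\<close>

text \<open>A batch is the list of the successively drawn indices, so that a batch drawn with
  replacement may repeat an index.\<close>

definition uniform_batch :: "bool \<Rightarrow> nat \<Rightarrow> nat \<Rightarrow> nat list pmf" where
  "uniform_batch repl n b =
     pmf_of_set {l. length l = b \<and> set l \<subseteq> {1..n} \<and> (repl \<or> distinct l)}"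

definition batch_size :: "nat \<Rightarrow> (nat \<Rightarrow> nat) \<Rightarrow> nat \<Rightarrow> nat \<Rightarrow> nat" where
  "batch_size b b' t k = (if k = 0 then b' t else b)"

text \<open>The approximation \<open>\<delta> t k j i\<close> is the one computed for the \<open>j\<close>-th element of the batch
  \<open>batch t k\<close> when this element is the index \<open>i\<close>. Hence an index drawn several times is
  approximated afresh at each draw; if \<open>\<delta>\<close> does not depend on \<open>j\<close>, there is one
  approximation per index. Only the values with \<open>i = batch t k ! j\<close> enter the algorithm.
  The functions \<open>spider_dir\<close> and \<open>spider_iter\<close> describe one trajectory.\<close>

fun spider_dir ::
  "nat \<Rightarrow> (nat \<Rightarrow> nat) \<Rightarrow> (nat \<Rightarrow> nat \<Rightarrow> nat list) \<Rightarrow> (nat \<Rightarrow> nat \<Rightarrow> nat \<Rightarrow> nat \<Rightarrow> real^'q)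
    \<Rightarrow> nat \<Rightarrow> nat \<Rightarrow> real^'q" where
  "spider_dir b b' batch \<delta> t 0 =
     (1 / real (b' t)) *\<^sub>R (\<Sum>j<b' t. \<delta> t 0 j (batch t 0 ! j))"
| "spider_dir b b' batch \<delta> t (Suc k) =
     spider_dir b b' batch \<delta> t k
       + (1 / real b) *\<^sub>R (\<Sum>j<b. \<delta> t (Suc k) j (batch t (Suc k) ! j))"

fun spider_iter ::
  "(real^'q \<Rightarrow> ereal) \<Rightarrow> (real^'q \<Rightarrow> real^'q^'q) \<Rightarrow> (nat \<Rightarrow> nat) \<Rightarrow> (nat \<Rightarrow> nat \<Rightarrow> real)
    \<Rightarrow> real^'q \<Rightarrow> (nat \<Rightarrow> nat \<Rightarrow> real^'q) \<Rightarrow> nat \<Rightarrow> nat \<Rightarrow> real^'q" where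
  "spider_iter g B kin \<gamma> Sinit S 0 k = Sinit"
| "spider_iter g B kin \<gamma> Sinit S (Suc t) 0 = spider_iter g B kin \<gamma> Sinit S t (kin t)"
| "spider_iter g B kin \<gamma> Sinit S (Suc t) (Suc k) =
     (let s = spider_iter g B kin \<gamma> Sinit S (Suc t) k
      in prox (B s) (\<gamma> (Suc t) (Suc k)) g (s + \<gamma> (Suc t) (Suc k) *\<^sub>R S (Suc t) (Suc k)))"

text \<open>History of the algorithm up to inner iteration \<open>k\<close> of outer iteration \<open>t\<close>: generated by
  the batches and the approximations that have been computed so far.\<close>

definition spider_past ::
  "'w measure \<Rightarrow> (nat \<Rightarrow> nat) \<Rightarrow> nat \<Rightarrow> (nat \<Rightarrow> nat) \<Rightarrow> (nat \<Rightarrow> nat \<Rightarrow> 'w \<Rightarrow> nat list)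
    \<Rightarrow> (nat \<Rightarrow> nat \<Rightarrow> nat \<Rightarrow> nat \<Rightarrow> 'w \<Rightarrow> real^'q) \<Rightarrow> nat \<Rightarrow> nat \<Rightarrow> 'w measure" where
  "spider_past M kin b b' batch \<delta> t k = sigma (space M)
     (\<Union>(t', k') \<in> {(t', k'). 1 \<le> t' \<and> (t' < t \<and> k' \<le> kin t' \<or> t' = t \<and> k' \<le> k)}.
        sets (vimage_algebra (space M) (batch t' k') (count_space UNIV))
        \<union> (\<Union>j<batch_size b b' t' k'.
             sets (vimage_algebra (space M) (\<lambda>\<omega>. \<delta> t' k' j (batch t' k' \<omega> ! j) \<omega>) borel)))"

text \<open>Sampling at step \<open>(t, k+1)\<close>: the mini-batch is uniform and independent of the history, and the
  approximations use fresh randomness. Given the last two iterates, on which their targets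
  depend, they are independent of the history and of the mini-batch (which only selects the
  indices for which an approximation is computed).\<close>

definition spider_sampling ::
  "'w measure \<Rightarrow> bool \<Rightarrow> nat \<Rightarrow> (nat \<Rightarrow> nat) \<Rightarrow> nat \<Rightarrow> (nat \<Rightarrow> nat)
    \<Rightarrow> (nat \<Rightarrow> nat \<Rightarrow> 'w \<Rightarrow> nat list) \<Rightarrow> (nat \<Rightarrow> nat \<Rightarrow> nat \<Rightarrow> nat \<Rightarrow> 'w \<Rightarrow> real^'q)
    \<Rightarrow> (nat \<Rightarrow> nat \<Rightarrow> 'w \<Rightarrow> real^'q) \<Rightarrow> nat \<Rightarrow> nat \<Rightarrow> bool" where
  "spider_sampling M repl n kin b b' batch \<delta> Shat t k \<longleftrightarrow>
     (let past = spider_past M kin b b' batch \<delta> t k;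
          draw = vimage_algebra (space M) (batch t (k+1)) (count_space UNIV)
      in distr M (count_space UNIV) (batch t (k+1)) = measure_pmf (uniform_batch repl n b)
       \<and> prob_space.indep_set M (sets draw) (sets past)
       \<and> cond_indep_set M
           (vimage_algebra (space M) (\<lambda>\<omega>. (Shat t k \<omega>, Shat t (k-1) \<omega>)) (borel \<Otimes>\<^sub>M borel))
           (sigma_sets (space M)
              (\<Union>j<b. \<Union>i\<in>{1..n}. sets (vimage_algebra (space M) (\<delta> t (k+1) j i) borel)))
           (sigma_sets (space M) (sets past \<union> sets draw)))"

text \<open>The sigma-algebra generated by the mini-batch of step \<open>(t, k+1)\<close> and the last two iterates.
  The truncated difference \<open>k - 1\<close> at \<open>k = 0\<close> implements the convention that the iterate with
  inner index \<open>-1\<close> is the one with inner index \<open>0\<close>; likewise in all other occurrences.\<close>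

definition spider_half ::
  "'w measure \<Rightarrow> (nat \<Rightarrow> nat \<Rightarrow> 'w \<Rightarrow> nat list) \<Rightarrow> (nat \<Rightarrow> nat \<Rightarrow> 'w \<Rightarrow> real^'q)
    \<Rightarrow> nat \<Rightarrow> nat \<Rightarrow> 'w measure" where
  "spider_half M batch Shat t k =
     vimage_algebra (space M) (\<lambda>\<omega>. (batch t (k+1) \<omega>, Shat t k \<omega>, Shat t (k-1) \<omega>))
       (count_space UNIV \<Otimes>\<^sub>M borel \<Otimes>\<^sub>M borel)"

end

theory Submission
  imports Defs
begin

text \<open>Comparing the inexact prox point with the exact one, the descent lemma and nonexpansiveness of the
  proximal map show that each inner step decreases \<open>W + g\<close> by a multiple of \<open>\<Delta>\<^sup>\<star> + D\<^sup>\<star>\<close>, up to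
  \<open>\<gamma> v\<^sub>m\<^sub>a\<^sub>x\<close> times the squared error of the direction; this holds along every trajectory. The
  error splits into a term that is a function of the past and the mini-batch and a noise that is
  centered given both, which yields a linear recursion for its second moment, driven by the squared
  length of the last move. That length is again controlled by \<open>\<Delta>\<^sup>\<star> + D\<^sup>\<star>\<close>, and the step size
  conditions let the accumulated errors be absorbed into the decrease of \<open>W + g\<close>. Integrability comes
  for free: if the infimum of \<open>W + g\<close> is finite, the pathwise inequality bounds \<open>\<Delta>\<^sup>\<star> + D\<^sup>\<star>\<close> by
  square-integrable errors, one step after the other.\<close>

section \<open>The proximal map in a variable metric\<close>

text \<open>Two obstacles shape the development. The bias \<open>\<mu>\<close> is conditioned on the
  mini-batch, so the error at a randomly selected index is not a frozen function of the past. The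
  sampling assumption lets it agree almost surely with a version conditioned on the two iterates
  alone, after which batch and past can be averaged separately. Measurability of the iterates has to
  be earned as well: the metric is random and controlled on the domain of \<open>g\<close> only,
  which calls for joint continuity of the proximal point in metric and argument. In \<Lambda> the
  first summand is the price of the descent lemma. The second arises because the squared move, at
  most \<open>2 \<gamma>^2 / vmin\<close> times the sum of the two criteria, enters the recursion
  with factor \<open>L^2 / b\<close> and its correction for the spread of the bias, is counted at
  most \<open>kin t\<close> times, and is multiplied by \<open>vmax \<gamma>\<close>.\<close>

lemma symmetric_form_commute:
  fixes A :: "real^'q^'q"
  assumes "transpose A = A"
  shows "(A *v x) \<bullet> y = (A *v y) \<bullet> x"
  by (metis assms dot_lmul_matrix inner_commute transpose_matrix_vector)

lemma sqnorm_wrt_add: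
  fixes A :: "real^'q^'q"
  assumes "transpose A = A"
  shows "sqnorm_wrt A (x + y) = sqnorm_wrt A x + 2 * ((A *v x) \<bullet> y) + sqnorm_wrt A y"
  using symmetric_form_commute[OF assms, of x y]
  by (simp add: sqnorm_wrt_def matrix_vector_right_distrib inner_add_left inner_add_right)

lemma sqnorm_wrt_scaleR:
  fixes A :: "real^'q^'q"
  shows "sqnorm_wrt A (c *\<^sub>R x) = c\<^sup>2 * sqnorm_wrt A x"
  by (simp add: sqnorm_wrt_def matrix_vector_mult_scaleR power2_eq_square)

lemma sqnorm_wrt_minus:
  fixes A :: "real^'q^'q"
  shows "sqnorm_wrt A (- x) = sqnorm_wrt A x"
  using sqnorm_wrt_scaleR[of A "-1" x] by simp

lemma sqnorm_wrt_diff: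
  fixes A :: "real^'q^'q"
  assumes "transpose A = A"
  shows "sqnorm_wrt A (x - y) = sqnorm_wrt A x - 2 * ((A *v x) \<bullet> y) + sqnorm_wrt A y"
  using sqnorm_wrt_add[OF assms, of x "- y"] by (simp add: sqnorm_wrt_minus)

lemma continuous_on_sqnorm_wrt:
  fixes A :: "real^'q^'q"
  assumes "continuous_on T f"
  shows "continuous_on T (\<lambda>x. sqnorm_wrt A (f x))"
  unfolding sqnorm_wrt_def
  by (intro continuous_intros assms bounded_linear.continuous_on[OF matrix_vector_mul_bounded_linear])

lemma sqnorm_wrt_add_le:
  fixes A :: "real^'q^'q"
  assumes "transpose A = A" "\<And>x. 0 \<le> sqnorm_wrt A x"
  shows "sqnorm_wrt A (x + y) \<le> 2 * sqnorm_wrt A x + 2 * sqnorm_wrt A y"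
  using assms(2)[of "x - y"] by (simp add: sqnorm_wrt_add[OF assms(1)] sqnorm_wrt_diff[OF assms(1)])

text \<open>If no minimizer existed, each point of \<open>K\<close> would lie in some set
  \<open>{x. f y < f x}\<close> with \<open>y\<close> in \<open>K\<close>. These sets are open, and
  in a finite subcover the \<open>y\<close> with least \<open>f y\<close> is itself covered, hence
  not least.\<close>

lemma compact_attains_min_lsc:
  fixes f :: "'a::topological_space \<Rightarrow> 'b::linorder"
  assumes "compact K" "K \<noteq> {}"
    and lsc: "\<And>x c. c < f x \<Longrightarrow> eventually (\<lambda>y. c < f y) (nhds x)"
  shows "\<exists>x\<in>K. \<forall>y\<in>K. f x \<le> f y"
proof (rule ccontr)
  assume contra: "\<not> ?thesis"
  have op: "open {x. f y < f x}" for y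
  proof (subst open_subopen, intro ballI)
    fix x assume "x \<in> {x. f y < f x}"
    then have "eventually (\<lambda>z. f y < f z) (nhds x)" using lsc by simp
    then show "\<exists>T. open T \<and> x \<in> T \<and> T \<subseteq> {x. f y < f x}" unfolding eventually_nhds by blast
  qed
  have "K \<subseteq> (\<Union>y\<in>K. {x. f y < f x})"
    using contra by (force simp: not_le)
  then obtain C where C: "C \<subseteq> K" "finite C" "K \<subseteq> (\<Union>y\<in>C. {x. f y < f x})"
    by (rule compactE_image[OF assms(1) op])
  then have "C \<noteq> {}" using assms(2) by auto
  then have "Min (f ` C) \<in> f ` C" using C(2) by simp
  then obtain y where y: "y \<in> C" "f y = Min (f ` C)" by force
  then obtain z where "z \<in> C" "f z < f y" using C by blast
  then show False using y C(2) by (metis Min_le finite_imageI image_eqI not_le)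
qed

text \<open>The Liminf ignores the value at \<open>x\<close> itself; the strict bound at
  \<open>x\<close> upgrades the punctured neighbourhood to a full one.\<close>

lemma lower_semicontinuous_eventually:
  assumes "lower_semicontinuous g" "c < g x"
  shows "eventually (\<lambda>y. c < g y) (nhds x)"
proof -
  have "c < Liminf (at x) g" using assms by (meson less_le_trans lower_semicontinuous_def)
  then have "eventually (\<lambda>y. c < g y) (at x)" by (rule less_LiminfD)
  then show ?thesis using assms(2) by (auto simp: eventually_at_filter elim: eventually_mono)
qed

text \<open>The minimum over the unit ball around a point of the domain propagates to the whole space by
  convexity along rays.\<close>

lemma convex_lsc_affine_lower_bound:
  fixes g :: "'a::euclidean_space \<Rightarrow> ereal"
  assumes "proper_fun g" "lower_semicontinuous g" "convex_ereal_fun g"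
  shows "\<exists>c0 c1. 0 \<le> c1 \<and> (\<forall>x. ereal (c0 - c1 * norm x) \<le> g x)"
proof -
  obtain x0 where "g x0 < \<infinity>" and ninf: "\<And>x. g x \<noteq> -\<infinity>"
    using assms(1) by (auto simp: proper_fun_def)
  then obtain a where a: "g x0 = ereal a"
    by (metis less_ereal.simps(2) ereal_cases infinity_ereal_def)
  obtain y0 where y0: "y0 \<in> cball x0 1" "\<And>y. y \<in> cball x0 1 \<Longrightarrow> g y0 \<le> g y"
    using compact_attains_min_lsc[of "cball x0 1" g] lower_semicontinuous_eventually[OF assms(2)]
    by auto
  then have "g y0 \<le> ereal a" using a by (metis centre_in_cball zero_le_one)
  then obtain c where c: "g y0 = ereal c" "c \<le> a" using ninf[of y0] by (cases "g y0") auto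
  have bd: "ereal (c - (a - c) * norm (x - x0)) \<le> g x" for x
  proof (cases "norm (x - x0) \<le> 1")
    case True
    then have "ereal c \<le> g x"
      using y0(2)[of x] c by (simp add: dist_norm norm_minus_commute)
    moreover have "c - (a - c) * norm (x - x0) \<le> c" using c by simp
    ultimately show ?thesis by (meson ereal_less_eq(3) order_trans)
  next
    case False
    define r where "r = norm (x - x0)"
    have r: "r > 1" using False r_def by simp
    \<comment> \<open>The point where the segment from \<open>x0\<close> to \<open>x\<close> meets
      the unit sphere around \<open>x0\<close>; there \<open>g\<close> is still at least
      \<open>c\<close>, and the convexity inequality is solved for \<open>g x\<close>.\<close>
    define y where "y = (1 - 1/r) *\<^sub>R x0 + (1/r) *\<^sub>R x"
    have "y - x0 = (1/r) *\<^sub>R (x - x0)" by (simp add: y_def algebra_simps)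
    then have "norm (y - x0) = 1" using r by (auto simp: r_def)
    then have "ereal c \<le> g y" using y0(2)[of y] c by (simp add: dist_norm norm_minus_commute)
    also have "g y \<le> ereal (1 - 1/r) * g x0 + ereal (1/r) * g x"
      using assms(3) r unfolding convex_ereal_fun_def y_def by simp
    finally have le: "ereal c \<le> ereal (1 - 1/r) * g x0 + ereal (1/r) * g x" .
    show ?thesis
    proof (cases "g x")
      case (real z)
      then have "c \<le> (1 - 1/r) * a + (1/r) * z" using le a by simp
      then have "r * c \<le> r * ((1 - 1/r) * a + (1/r) * z)" using r by (intro mult_left_mono) auto
      also have "\<dots> = r * a - a + z" using r by (simp add: field_simps)
      finally have "r * c \<le> r * a - a + z" .
      then have "c - (a - c) * r \<le> z" using c(2) by (simp add: algebra_simps)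
      then show ?thesis using real r_def by simp
    qed (use ninf in auto)
  qed
  have "ereal ((c - (a - c) * norm x0) - (a - c) * norm x) \<le> g x" for x
  proof -
    have "(a - c) * norm (x - x0) \<le> (a - c) * (norm x + norm x0)"
      using c norm_triangle_ineq4 by (intro mult_left_mono) auto
    then have "c - (a - c) * norm x0 - (a - c) * norm x \<le> c - (a - c) * norm (x - x0)"
      by (simp add: algebra_simps)
    then show ?thesis using bd[of x] by (meson ereal_less_eq(3) order_trans)
  qed
  then have "\<forall>x. ereal ((c - (a - c) * norm x0) - (a - c) * norm x) \<le> g x" by blast
  moreover have "0 \<le> a - c" using c(2) by simp
  ultimately show ?thesis by blast
qed

text \<open>\<open>ARG_MIN\<close> says something only where a minimizer exists. It does: the
  objective is lower semicontinuous, and its quadratic part outgrows the affine lower bound of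
  \<open>g\<close>, so that the search is confined to a compact ball.\<close>

lemma prox_minimizes:
  fixes g :: "real^'q \<Rightarrow> ereal"
  assumes g: "proper_fun g" "lower_semicontinuous g" "convex_ereal_fun g"
    and v: "0 < v" "\<And>x. v * (norm x)\<^sup>2 \<le> sqnorm_wrt A x" and \<gamma>: "0 < \<gamma>"
  shows "ereal \<gamma> * g (prox A \<gamma> g s) + ereal (1/2 * sqnorm_wrt A (prox A \<gamma> g s - s))
           \<le> ereal \<gamma> * g z + ereal (1/2 * sqnorm_wrt A (z - s))"
proof -
  define f where "f x = ereal \<gamma> * g x + ereal (1/2 * sqnorm_wrt A (x - s))" for x
  obtain c0 c1 where c: "0 \<le> c1" "\<And>x. ereal (c0 - c1 * norm x) \<le> g x"
    using convex_lsc_affine_lower_bound[OF g] by auto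
  obtain x0 where "g x0 < \<infinity>" and ninf: "\<And>x. g x \<noteq> -\<infinity>"
    using g(1) by (auto simp: proper_fun_def)
  then obtain F0 where F0: "f x0 = ereal F0"
    using \<gamma> by (cases "g x0") (auto simp: f_def)
  have lsc: "eventually (\<lambda>y. c < f y) (nhds x)" if "c < f x" for c x
  proof (cases c)
    case (real r)
    let ?q = "\<lambda>y. 1/2 * sqnorm_wrt A (y - s)"
    have "ereal ((r - ?q x) / \<gamma>) < g x"
      using that real \<gamma> ninf[of x] by (cases "g x") (auto simp: f_def field_simps)
    \<comment> \<open>\<open>d\<close> splits the strict inequality: near \<open>x\<close> the
      function \<open>g\<close> stays above \<open>d\<close> and the quadratic part stays above
      \<open>r - \<gamma> * d\<close>.\<close>
    then obtain d where d: "ereal ((r - ?q x) / \<gamma>) < ereal d" "ereal d < g x"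
      using ereal_dense2 by blast
    have "isCont ?q x"
      by (rule continuous_on_interior[of UNIV]) (auto intro!: continuous_intros continuous_on_sqnorm_wrt)
    then have "(?q \<longlongrightarrow> ?q x) (nhds x)"
      using tendsto_at_iff_tendsto_nhds[of ?q x] by (simp only: isCont_def)
    moreover have "r - \<gamma> * d < ?q x" using d(1) \<gamma> by (simp add: field_simps)
    ultimately have "eventually (\<lambda>y. r - \<gamma> * d < ?q y) (nhds x)" by (rule order_tendstoD)
    moreover have "eventually (\<lambda>y. ereal d < g y) (nhds x)"
      using lower_semicontinuous_eventually[OF g(2) d(2)] .
    ultimately show ?thesis
    proof eventually_elim
      case (elim y)
      show ?case
      proof (cases "g y")
        case (real z)
        then have "\<gamma> * d < \<gamma> * z" using elim \<gamma> by simp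
        then have "r < \<gamma> * z + ?q y" using elim by linarith
        then show ?thesis using real \<open>c = ereal r\<close> by (simp add: f_def)
      qed (use \<gamma> real ninf in \<open>auto simp: f_def\<close>)
    qed
  next
    case MInf
    have "- \<infinity> < f y" for y using ninf[of y] \<gamma> by (cases "g y") (auto simp: f_def)
    then show ?thesis using MInf by simp
  qed (use that in auto)
  \<comment> \<open>With \<open>r\<close> the distance to \<open>s\<close>, the affine bound reduces
    \<open>f x > F0\<close> to \<open>K + \<gamma> * c1 * r < v/2 * r^2\<close>. The summand 1 in
    \<open>R\<close> gives \<open>r > 1\<close>, whence \<open>|K| \<le> |K| * r\<close>, and the
    rest of \<open>R\<close> gives \<open>(\<gamma> * c1 + |K|) * r < v/2 * r^2\<close>.\<close>
  define K where "K = F0 - \<gamma> * c0 + \<gamma> * c1 * norm s"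
  define R where "R = 1 + 2 * (\<gamma> * c1 + \<bar>K\<bar>) / v"
  have far: "f x0 < f x" if "R < norm (x - s)" for x
  proof (cases "g x")
    case (real z)
    let ?r = "norm (x - s)"
    have "0 \<le> 2 * (\<gamma> * c1 + \<bar>K\<bar>) / v" using v \<gamma> c by simp
    then have r1: "1 < ?r" and "2 * (\<gamma> * c1 + \<bar>K\<bar>) / v < ?r" using that by (auto simp: R_def)
    then have "\<gamma> * c1 + \<bar>K\<bar> < v/2 * ?r" using v by (simp add: field_simps)
    then have "(\<gamma> * c1 + \<bar>K\<bar>) * ?r < v/2 * ?r * ?r" using r1 by (intro mult_strict_right_mono) auto
    moreover have "\<bar>K\<bar> * 1 \<le> \<bar>K\<bar> * ?r" using r1 by (intro mult_left_mono) auto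
    ultimately have 1: "K + \<gamma> * c1 * ?r < 1/2 * (v * ?r\<^sup>2)"
      by (simp add: algebra_simps power2_eq_square)
    have "norm x \<le> ?r + norm s" using norm_triangle_ineq[of "x - s" s] by simp
    then have "c1 * norm x \<le> c1 * (?r + norm s)" using c by (intro mult_left_mono)
    moreover have "c0 - c1 * norm x \<le> z" using c(2)[of x] real by simp
    ultimately have "c0 - c1 * (?r + norm s) \<le> z" by linarith
    then have "\<gamma> * (c0 - c1 * (?r + norm s)) \<le> \<gamma> * z" using \<gamma> by simp
    then have "F0 < \<gamma> * z + 1/2 * sqnorm_wrt A (x - s)"
      using 1 v(2)[of "x - s"] by (simp add: K_def algebra_simps)
    then show ?thesis using real F0 by (simp add: f_def)
  qed (use ninf \<gamma> F0 in \<open>auto simp: f_def\<close>)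
  \<comment> \<open>The maximum puts \<open>x0\<close> into the ball, so the minimum over the ball
    is at most \<open>f x0\<close>, which lies below all values outside.\<close>
  have "\<exists>x\<in>cball s (max R (norm (x0 - s))). \<forall>y\<in>cball s (max R (norm (x0 - s))). f x \<le> f y"
  proof (rule compact_attains_min_lsc)
    have "x0 \<in> cball s (max R (norm (x0 - s)))" by (simp add: dist_norm norm_minus_commute)
    then show "cball s (max R (norm (x0 - s))) \<noteq> {}" by blast
  qed (use lsc in auto)
  then obtain x where x: "\<And>y. y \<in> cball s (max R (norm (x0 - s))) \<Longrightarrow> f x \<le> f y" by blast
  have "f x \<le> f y" for y
  proof (cases "norm (y - s) \<le> max R (norm (x0 - s))")
    case False
    then have "f x0 < f y" by (intro far) simp
    moreover have "f x \<le> f x0" by (intro x) (simp add: dist_norm norm_minus_commute)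
    ultimately show ?thesis by order
  qed (use x in \<open>simp add: dist_norm norm_minus_commute\<close>)
  then have "is_arg_min f (\<lambda>x. True) x" by (simp add: is_arg_min_linorder)
  then have "is_arg_min f (\<lambda>x. True) (prox A \<gamma> g s)"
    unfolding prox_def f_def arg_min_def by (rule someI)
  then show ?thesis by (simp add: is_arg_min_linorder f_def)
qed

section \<open>Optimality and stability of proximal points\<close>

lemma prox_in_domain:
  fixes g :: "real^'q \<Rightarrow> ereal"
  assumes g: "proper_fun g" "lower_semicontinuous g" "convex_ereal_fun g"
    and v: "0 < v" "\<And>x. v * (norm x)\<^sup>2 \<le> sqnorm_wrt A x" and \<gamma>: "0 < \<gamma>"
  shows "g (prox A \<gamma> g s) < \<infinity>"
proof -
  obtain z where "g z < \<infinity>" and "g z \<noteq> -\<infinity>" using g(1) by (auto simp: proper_fun_def)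
  then show ?thesis
    using prox_minimizes[OF g v \<gamma>, of s z] \<gamma> by (cases "g z"; cases "g (prox A \<gamma> g s)") auto
qed

lemma domain_convex:
  assumes "convex_ereal_fun g" "g x < \<infinity>" "g y < \<infinity>" "0 \<le> u" "u \<le> 1"
  shows "g ((1 - u) *\<^sub>R x + u *\<^sub>R y) < \<infinity>"
proof -
  have "g ((1 - u) *\<^sub>R x + u *\<^sub>R y) \<le> ereal (1 - u) * g x + ereal u * g y"
    using assms unfolding convex_ereal_fun_def by blast
  also have "\<dots> < \<infinity>" using assms by (cases "g x"; cases "g y") auto
  finally show ?thesis .
qed

lemma real_of_ereal_convex:
  assumes "proper_fun g" "convex_ereal_fun g" "g x < \<infinity>" "g y < \<infinity>" "0 \<le> u" "u \<le> 1"
  shows "real_of_ereal (g ((1 - u) *\<^sub>R x + u *\<^sub>R y))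
           \<le> (1 - u) * real_of_ereal (g x) + u * real_of_ereal (g y)"
proof -
  have "g ((1 - u) *\<^sub>R x + u *\<^sub>R y) \<le> ereal (1 - u) * g x + ereal u * g y"
    using assms unfolding convex_ereal_fun_def by blast
  moreover have "g z \<noteq> -\<infinity>" for z using assms(1) by (auto simp: proper_fun_def)
  ultimately show ?thesis
    using assms(3,4) domain_convex[OF assms(2-6)]
    by (cases "g x"; cases "g y"; cases "g ((1 - u) *\<^sub>R x + u *\<^sub>R y)") auto
qed

text \<open>This is the membership of \<open>A (s - p) / \<gamma>\<close> in the subdifferential of
  \<open>g\<close> at \<open>p\<close>, obtained by comparing \<open>p\<close> with
  \<open>(1 - u) p + u z\<close>, dividing by \<open>u\<close> and letting \<open>u\<close> tend to
  0.\<close>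

lemma prox_variational:
  fixes g :: "real^'q \<Rightarrow> ereal" and s z :: "real^'q"
  assumes g: "proper_fun g" "lower_semicontinuous g" "convex_ereal_fun g"
    and A: "transpose A = A"
    and v: "0 < v" "\<And>x. v * (norm x)\<^sup>2 \<le> sqnorm_wrt A x" and \<gamma>: "0 < \<gamma>"
    and z: "g z < \<infinity>"
  defines "p \<equiv> prox A \<gamma> g s"
  shows "\<gamma> * real_of_ereal (g p) + (A *v (s - p)) \<bullet> (z - p) \<le> \<gamma> * real_of_ereal (g z)"
proof -
  have p: "g p < \<infinity>" using prox_in_domain[OF g v \<gamma>] by (simp add: p_def)
  have ninf: "g x \<noteq> -\<infinity>" for x using g(1) by (auto simp: proper_fun_def)
  have bd: "\<gamma> * real_of_ereal (g p) + (A *v (s - p)) \<bullet> (z - p)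
      \<le> \<gamma> * real_of_ereal (g z) + u * (1/2 * sqnorm_wrt A (z - p))" if u: "0 < u" "u \<le> 1" for u
  proof -
    let ?y = "(1 - u) *\<^sub>R p + u *\<^sub>R z"
    have y: "g ?y < \<infinity>" using domain_convex[OF g(3) p z] u by auto
    have "\<gamma> * real_of_ereal (g p) + 1/2 * sqnorm_wrt A (p - s)
        \<le> \<gamma> * real_of_ereal (g ?y) + 1/2 * sqnorm_wrt A (?y - s)"
      using prox_minimizes[OF g v \<gamma>, of s ?y] p y ninf[of p] ninf[of ?y] unfolding p_def[symmetric]
      by (cases "g p"; cases "g ?y") auto
    also have "\<gamma> * real_of_ereal (g ?y)
        \<le> \<gamma> * ((1 - u) * real_of_ereal (g p) + u * real_of_ereal (g z))"
      using real_of_ereal_convex[OF g(1,3) p z] u \<gamma> by (intro mult_left_mono) auto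
    also have "?y - s = (p - s) + u *\<^sub>R (z - p)" by (simp add: algebra_simps)
    also have "sqnorm_wrt A \<dots> = sqnorm_wrt A (p - s) - 2 * u * ((A *v (s - p)) \<bullet> (z - p))
        + u\<^sup>2 * sqnorm_wrt A (z - p)"
      unfolding sqnorm_wrt_add[OF A] sqnorm_wrt_scaleR
      by (simp add: matrix_vector_mult_diff_distrib inner_diff_left algebra_simps)
    finally have "u * (\<gamma> * real_of_ereal (g p) + (A *v (s - p)) \<bullet> (z - p))
      \<le> u * (\<gamma> * real_of_ereal (g z) + u * (1/2 * sqnorm_wrt A (z - p)))"
      by (simp add: algebra_simps power2_eq_square)
    then show ?thesis using u(1) by simp
  qed
  have "((\<lambda>u. \<gamma> * real_of_ereal (g z) + u * (1/2 * sqnorm_wrt A (z - p))) \<longlongrightarrow>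
        \<gamma> * real_of_ereal (g z) + 0 * (1/2 * sqnorm_wrt A (z - p))) (at_right 0)"
    by (intro tendsto_intros)
  moreover have "eventually (\<lambda>u. \<gamma> * real_of_ereal (g p) + (A *v (s - p)) \<bullet> (z - p)
      \<le> \<gamma> * real_of_ereal (g z) + u * (1/2 * sqnorm_wrt A (z - p))) (at_right (0::real))"
    using eventually_at_right_real[of 0 1]
    by (rule eventually_mono) (use bd in auto)
  ultimately show ?thesis
    using tendsto_lowerbound[OF _ _ trivial_limit_at_right_real] by fastforce
qed

text \<open>Sum of the two variational inequalities, each tested at the other proximal point; with
  different metrics a term in \<open>A - A'\<close> remains. Equal metrics give firm
  nonexpansiveness, varying metrics give continuity.\<close>

lemma prox_perturbation:
  fixes g :: "real^'q \<Rightarrow> ereal" and s s' :: "real^'q"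
  assumes g: "proper_fun g" "lower_semicontinuous g" "convex_ereal_fun g" and \<gamma>: "0 < \<gamma>"
    and A: "transpose A = A" and A': "transpose A' = A'"
    and v: "0 < v" "\<And>x. v * (norm x)\<^sup>2 \<le> sqnorm_wrt A x" "\<And>x. v * (norm x)\<^sup>2 \<le> sqnorm_wrt A' x"
  defines "p \<equiv> prox A \<gamma> g s" and "p' \<equiv> prox A' \<gamma> g s'"
  shows "sqnorm_wrt A (p - p') \<le> (A *v (s - s') + (A - A') *v (s' - p')) \<bullet> (p - p')"
proof -
  have "\<gamma> * real_of_ereal (g p) + (A *v (s - p)) \<bullet> (p' - p) \<le> \<gamma> * real_of_ereal (g p')"
    using prox_variational[OF g A v(1,2) \<gamma>] prox_in_domain[OF g v(1,3) \<gamma>] by (simp add: p_def p'_def)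
  moreover have "\<gamma> * real_of_ereal (g p') + (A' *v (s' - p')) \<bullet> (p - p') \<le> \<gamma> * real_of_ereal (g p)"
    using prox_variational[OF g A' v(1,3) \<gamma>] prox_in_domain[OF g v(1,2) \<gamma>] by (simp add: p_def p'_def)
  ultimately have "(A *v (s - p)) \<bullet> (p' - p) + (A' *v (s' - p')) \<bullet> (p - p') \<le> 0" by linarith
  then show ?thesis
    by (simp add: sqnorm_wrt_def matrix_vector_mult_diff_distrib matrix_vector_mult_diff_rdistrib
        inner_diff_left inner_diff_right inner_add_left algebra_simps)
qed

lemma tendsto_matrix_vector_mult:
  fixes A :: "real^'q^'p"
  assumes "(f \<longlongrightarrow> A) F" "(h \<longlongrightarrow> x) F"
  shows "((\<lambda>t. f t *v h t) \<longlongrightarrow> A *v x) F"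
  unfolding matrix_vector_mult_def
  by (intro tendsto_vec_lambda tendsto_sum tendsto_mult tendsto_vec_nth assms)

text \<open>The metric of the algorithm is evaluated at a random iterate, so measurability of the
  iterates rests on joint continuity in matrix and point, over matrices with a common lower bound
  \<open>v\<close>.\<close>

lemma continuous_on_prox:
  fixes g :: "real^'q \<Rightarrow> ereal"
  assumes g: "proper_fun g" "lower_semicontinuous g" "convex_ereal_fun g" and \<gamma>: "0 < \<gamma>"
    and v: "0 < v"
  shows "continuous_on {(A, s). transpose A = A \<and> (\<forall>x. v * (norm x)\<^sup>2 \<le> sqnorm_wrt A x)}
           (\<lambda>(A, s). prox A \<gamma> g s)"
  unfolding continuous_on_def
proof (intro ballI, clarify)
  let ?K = "{(A::real^'q^'q, s::real^'q). transpose A = A \<and> (\<forall>x. v * (norm x)\<^sup>2 \<le> sqnorm_wrt A x)}"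
  fix A' :: "real^'q^'q" and s' :: "real^'q"
  assume A': "transpose A' = A'" "\<forall>x. v * (norm x)\<^sup>2 \<le> sqnorm_wrt A' x"
  let ?F = "at (A', s') within ?K"
  let ?p' = "prox A' \<gamma> g s'"
  \<comment> \<open>By Cauchy-Schwarz and the lower bound \<open>v\<close>, the perturbation
    inequality bounds the distance of the two proximal points by \<open>e\<close>, which is
    continuous and vanishes at \<open>(A', s')\<close>.\<close>
  define e where "e = (\<lambda>x :: (real^'q^'q) \<times> (real^'q).
    norm (fst x *v (snd x - s') + (fst x - A') *v (s' - ?p')) / v)"
  have "isCont (\<lambda>x. fst x *v (snd x - s')) (A', s')"
    unfolding isCont_def by (intro tendsto_matrix_vector_mult tendsto_intros)
  moreover have "isCont (\<lambda>x::(real^'q^'q) \<times> (real^'q). (fst x - A') *v (s' - ?p')) (A', s')"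
    unfolding isCont_def by (intro tendsto_matrix_vector_mult tendsto_intros)
  ultimately have "isCont e (A', s')"
    unfolding e_def using v by (intro continuous_intros) auto
  then have "(e \<longlongrightarrow> e (A', s')) ?F"
    unfolding isCont_def by (rule tendsto_within_subset) simp
  then have e0: "(e \<longlongrightarrow> 0) ?F" by (simp add: e_def)
  have "eventually (\<lambda>x. norm ((case x of (A, s) \<Rightarrow> prox A \<gamma> g s) - ?p') \<le> e x) ?F"
    unfolding eventually_at_filter
  proof (intro always_eventually allI impI)
    fix x assume "x \<in> ?K"
    then obtain A :: "real^'q^'q" and s :: "real^'q" where x: "x = (A, s)"
      and A: "transpose A = A" "\<forall>x. v * (norm x)\<^sup>2 \<le> sqnorm_wrt A x"
      by blast
    let ?d = "prox A \<gamma> g s - ?p'"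
    let ?w = "A *v (s - s') + (A - A') *v (s' - ?p')"
    have "v * (norm ?d)\<^sup>2 \<le> sqnorm_wrt A ?d" using A(2) by blast
    also have "\<dots> \<le> ?w \<bullet> ?d"
      by (rule prox_perturbation[OF g \<gamma> A(1) A'(1) v]) (use A(2) A'(2) in auto)
    also have "\<dots> \<le> norm ?w * norm ?d" by (rule norm_cauchy_schwarz)
    finally have "norm ?d * (v * norm ?d) \<le> norm ?d * norm ?w"
      by (simp add: power2_eq_square algebra_simps)
    then have "v * norm ?d \<le> norm ?w"
      by (cases "norm ?d = 0") auto
    then show "norm ((case x of (A, s) \<Rightarrow> prox A \<gamma> g s) - ?p') \<le> e x"
      using v by (simp add: e_def x field_simps)
  qed
  then have "((\<lambda>x. (case x of (A, s) \<Rightarrow> prox A \<gamma> g s) - ?p') \<longlongrightarrow> 0) ?F"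
    by (rule Lim_null_comparison[OF _ e0])
  then show "((\<lambda>(A, s). prox A \<gamma> g s) \<longlongrightarrow> ?p') ?F"
    by (simp add: LIM_zero_iff)
qed

text \<open>In the metric \<open>A\<close>, with \<open>x = s - s'\<close> and \<open>d\<close> the
  difference of the proximal points, \<open>2 <x,d> \<le> |x|^2 + |d|^2 \<le> |x|^2 + <x,d>\<close>
  by firm nonexpansiveness.\<close>

lemma prox_nonexpansive:
  fixes g :: "real^'q \<Rightarrow> ereal"
  assumes g: "proper_fun g" "lower_semicontinuous g" "convex_ereal_fun g" and \<gamma>: "0 < \<gamma>"
    and A: "transpose A = A"
    and v: "0 < v" "\<And>x. v * (norm x)\<^sup>2 \<le> sqnorm_wrt A x"
  shows "(A *v (s - s')) \<bullet> (prox A \<gamma> g s - prox A \<gamma> g s') \<le> sqnorm_wrt A (s - s')"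
proof -
  let ?d = "prox A \<gamma> g s - prox A \<gamma> g s'"
  have nn: "0 \<le> sqnorm_wrt A x" for x
    by (rule order_trans[OF _ v(2)]) (simp add: v(1) less_imp_le)
  have "sqnorm_wrt A ?d \<le> (A *v (s - s')) \<bullet> ?d"
    using prox_perturbation[OF g \<gamma> A A v(1,2,2), of s s'] by simp
  moreover have "0 \<le> sqnorm_wrt A (s - s') - 2 * ((A *v (s - s')) \<bullet> ?d) + sqnorm_wrt A ?d"
    using nn[of "(s - s') - ?d"] by (simp add: sqnorm_wrt_diff[OF A])
  ultimately show ?thesis by linarith
qed

section \<open>Descent of the objective in one inexact proximal step\<close>

lemma lipschitz_gradient_upper_bound:
  fixes W :: "'a::euclidean_space \<Rightarrow> real"
  assumes D: "\<And>u. 0 \<le> u \<Longrightarrow> u \<le> 1 \<Longrightarrow> (1 - u) *\<^sub>R x + u *\<^sub>R y \<in> T"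
    and W: "\<And>s. s \<in> T \<Longrightarrow> GDERIV W s :> W' s"
    and L: "L-lipschitz_on T W'"
  shows "W y \<le> W x + W' x \<bullet> (y - x) + L / 2 * (norm (y - x))\<^sup>2"
proof -
  \<comment> \<open>Subtracting the claimed bound along the segment leaves a function with
    nonpositive derivative on \<open>[0, 1]\<close>; this replaces integrating the gradient.\<close>
  define \<psi> where "\<psi> u = W (x + u *\<^sub>R (y - x)) - u * (W' x \<bullet> (y - x)) - L / 2 * u\<^sup>2 * (norm (y - x))\<^sup>2" for u
  have seg: "x + u *\<^sub>R (y - x) \<in> T" if "0 \<le> u" "u \<le> 1" for u
  proof -
    have "x + u *\<^sub>R (y - x) = (1 - u) *\<^sub>R x + u *\<^sub>R y" by (simp add: algebra_simps)
    then show ?thesis using D[OF that] by simp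
  qed
  have "\<psi> 1 \<le> \<psi> 0"
  proof (rule DERIV_nonpos_imp_nonincreasing, simp, intro exI conjI)
    fix u :: real assume u: "0 \<le> u" "u \<le> 1"
    let ?z = "x + u *\<^sub>R (y - x)"
    have "((\<lambda>u. W (x + u *\<^sub>R (y - x))) has_derivative (\<lambda>h. (h *\<^sub>R (y - x)) \<bullet> W' ?z)) (at u)"
      by (rule has_derivative_compose[where g = W, of "\<lambda>u. x + u *\<^sub>R (y - x)" "\<lambda>h. h *\<^sub>R (y - x)"])
        (use W[OF seg[OF u]] in \<open>auto simp: gderiv_def intro!: derivative_eq_intros\<close>)
    then have "((\<lambda>u. W (x + u *\<^sub>R (y - x))) has_real_derivative (y - x) \<bullet> W' ?z) (at u)"
      by (simp add: has_field_derivative_def mult.commute[of _ "(y - x) \<bullet> W' ?z"])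
    then show "(\<psi> has_real_derivative ((y - x) \<bullet> W' ?z - W' x \<bullet> (y - x)
        - L / 2 * (2 * u) * (norm (y - x))\<^sup>2)) (at u)"
      unfolding \<psi>_def by (auto intro!: derivative_eq_intros)
    have "(W' ?z - W' x) \<bullet> (y - x) \<le> norm (W' ?z - W' x) * norm (y - x)" by (rule norm_cauchy_schwarz)
    also have "\<dots> \<le> (L * norm (?z - x)) * norm (y - x)"
      using lipschitz_onD[OF L seg[OF u] seg[of 0]] by (intro mult_right_mono) (auto simp: dist_norm)
    also have "\<dots> = L * u * (norm (y - x))\<^sup>2" using u by (simp add: power2_eq_square)
    finally show "(y - x) \<bullet> W' ?z - W' x \<bullet> (y - x) - L / 2 * (2 * u) * (norm (y - x))\<^sup>2 \<le> 0"
      by (simp add: inner_diff_left inner_diff_right inner_commute)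
  qed
  then show ?thesis by (simp add: \<psi>_def)
qed

text \<open>The move is the exact proximal step plus the deviation from it. This feeds the descent
  of the objective back into the error recursion, which is driven by squared moves.\<close>

lemma prox_step_length:
  fixes s s' p :: "real^'q"
  assumes A: "transpose A = A" and v: "0 < v" "\<And>x. v * (norm x)\<^sup>2 \<le> sqnorm_wrt A x" and \<gamma>: "0 < \<gamma>"
  shows "(norm (s' - s))\<^sup>2
      \<le> 2 * \<gamma>\<^sup>2 / v * (sqnorm_wrt A (p - s) / \<gamma>\<^sup>2 + sqnorm_wrt A (s' - p) / \<gamma>\<^sup>2)"
proof -
  have nn: "0 \<le> sqnorm_wrt A x" for x
    by (rule order_trans[OF _ v(2)]) (simp add: v(1) less_imp_le)
  have "v * (norm (s' - s))\<^sup>2 \<le> sqnorm_wrt A ((p - s) + (s' - p))" using v(2)[of "s' - s"] by simp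
  also have "\<dots> \<le> 2 * sqnorm_wrt A (p - s) + 2 * sqnorm_wrt A (s' - p)"
    by (rule sqnorm_wrt_add_le[OF A nn])
  finally have "(norm (s' - s))\<^sup>2 \<le> (2 * sqnorm_wrt A (p - s) + 2 * sqnorm_wrt A (s' - p)) / v"
    using v(1) by (simp add: field_simps)
  also have "\<dots> = 2 * \<gamma>\<^sup>2 / v * (sqnorm_wrt A (p - s) / \<gamma>\<^sup>2 + sqnorm_wrt A (s' - p) / \<gamma>\<^sup>2)"
    using \<gamma> by (simp add: distrib_left distrib_right add_divide_distrib)
  finally show ?thesis .
qed

text \<open>The exact prox point \<open>p\<close> serves as the comparison point for the perturbed one \<open>s'\<close>, and the
  nonexpansiveness of the proximal map absorbs the inner product of \<open>H - h\<close> with \<open>s' - p\<close>.\<close>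

lemma prox_gradient_descent:
  fixes g :: "real^'q \<Rightarrow> ereal" and s h H :: "real^'q"
  assumes g: "proper_fun g" "lower_semicontinuous g" "convex_ereal_fun g" and \<gamma>: "0 < \<gamma>"
    and A: "transpose A = A"
    and v: "0 < v" "\<And>x. v * (norm x)\<^sup>2 \<le> sqnorm_wrt A x" "\<And>x. sqnorm_wrt A x \<le> v' * (norm x)\<^sup>2"
    and s: "g s < \<infinity>"
    and W: "\<And>s. g s < \<infinity> \<Longrightarrow> GDERIV W s :> W' s" and L: "LW-lipschitz_on {s. g s < \<infinity>} W'"
    and h: "W' s = - (A *v h)"
  defines "s' \<equiv> prox A \<gamma> g (s + \<gamma> *\<^sub>R H)" and "p \<equiv> prox A \<gamma> g (s + \<gamma> *\<^sub>R h)"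
  shows "W s' + real_of_ereal (g s')
      + \<gamma> * (1/2 - \<gamma> * LW / v) * (sqnorm_wrt A (p - s) / \<gamma>\<^sup>2 + sqnorm_wrt A (s' - p) / \<gamma>\<^sup>2)
    \<le> W s + real_of_ereal (g s) + \<gamma> * v' * (norm (H - h))\<^sup>2"
proof -
  let ?g = "\<lambda>x. real_of_ereal (g x)"
  define a where "a = s' - s"
  define c where "c = p - s"
  have nn: "0 \<le> sqnorm_wrt A x" for x
    by (rule order_trans[OF _ v(2)]) (simp add: v(1) less_imp_le)
  have LW: "0 \<le> LW" using L by (rule lipschitz_on_nonneg)
  have dom: "g s' < \<infinity>" "g p < \<infinity>"
    unfolding s'_def p_def by (rule prox_in_domain[OF g v(1,2) \<gamma>])+
  \<comment> \<open>The variational inequality of \<open>s'\<close> is tested at \<open>p\<close>,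
    and the next one, of \<open>p\<close>, at \<open>s\<close>, so that \<open>g p\<close> cancels
    between them.\<close>
  have "\<gamma> * ?g s' + (A *v (s + \<gamma> *\<^sub>R H - s')) \<bullet> (p - s') \<le> \<gamma> * ?g p"
    unfolding s'_def by (rule prox_variational[OF g A v(1,2) \<gamma> dom(2)])
  then have 1: "\<gamma> * ?g s' + \<gamma> * ((A *v H) \<bullet> (c - a)) - (A *v a) \<bullet> c + sqnorm_wrt A a \<le> \<gamma> * ?g p"
    by (simp add: a_def c_def sqnorm_wrt_def matrix_vector_mult_diff_distrib matrix_vector_right_distrib
        matrix_vector_mult_scaleR inner_diff_left inner_diff_right inner_add_left inner_add_right algebra_simps)
  have "\<gamma> * ?g p + (A *v (s + \<gamma> *\<^sub>R h - p)) \<bullet> (s - p) \<le> \<gamma> * ?g s"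
    unfolding p_def by (rule prox_variational[OF g A v(1,2) \<gamma> s])
  then have 2: "\<gamma> * ?g p - \<gamma> * ((A *v h) \<bullet> c) + sqnorm_wrt A c \<le> \<gamma> * ?g s"
    by (simp add: c_def sqnorm_wrt_def matrix_vector_mult_diff_distrib matrix_vector_right_distrib
        matrix_vector_mult_scaleR inner_diff_left inner_diff_right inner_add_left inner_add_right algebra_simps)
  have "W s' \<le> W s + W' s \<bullet> (s' - s) + LW / 2 * (norm (s' - s))\<^sup>2"
    by (rule lipschitz_gradient_upper_bound[OF _ W L])
      (use domain_convex[OF g(3) s dom(1)] in auto)
  also have "LW / 2 * (norm (s' - s))\<^sup>2 \<le> LW / 2 * ((2 * sqnorm_wrt A c + 2 * sqnorm_wrt A (a - c)) / v)"
  proof (rule mult_left_mono)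
    have "v * (norm (s' - s))\<^sup>2 \<le> sqnorm_wrt A (c + (a - c))"
      using v(2)[of a] by (simp add: a_def)
    also have "\<dots> \<le> 2 * sqnorm_wrt A c + 2 * sqnorm_wrt A (a - c)"
      by (rule sqnorm_wrt_add_le[OF A nn])
    finally show "(norm (s' - s))\<^sup>2 \<le> (2 * sqnorm_wrt A c + 2 * sqnorm_wrt A (a - c)) / v"
      using v(1) by (simp add: field_simps)
  qed (use LW in simp)
  finally have "W s' \<le> W s - (A *v h) \<bullet> a + LW / v * (sqnorm_wrt A c + sqnorm_wrt A (a - c))"
    by (simp add: h a_def algebra_simps add_divide_distrib)
  then have "\<gamma> * W s' \<le> \<gamma> * (W s - (A *v h) \<bullet> a + LW / v * (sqnorm_wrt A c + sqnorm_wrt A (a - c)))"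
    using \<gamma> by (intro mult_left_mono) auto
  moreover define q where "q = \<gamma> * LW / v"
  moreover define D where "D = sqnorm_wrt A c + sqnorm_wrt A (a - c)"
  ultimately have 3: "\<gamma> * W s' \<le> \<gamma> * W s - \<gamma> * ((A *v h) \<bullet> a) + q * D"
    by (simp add: right_diff_distrib distrib_left mult.assoc)
  have "(A *v ((s + \<gamma> *\<^sub>R H) - (s + \<gamma> *\<^sub>R h))) \<bullet> (s' - p)
      \<le> sqnorm_wrt A ((s + \<gamma> *\<^sub>R H) - (s + \<gamma> *\<^sub>R h))"
    unfolding s'_def p_def by (rule prox_nonexpansive[OF g \<gamma> A v(1,2)])
  also have "(s + \<gamma> *\<^sub>R H) - (s + \<gamma> *\<^sub>R h) = \<gamma> *\<^sub>R (H - h)" by (simp add: algebra_simps)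
  also have "sqnorm_wrt A (\<gamma> *\<^sub>R (H - h)) \<le> \<gamma>\<^sup>2 * (v' * (norm (H - h))\<^sup>2)"
    unfolding sqnorm_wrt_scaleR by (intro mult_left_mono v) simp
  finally have 4: "\<gamma> * ((A *v H) \<bullet> (a - c)) - \<gamma> * ((A *v h) \<bullet> (a - c)) \<le> \<gamma>\<^sup>2 * (v' * (norm (H - h))\<^sup>2)"
    by (simp add: a_def c_def matrix_vector_mult_diff_distrib matrix_vector_mult_scaleR inner_diff_left
        algebra_simps)
  have 5: "sqnorm_wrt A (a - c) = sqnorm_wrt A a - 2 * ((A *v a) \<bullet> c) + sqnorm_wrt A c"
    by (rule sqnorm_wrt_diff[OF A])
  \<comment> \<open>In the metric \<open>A\<close> the quadratic terms add up to
    \<open>|a|^2 - <a,c> + |c|^2 = |a|^2 / 2 + D / 2\<close>. Dropping \<open>|a|^2 / 2\<close>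
    leaves the constant 1/2 of the descent coefficient.\<close>
  have "\<gamma> * W s' + \<gamma> * ?g s' + (D / 2 - q * D) \<le> \<gamma> * W s + \<gamma> * ?g s + \<gamma>\<^sup>2 * (v' * (norm (H - h))\<^sup>2)"
    using 1 2 3 4 5 nn[of a] D_def unfolding inner_diff_right right_diff_distrib by linarith
  also have "D / 2 - q * D = (1/2 - q) * D" by (simp add: left_diff_distrib)
  finally have "(\<gamma> * W s' + \<gamma> * ?g s' + (1/2 - q) * D) / \<gamma>
      \<le> (\<gamma> * W s + \<gamma> * ?g s + \<gamma>\<^sup>2 * (v' * (norm (H - h))\<^sup>2)) / \<gamma>"
    using \<gamma> by (intro divide_right_mono) auto
  then have "W s' + ?g s' + (1/2 - q) * D / \<gamma> \<le> W s + ?g s + \<gamma> * v' * (norm (H - h))\<^sup>2"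
    using \<gamma> by (simp add: add_divide_distrib power2_eq_square mult.assoc)
  moreover have "D = sqnorm_wrt A (p - s) + sqnorm_wrt A (s' - p)"
    by (simp add: D_def a_def c_def)
  ultimately show ?thesis
    using \<gamma> by (simp add: q_def power2_eq_square flip: add_divide_distrib)
qed

lemma borel_measurable_prox:
  fixes g :: "real^'q \<Rightarrow> ereal"
  assumes g: "proper_fun g" "lower_semicontinuous g" "convex_ereal_fun g" and \<gamma>: "0 < \<gamma>" and v: "0 < v"
    and A: "\<And>w. w \<in> space N \<Longrightarrow> transpose (A w) = A w"
      "\<And>w x. w \<in> space N \<Longrightarrow> v * (norm x)\<^sup>2 \<le> sqnorm_wrt (A w) x"
    and meas: "A \<in> borel_measurable N" "s \<in> borel_measurable N"
  shows "(\<lambda>w. prox (A w) \<gamma> g (s w)) \<in> borel_measurable N"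
proof -
  let ?K = "{(A::real^'q^'q, s::real^'q). transpose A = A \<and> (\<forall>x. v * (norm x)\<^sup>2 \<le> sqnorm_wrt A x)}"
  have "(\<lambda>w. (A w, s w)) \<in> N \<rightarrow>\<^sub>M restrict_space borel ?K"
    using A by (intro measurable_restrict_space2 borel_measurable_Pair meas) auto
  from measurable_compose[OF this borel_measurable_continuous_on_restrict[OF continuous_on_prox[OF g \<gamma> v]]]
  show ?thesis by simp
qed

section \<open>Uniform batches\<close>

text \<open>The support of \<open>uniform_batch\<close>; as a finite set it turns expectations over
  the batch into averages.\<close>

definition batch_lists :: "bool \<Rightarrow> nat \<Rightarrow> nat \<Rightarrow> nat list set" where
  "batch_lists repl n b = {l. length l = b \<and> set l \<subseteq> {1..n} \<and> (repl \<or> distinct l)}"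

lemma finite_batch_lists: "finite (batch_lists repl n b)"
  by (rule finite_subset[OF _ finite_lists_length_eq[of "{1..n}" b]]) (auto simp: batch_lists_def)

lemma batch_lists_nonempty:
  assumes "1 \<le> n" "repl \<or> b \<le> n"
  shows "batch_lists repl n b \<noteq> {}"
proof (cases repl)
  case True
  then have "replicate b 1 \<in> batch_lists repl n b" using assms by (auto simp: batch_lists_def)
  then show ?thesis by blast
next
  case False
  then have "[1..<Suc b] \<in> batch_lists repl n b" using assms by (auto simp: batch_lists_def simp del: upt_Suc)
  then show ?thesis by blast
qed

lemma batch_lists_nth: "l \<in> batch_lists repl n b \<Longrightarrow> j < b \<Longrightarrow> l ! j \<in> {1..n}"
  using nth_mem[of j l] unfolding batch_lists_def by blast

text \<open>Exchanging the labels \<open>i\<close> and \<open>i'\<close> throughout a list preserves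
  both sampling schemes and fixes \<open>k\<close>.\<close>

lemma card_batch_coord_swap:
  assumes i: "i \<in> {1..n}" "i' \<in> {1..n}" and j: "j < b" "j' < b" and k: "k \<noteq> i" "k \<noteq> i'"
  shows "card {l \<in> batch_lists repl n b. l ! j = i \<and> l ! j' = k}
       = card {l \<in> batch_lists repl n b. l ! j = i' \<and> l ! j' = k}"
    and "card {l \<in> batch_lists repl n b. l ! j = i} = card {l \<in> batch_lists repl n b. l ! j = i'}"
proof -
  let ?\<tau> = "\<lambda>x. if x = i then i' else if x = i' then i else x"
  have inv: "map ?\<tau> (map ?\<tau> l) = l" for l by (induction l) auto
  have inj: "inj ?\<tau>" by (rule injI) (auto split: if_splits)
  have "map ?\<tau> l \<in> batch_lists repl n b" if "l \<in> batch_lists repl n b" for l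
    using that i inj_on_subset[OF inj subset_UNIV] unfolding batch_lists_def
    by (auto simp: distinct_map split: if_splits)
  then have mem: "\<And>l. l \<in> batch_lists repl n b \<Longrightarrow> map ?\<tau> l \<in> batch_lists repl n b" .
  have nth: "map ?\<tau> l ! r = ?\<tau> (l ! r)" if "l \<in> batch_lists repl n b" "r < b" for l r
    using that by (simp add: batch_lists_def)
  show "card {l \<in> batch_lists repl n b. l ! j = i \<and> l ! j' = k}
       = card {l \<in> batch_lists repl n b. l ! j = i' \<and> l ! j' = k}"
    by (rule bij_betw_same_card, rule bij_betw_byWitness[where f = "map ?\<tau>" and f' = "map ?\<tau>"])
      (use inv mem nth j k in \<open>auto simp del: map_map\<close>)
  show "card {l \<in> batch_lists repl n b. l ! j = i} = card {l \<in> batch_lists repl n b. l ! j = i'}"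
    by (rule bij_betw_same_card, rule bij_betw_byWitness[where f = "map ?\<tau>" and f' = "map ?\<tau>"])
      (use inv mem nth j in \<open>auto simp del: map_map\<close>)
qed

text \<open>With replacement a single coordinate can be overwritten freely, which also covers the
  case that \<open>k\<close> is \<open>i\<close> or \<open>i'\<close>, out of reach of the
  relabelling.\<close>

lemma card_batch_coord_swap_repl:
  assumes i: "i \<in> {1..n}" "i' \<in> {1..n}" and j: "j < b" "j' < b" "j \<noteq> j'"
  shows "card {l \<in> batch_lists True n b. l ! j = i \<and> l ! j' = k}
       = card {l \<in> batch_lists True n b. l ! j = i' \<and> l ! j' = k}"
proof -
  have mem: "l[j := x] \<in> batch_lists True n b" if "l \<in> batch_lists True n b" "x \<in> {1..n}" for l x
    using that set_update_subset_insert[of l j x] unfolding batch_lists_def by auto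
  have len: "length l = b" if "l \<in> batch_lists True n b" for l using that by (simp add: batch_lists_def)
  show ?thesis
    by (rule bij_betw_same_card,
        rule bij_betw_byWitness[where f = "\<lambda>l. l[j := i']" and f' = "\<lambda>l. l[j := i]"])
      (use mem len i j in auto)
qed

text \<open>Each single draw is uniform in both schemes: all fibres have the same size
  \<open>N\<close>, and the constant function 1 shows that \<open>N\<close> is the number of lists
  divided by \<open>n\<close>.\<close>

lemma sum_batch_coord:
  fixes f :: "nat \<Rightarrow> real"
  assumes j: "j < b" and n: "1 \<le> n"
  shows "(\<Sum>l\<in>batch_lists repl n b. f (l ! j))
       = real (card (batch_lists repl n b)) / real n * (\<Sum>i=1..n. f i)"
proof -
  let ?L = "batch_lists repl n b"
  define N where "N = card {l \<in> ?L. l ! j = 1}"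
  \<comment> \<open>\<open>i + 2\<close> is a dummy third index, different from both
    \<open>i\<close> and 1.\<close>
  have N: "card {l \<in> ?L. l ! j = i} = N" if "i \<in> {1..n}" for i
    using card_batch_coord_swap(2)[of i n 1 j b j "i + 2"] that j n unfolding N_def by auto
  have grp: "(\<Sum>l\<in>?L. h (l ! j)) = real N * (\<Sum>i=1..n. h i)" for h :: "nat \<Rightarrow> real"
  proof -
    have "(\<Sum>l\<in>?L. h (l ! j)) = (\<Sum>i=1..n. \<Sum>l\<in>{l \<in> ?L. l ! j = i}. h (l ! j))"
      by (rule sum.group[symmetric]) (use batch_lists_nth j in \<open>auto simp: finite_batch_lists\<close>)
    also have "\<dots> = (\<Sum>i=1..n. real N * h i)"
      using N by (intro sum.cong) auto
    finally show ?thesis by (simp add: sum_distrib_left)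
  qed
  have "real (card ?L) = real N * real n" using grp[of "\<lambda>_. 1"] by simp
  then show ?thesis using grp[of f] n by simp
qed

text \<open>Fix the value \<open>k\<close> of draw \<open>j'\<close>. With replacement, draw
  \<open>j\<close> takes every index equally often and the centered sum vanishes. Without, it takes
  every index except \<open>k\<close> equally often, say \<open>m\<close> times, and
  \<open>- m |c k|^2\<close> is left.\<close>

lemma sum_batch_cross_nonpos:
  fixes c :: "nat \<Rightarrow> 'a::real_inner"
  assumes c: "(\<Sum>i=1..n. c i) = 0" and j: "j < b" "j' < b" "j \<noteq> j'"
  shows "(\<Sum>l\<in>batch_lists repl n b. c (l ! j) \<bullet> c (l ! j')) \<le> 0"
proof -
  let ?L = "batch_lists repl n b"
  define N where "N k i = card {l \<in> ?L. l ! j = i \<and> l ! j' = k}" for k i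
  have inner: "(\<Sum>l\<in>{l \<in> ?L. l ! j' = k}. c (l ! j)) = (\<Sum>i=1..n. real (N k i) *\<^sub>R c i)" for k
  proof -
    have "(\<Sum>l\<in>{l \<in> ?L. l ! j' = k}. c (l ! j))
        = (\<Sum>i=1..n. \<Sum>l\<in>{l \<in> {l \<in> ?L. l ! j' = k}. l ! j = i}. c (l ! j))"
      by (rule sum.group[symmetric]) (use batch_lists_nth j in \<open>auto simp: finite_batch_lists\<close>)
    also have "\<dots> = (\<Sum>i=1..n. \<Sum>l\<in>{l \<in> ?L. l ! j = i \<and> l ! j' = k}. c i)"
      by (intro sum.cong) auto
    finally show ?thesis by (simp add: N_def sum_constant_scaleR)
  qed
  have neg: "(\<Sum>i=1..n. real (N k i) *\<^sub>R c i) \<bullet> c k \<le> 0" if k: "k \<in> {1..n}" for k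
  proof (cases repl)
    case True
    have "N k i = N k k" if "i \<in> {1..n}" for i
      using card_batch_coord_swap_repl[OF that k j] True by (simp add: N_def)
    then have "(\<Sum>i=1..n. real (N k i) *\<^sub>R c i) = real (N k k) *\<^sub>R (\<Sum>i=1..n. c i)"
      unfolding scaleR_sum_right by (intro sum.cong) auto
    then show ?thesis using c by simp
  next
    case False
    have "{l \<in> ?L. l ! j = k \<and> l ! j' = k} = {}"
      using False j by (auto simp: batch_lists_def nth_eq_iff_index_eq)
    then have kk: "N k k = 0" unfolding N_def by (metis card.empty)
    obtain m where m: "\<And>i. i \<in> {1..n} - {k} \<Longrightarrow> N k i = m"
    proof (cases "{1..n} - {k} = {}")
      case False
      then obtain i0 where i0: "i0 \<in> {1..n} - {k}" by blast
      have "N k i = N k i0" if "i \<in> {1..n} - {k}" for i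
        using card_batch_coord_swap(1)[of i n i0 j b j' k] that i0 j by (simp add: N_def)
      then show ?thesis using that by blast
    qed (use that in blast)
    have "(\<Sum>i=1..n. real (N k i) *\<^sub>R c i) = (\<Sum>i\<in>{1..n} - {k}. real (N k i) *\<^sub>R c i)"
      using k kk by (simp add: sum.remove)
    also have "\<dots> = real m *\<^sub>R (\<Sum>i\<in>{1..n} - {k}. c i)"
      unfolding scaleR_sum_right using m by (intro sum.cong) auto
    also have "(\<Sum>i\<in>{1..n} - {k}. c i) = - c k"
      using c k by (simp add: sum_diff1)
    finally show ?thesis by simp
  qed
  have "(\<Sum>l\<in>?L. c (l ! j) \<bullet> c (l ! j'))
      = (\<Sum>k=1..n. \<Sum>l\<in>{l \<in> ?L. l ! j' = k}. c (l ! j) \<bullet> c (l ! j'))"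
    by (rule sum.group[symmetric]) (use batch_lists_nth j in \<open>auto simp: finite_batch_lists\<close>)
  also have "\<dots> = (\<Sum>k=1..n. (\<Sum>l\<in>{l \<in> ?L. l ! j' = k}. c (l ! j)) \<bullet> c k)"
    by (intro sum.cong) (auto simp: inner_sum_left)
  also have "\<dots> \<le> 0" unfolding inner by (rule sum_nonpos) (rule neg)
  finally show ?thesis .
qed

lemma power2_norm_sum:
  fixes x :: "'i \<Rightarrow> 'a::real_inner"
  shows "(norm (\<Sum>j\<in>J. x j))\<^sup>2 = (\<Sum>j\<in>J. \<Sum>j'\<in>J. x j \<bullet> x j')"
  by (simp add: power2_norm_eq_inner inner_sum_left inner_sum_right) (rule sum.swap)

text \<open>Sampling without replacement only helps: the covariance of two distinct draws is
  nonpositive.\<close>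

lemma batch_mean_square:
  fixes c :: "nat \<Rightarrow> 'a::real_inner"
  assumes n: "1 \<le> n" and b: "1 \<le> b"
    and c: "(\<Sum>i=1..n. c i) = 0"
  shows "(\<Sum>l\<in>batch_lists repl n b. (norm (u + (1 / real b) *\<^sub>R (\<Sum>j<b. c (l ! j))))\<^sup>2)
       \<le> real (card (batch_lists repl n b))
          * ((norm u)\<^sup>2 + (\<Sum>i=1..n. (norm (c i))\<^sup>2) / (real n * real b))"
proof -
  let ?L = "batch_lists repl n b"
  have sq: "(norm (u + r *\<^sub>R z))\<^sup>2 = (norm u)\<^sup>2 + 2 * r * (u \<bullet> z) + r\<^sup>2 * (norm z)\<^sup>2" for r z
    unfolding power2_norm_eq_inner
    by (simp add: inner_add_left inner_add_right inner_commute power2_eq_square algebra_simps)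
  have "(\<Sum>l\<in>?L. (norm (u + (1 / real b) *\<^sub>R (\<Sum>j<b. c (l ! j))))\<^sup>2)
      = (\<Sum>l\<in>?L. (norm u)\<^sup>2 + 2 / real b * (\<Sum>j<b. u \<bullet> c (l ! j))
          + (1 / real b)\<^sup>2 * (\<Sum>j<b. \<Sum>j'<b. c (l ! j) \<bullet> c (l ! j')))"
    unfolding sq power2_norm_sum by (simp add: inner_sum_right)
  also have "\<dots> = real (card ?L) * (norm u)\<^sup>2 + 2 / real b * (\<Sum>j<b. \<Sum>l\<in>?L. u \<bullet> c (l ! j))
          + (1 / real b)\<^sup>2 * (\<Sum>j<b. \<Sum>j'<b. \<Sum>l\<in>?L. c (l ! j) \<bullet> c (l ! j'))"
    by (simp add: sum.distrib sum_distrib_left sum.swap[of _ _ ?L])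
  \<comment> \<open>A single draw is uniform and \<open>c\<close> is centered, so the linear term
    drops out.\<close>
  also have "(\<Sum>j<b. \<Sum>l\<in>?L. u \<bullet> c (l ! j)) = 0"
    using sum_batch_coord[OF _ n, of _ b "\<lambda>i. u \<bullet> c i" repl] c by (simp flip: inner_sum_right)
  finally have eq: "(\<Sum>l\<in>?L. (norm (u + (1 / real b) *\<^sub>R (\<Sum>j<b. c (l ! j))))\<^sup>2)
      = real (card ?L) * (norm u)\<^sup>2
        + (1 / real b)\<^sup>2 * (\<Sum>j<b. \<Sum>j'<b. \<Sum>l\<in>?L. c (l ! j) \<bullet> c (l ! j'))" by simp
  have "(\<Sum>j<b. \<Sum>j'<b. \<Sum>l\<in>?L. c (l ! j) \<bullet> c (l ! j'))
      \<le> (\<Sum>j<b. \<Sum>j'<b. if j' = j then real (card ?L) / real n * (\<Sum>i=1..n. (norm (c i))\<^sup>2) else 0)"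
    using sum_batch_coord[OF _ n, of _ b "\<lambda>i. (norm (c i))\<^sup>2" repl] sum_batch_cross_nonpos[OF c, of _ b]
    by (intro sum_mono) (auto simp: power2_norm_eq_inner)
  also have "\<dots> = real b * (real (card ?L) / real n * (\<Sum>i=1..n. (norm (c i))\<^sup>2))" by simp
  finally have "(1 / real b)\<^sup>2 * (\<Sum>j<b. \<Sum>j'<b. \<Sum>l\<in>?L. c (l ! j) \<bullet> c (l ! j'))
      \<le> (1 / real b)\<^sup>2 * (real b * (real (card ?L) / real n * (\<Sum>i=1..n. (norm (c i))\<^sup>2)))"
    by (intro mult_left_mono) auto
  also have "\<dots> = real (card ?L) * ((\<Sum>i=1..n. (norm (c i))\<^sup>2) / (real n * real b))"
    using b by (simp add: power2_eq_square)
  finally show ?thesis unfolding eq distrib_left by simp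
qed

section \<open>Conditional independence\<close>

lemma sets_vimage_algebra_subset:
  assumes "f \<in> measurable N K" "space N = \<Omega>"
  shows "sets (vimage_algebra \<Omega> f K) \<subseteq> sets N"
  using assms measurable_sets[OF assms(1)] measurable_space[OF assms(1)]
  by (subst sets_vimage_algebra2) auto

lemma borel_measurable_select:
  assumes J: "J \<in> measurable N (count_space UNIV)" "\<And>w. w \<in> space N \<Longrightarrow> J w \<in> I" "countable I"
    and F: "\<And>i. i \<in> I \<Longrightarrow> F i \<in> borel_measurable N"
  shows "(\<lambda>w. F (J w) w) \<in> borel_measurable N"
  by (rule measurable_compose_countable'[OF F _ J(3)]) (use J(1,2) in \<open>auto simp: measurable_def\<close>)

context prob_space
begin

lemma subalgebra_sigma_finite:
  assumes "subalgebra M F"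
  shows "sigma_finite_subalgebra M F"
proof -
  interpret finite_measure_subalgebra M F
    using assms by unfold_locales
  show ?thesis by (rule sigma_finite_subalgebra_axioms)
qed

lemma real_cond_exp_indicator_bounds:
  assumes F: "subalgebra M F" and A: "A \<in> events"
  shows "AE w in M. \<bar>real_cond_exp M F (indicator A) w\<bar> \<le> 1"
proof -
  interpret F: sigma_finite_subalgebra M F by (rule subalgebra_sigma_finite[OF F])
  have int: "integrable M (indicator A :: _ \<Rightarrow> real)" using A by (simp add: emeasure_eq_measure)
  have "AE w in M. real_cond_exp M F (indicator A) w \<ge> 0"
    by (rule F.real_cond_exp_ge_c[OF int]) auto
  moreover have "AE w in M. real_cond_exp M F (indicator A) w \<le> 1"
    by (rule F.real_cond_exp_le_c[OF int]) auto
  ultimately show ?thesis by eventually_elim auto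
qed

text \<open>Testing against events of \<open>\<B>\<close> first identifies \<open>E[1\<^sub>C | \<A>]\<close> with \<open>E[E[1\<^sub>C | F] | \<A>]\<close>, which
  extends the product rule from events of \<open>\<A>\<close> to integrable functions without approximation by
  simple functions; the same argument with the roles exchanged then treats \<open>Y\<close>.\<close>

lemma cond_indep_expectation:
  fixes X Y :: "'a \<Rightarrow> real"
  assumes F: "subalgebra M F" and \<A>: "subalgebra M \<A>" and \<B>: "subalgebra M \<B>"
    and ci: "\<And>A C. A \<in> sets \<A> \<Longrightarrow> C \<in> sets \<B> \<Longrightarrow> AE w in M.
        real_cond_exp M F (indicator (A \<inter> C)) w
        = real_cond_exp M F (indicator A) w * real_cond_exp M F (indicator C) w"
    and X: "X \<in> borel_measurable \<A>" "integrable M X"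
    and Y: "Y \<in> borel_measurable \<B>"
    and XY: "integrable M (\<lambda>w. Y w * X w)" "integrable M (\<lambda>w. Y w * real_cond_exp M F X w)"
  shows "(LINT w|M. Y w * X w) = (LINT w|M. Y w * real_cond_exp M F X w)"
proof -
  interpret F: sigma_finite_subalgebra M F by (rule subalgebra_sigma_finite[OF F])
  interpret A: sigma_finite_subalgebra M \<A> by (rule subalgebra_sigma_finite[OF \<A>])
  interpret B: sigma_finite_subalgebra M \<B> by (rule subalgebra_sigma_finite[OF \<B>])
  have evA: "A \<in> events" if "A \<in> sets \<A>" for A using that \<A> by (auto simp: subalgebra_def)
  have evB: "A \<in> events" if "A \<in> sets \<B>" for A using that \<B> by (auto simp: subalgebra_def)
  have ind: "integrable M (indicator A :: _ \<Rightarrow> real)" if "A \<in> events" for A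
    using that by (simp add: emeasure_eq_measure)
  have FM: "real_cond_exp M F Z \<in> borel_measurable M" for Z
    by (rule borel_measurable_cond_exp2)
  have step: "(LINT w|M. indicator C w * X w) = (LINT w|M. indicator C w * real_cond_exp M F X w)"
    if C: "C \<in> sets \<B>" for C
  proof -
    let ?r = "real_cond_exp M F (indicator C)"
    have intr: "integrable M ?r" using F.real_cond_exp_int(1)[OF ind[OF evB[OF C]]] .
    have 1: "(LINT w|M. indicator A w * indicator C w) = (LINT w|M. indicator A w * ?r w)"
      if A: "A \<in> sets \<A>" for A
    proof -
      have "(LINT w|M. indicator A w * indicator C w) = (LINT w|M. indicator (A \<inter> C) w :: real)"
        by (simp add: indicator_inter_arith)
      also have "\<dots> = (LINT w|M. real_cond_exp M F (indicator (A \<inter> C)) w)"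
        by (rule F.real_cond_exp_int(2)[symmetric]) (use evA[OF A] evB[OF C] in \<open>intro ind sets.Int\<close>)
      also have "\<dots> = (LINT w|M. ?r w * real_cond_exp M F (indicator A) w)"
        by (rule integral_cong_AE) (use ci[OF A C] FM in \<open>auto simp: mult.commute\<close>)
      also have "\<dots> = (LINT w|M. ?r w * indicator A w)"
        by (rule F.real_cond_exp_intg(2))
          (use evA[OF A] intr integrable_real_mult_indicator[OF evA[OF A] intr] in auto)
      finally show ?thesis by (simp add: mult.commute)
    qed
    have 2: "AE w in M. real_cond_exp M \<A> (indicator C) w = real_cond_exp M \<A> ?r w"
    proof (rule A.real_cond_exp_charact)
      fix A assume A: "A \<in> sets \<A>"
      have "set_lebesgue_integral M A (indicator C) = (set_lebesgue_integral M A ?r :: real)"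
        using 1[OF A] by (simp add: set_lebesgue_integral_def)
      also have "\<dots> = set_lebesgue_integral M A (real_cond_exp M \<A> ?r)"
        by (rule A.real_cond_exp_intA[OF intr A])
      finally show "set_lebesgue_integral M A (indicator C)
          = (set_lebesgue_integral M A (real_cond_exp M \<A> ?r) :: real)" .
    qed (use ind evB[OF C] intr A.real_cond_exp_int(1)[OF intr] in auto)
    have XM: "X \<in> borel_measurable M" using X(2) by auto
    have XC: "integrable M (\<lambda>w. X w * indicator C w)"
      by (rule integrable_real_mult_indicator[OF evB[OF C] X(2)])
    have bd: "AE w in M. \<bar>?r w\<bar> \<le> 1" by (rule real_cond_exp_indicator_bounds[OF F evB[OF C]])
    have Xr: "integrable M (\<lambda>w. X w * ?r w)"
      by (rule Bochner_Integration.integrable_bound[OF X(2)])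
        (use XM FM bd in \<open>auto simp: abs_mult mult_left_le elim!: eventually_mono\<close>)
    have rC: "integrable M (\<lambda>w. real_cond_exp M F X w * indicator C w)"
      by (rule integrable_real_mult_indicator[OF evB[OF C] F.real_cond_exp_int(1)[OF X(2)]])
    \<comment> \<open>\<open>X\<close> is measurable for \<A>, which allows
      \<open>indicator C\<close> to be replaced by \<open>?r\<close>; \<open>?r\<close> is
      measurable for \<open>F\<close>, which then moves the conditioning over to
      \<open>X\<close>.\<close>
    have "(LINT w|M. X w * indicator C w) = (LINT w|M. X w * real_cond_exp M \<A> (indicator C) w)"
      by (rule A.real_cond_exp_intg(2)[symmetric]) (use XC X(1) evB[OF C] in auto)
    also have "\<dots> = (LINT w|M. X w * real_cond_exp M \<A> ?r w)"
      by (rule integral_cong_AE) (use 2 XM in auto)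
    also have "\<dots> = (LINT w|M. X w * ?r w)"
      by (rule A.real_cond_exp_intg(2)) (use Xr X(1) in auto)
    also have "\<dots> = (LINT w|M. ?r w * X w)" by (simp add: mult.commute)
    also have "\<dots> = (LINT w|M. ?r w * real_cond_exp M F X w)"
      by (rule F.real_cond_exp_intg(2)[symmetric]) (use Xr XM in \<open>auto simp: mult.commute\<close>)
    also have "\<dots> = (LINT w|M. real_cond_exp M F X w * ?r w)" by (simp add: mult.commute)
    also have "\<dots> = (LINT w|M. real_cond_exp M F X w * indicator C w)"
      by (rule F.real_cond_exp_intg(2)) (use rC evB[OF C] in auto)
    finally show ?thesis by (simp add: mult.commute)
  qed
  have Fint: "integrable M (real_cond_exp M F X)" by (rule F.real_cond_exp_int(1)[OF X(2)])
  have 3: "AE w in M. real_cond_exp M \<B> X w = real_cond_exp M \<B> (real_cond_exp M F X) w"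
  proof (rule B.real_cond_exp_charact)
    fix C assume C: "C \<in> sets \<B>"
    have "set_lebesgue_integral M C X = set_lebesgue_integral M C (real_cond_exp M F X)"
      using step[OF C] by (simp add: set_lebesgue_integral_def)
    also have "\<dots> = set_lebesgue_integral M C (real_cond_exp M \<B> (real_cond_exp M F X))"
      by (rule B.real_cond_exp_intA[OF Fint C])
    finally show "set_lebesgue_integral M C X
        = set_lebesgue_integral M C (real_cond_exp M \<B> (real_cond_exp M F X))" .
  qed (use X Fint B.real_cond_exp_int(1)[OF Fint] in auto)
  have YM: "Y \<in> borel_measurable M" using measurable_from_subalg[OF \<B> Y] .
  have "(LINT w|M. Y w * X w) = (LINT w|M. Y w * real_cond_exp M \<B> X w)"
    by (rule B.real_cond_exp_intg(2)[symmetric]) (use XY X Y in auto)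
  also have "\<dots> = (LINT w|M. Y w * real_cond_exp M \<B> (real_cond_exp M F X) w)"
    by (rule integral_cong_AE) (use 3 YM in auto)
  also have "\<dots> = (LINT w|M. Y w * real_cond_exp M F X w)"
    by (rule B.real_cond_exp_intg(2)) (use XY Y in auto)
  finally show ?thesis .
qed

end

lemma cond_indep_setD:
  assumes "cond_indep_set M F \<A> \<B>" "A \<in> \<A>" "C \<in> \<B>"
  shows "AE w in M. real_cond_exp M F (indicator (A \<inter> C)) w
        = real_cond_exp M F (indicator A) w * real_cond_exp M F (indicator C) w"
proof -
  have "case_bool A C \<in> Pi UNIV (case_bool \<A> \<B>)" "finite (UNIV :: bool set)" "(UNIV :: bool set) \<noteq> {}"
    using assms(2,3) by (auto split: bool.split)
  then have "AE w in M. real_cond_exp M F (indicator (\<Inter>j\<in>UNIV. case_bool A C j)) w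
      = (\<Prod>j\<in>UNIV. real_cond_exp M F (indicator (case_bool A C j)) w)"
    using assms(1) unfolding cond_indep_set_def cond_indep_sets_def
    by blast
  then show ?thesis by (simp add: UNIV_bool Int_commute mult.commute)
qed

lemma cond_indep_setsD2:
  assumes "cond_indep_sets M F \<A> I" "i \<in> I" "j \<in> I" "i \<noteq> j" "A \<in> \<A> i" "C \<in> \<A> j"
  shows "AE w in M. real_cond_exp M F (indicator (A \<inter> C)) w
        = real_cond_exp M F (indicator A) w * real_cond_exp M F (indicator C) w"
proof -
  let ?f = "\<lambda>k. if k = i then A else C"
  have "?f \<in> Pi {i, j} \<A>" "{i, j} \<subseteq> I" "{i, j} \<noteq> {}" "finite {i, j}" using assms by auto
  then have "AE w in M. real_cond_exp M F (indicator (\<Inter>k\<in>{i, j}. ?f k)) w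
      = (\<Prod>k\<in>{i, j}. real_cond_exp M F (indicator (?f k)) w)"
    using assms(1) unfolding cond_indep_sets_def by blast
  then show ?thesis using assms(4) by (simp add: Int_commute)
qed

section \<open>Square-integrable functions and elementary inequalities\<close>

text \<open>Young's inequality with weight \<open>t\<close>: expand
  \<open>|t a - c|^2 \<ge> 0\<close> and divide by \<open>t\<close>.\<close>

lemma norm_add_squared_weighted_le:
  fixes a c :: "'a::real_inner"
  assumes "0 < t"
  shows "(norm (a + c))\<^sup>2 \<le> (1 + t) * (norm a)\<^sup>2 + (1 + 1 / t) * (norm c)\<^sup>2"
proof -
  have "0 \<le> (norm (t *\<^sub>R a - c))\<^sup>2" by simp
  also have "\<dots> = t\<^sup>2 * (norm a)\<^sup>2 - 2 * t * (a \<bullet> c) + (norm c)\<^sup>2"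
    unfolding power2_norm_eq_inner
    by (simp add: inner_diff_left inner_diff_right inner_commute power2_eq_square algebra_simps)
  finally have "2 * t * (a \<bullet> c) / t \<le> (t\<^sup>2 * (norm a)\<^sup>2 + (norm c)\<^sup>2) / t"
    using assms by (intro divide_right_mono) auto
  then have "2 * (a \<bullet> c) \<le> t * (norm a)\<^sup>2 + (norm c)\<^sup>2 / t"
    using assms by (simp add: add_divide_distrib power2_eq_square mult.assoc)
  moreover have "(norm (a + c))\<^sup>2 = (norm a)\<^sup>2 + 2 * (a \<bullet> c) + (norm c)\<^sup>2"
    unfolding power2_norm_eq_inner by (simp add: inner_add_left inner_add_right inner_commute)
  moreover have "(1 + t) * (norm a)\<^sup>2 + (1 + 1 / t) * (norm c)\<^sup>2
      = (norm a)\<^sup>2 + (t * (norm a)\<^sup>2 + (norm c)\<^sup>2 / t) + (norm c)\<^sup>2"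
    by (simp add: distrib_right)
  ultimately show ?thesis by linarith
qed

text \<open>Centering lowers the sum of squares by exactly \<open>|s|^2 / n\<close>, with
  \<open>s\<close> the sum of the vectors.\<close>

lemma sum_norm_centered_le:
  fixes d :: "nat \<Rightarrow> 'a::real_inner"
  assumes "1 \<le> n"
  shows "(\<Sum>i=1..n. (norm (d i - (1 / real n) *\<^sub>R (\<Sum>i=1..n. d i)))\<^sup>2) \<le> (\<Sum>i=1..n. (norm (d i))\<^sup>2)"
proof -
  define s where "s = (\<Sum>i=1..n. d i)"
  have "(\<Sum>i=1..n. (norm (d i - (1 / real n) *\<^sub>R s))\<^sup>2)
      = (\<Sum>i=1..n. (norm (d i))\<^sup>2 - 2 / real n * (d i \<bullet> s) + (1 / real n)\<^sup>2 * (s \<bullet> s))"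
    unfolding power2_norm_eq_inner
    by (intro sum.cong) (auto simp: inner_diff_left inner_diff_right inner_commute power2_eq_square)
  also have "\<dots> = (\<Sum>i=1..n. (norm (d i))\<^sup>2) - 2 / real n * (s \<bullet> s) + real n * ((1 / real n)\<^sup>2 * (s \<bullet> s))"
    by (simp add: sum.distrib sum_subtractf s_def inner_sum_left flip: sum_distrib_left sum_divide_distrib)
  also have "\<dots> = (\<Sum>i=1..n. (norm (d i))\<^sup>2) - (s \<bullet> s) / real n"
    using assms by (simp add: power2_eq_square field_simps)
  finally show ?thesis by (simp add: s_def)
qed

lemma sum_norm_add_squared_le:
  fixes a c :: "nat \<Rightarrow> 'a::real_inner"
  assumes n: "1 \<le> n" and b: "1 \<le> b" and \<tau>: "0 \<le> \<tau>"
    and a: "(\<Sum>i=1..n. (norm (a i))\<^sup>2) / real n \<le> \<alpha>"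
    and c: "(\<Sum>i=1..n. (norm (c i))\<^sup>2) / real n \<le> \<tau>\<^sup>2"
  shows "(\<Sum>i=1..n. (norm (a i + c i))\<^sup>2) / (real n * real b)
      \<le> (1 + 2 * \<tau> / sqrt b) / real b * \<alpha> + 2 * \<tau> / sqrt b + \<tau>\<^sup>2 / real b"
proof -
  define t where "t = \<tau> / sqrt b"
  have sb: "0 < sqrt b" "sqrt b * sqrt b = real b" using b by auto
  have \<alpha>: "0 \<le> \<alpha>" using a by (rule order_trans[rotated]) (simp add: sum_nonneg)
  have "(\<Sum>i=1..n. (norm (a i + c i))\<^sup>2) / real n \<le> (1 + t) * \<alpha> + \<tau>\<^sup>2 + \<tau> * sqrt b"
  proof (cases "\<tau> = 0")
    case True
    then have "(\<Sum>i=1..n. (norm (c i))\<^sup>2) \<le> 0" using c n by (simp add: field_simps)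
    then have "c i = 0" if "i \<in> {1..n}" for i
      using that sum_nonneg_eq_0_iff[of "{1..n}" "\<lambda>i. (norm (c i))\<^sup>2"] sum_nonneg[of "{1..n}" "\<lambda>i. (norm (c i))\<^sup>2"]
      by auto
    then show ?thesis using a True by (simp add: t_def)
  next
    case False
    then have t: "0 < t" using \<tau> sb by (simp add: t_def)
    have "(\<Sum>i=1..n. (norm (a i + c i))\<^sup>2)
        \<le> (\<Sum>i=1..n. (1 + t) * (norm (a i))\<^sup>2 + (1 + 1 / t) * (norm (c i))\<^sup>2)"
      by (intro sum_mono norm_add_squared_weighted_le t)
    then have "(\<Sum>i=1..n. (norm (a i + c i))\<^sup>2) / real n
        \<le> (\<Sum>i=1..n. (1 + t) * (norm (a i))\<^sup>2 + (1 + 1 / t) * (norm (c i))\<^sup>2) / real n"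
      by (intro divide_right_mono) auto
    also have "\<dots> = (1 + t) * ((\<Sum>i=1..n. (norm (a i))\<^sup>2) / real n) + (1 + 1 / t) * ((\<Sum>i=1..n. (norm (c i))\<^sup>2) / real n)"
      unfolding sum.distrib add_divide_distrib sum_distrib_left[symmetric] by simp
    also have "\<dots> \<le> (1 + t) * \<alpha> + (1 + 1 / t) * \<tau>\<^sup>2"
      using t by (intro add_mono mult_left_mono a c) auto
    also have "(1 + 1 / t) * \<tau>\<^sup>2 = \<tau>\<^sup>2 + \<tau> * sqrt b"
      using False \<tau> by (simp add: t_def power2_eq_square field_simps)
    finally show ?thesis by simp
  qed
  then have "(\<Sum>i=1..n. (norm (a i + c i))\<^sup>2) / real n / real b \<le> ((1 + t) * \<alpha> + \<tau>\<^sup>2 + \<tau> * sqrt b) / real b"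
    by (intro divide_right_mono) auto
  moreover have "((1 + t) * \<alpha> + \<tau>\<^sup>2 + \<tau> * sqrt b) / real b = (1 + t) / real b * \<alpha> + \<tau>\<^sup>2 / real b + t"
  proof -
    have "\<tau> * sqrt b / real b = t"
      using sb b by (simp add: t_def frac_eq_eq mult.assoc)
    then show ?thesis by (simp add: add_divide_distrib distrib_right)
  qed
  \<comment> \<open>Slack that rounds the constants up to the factors 2 of the stated bound.\<close>
  moreover have t: "t \<le> 2 * t"
  proof -
    have "0 \<le> t" using \<tau> sb by (simp add: t_def)
    then show ?thesis by simp
  qed
  moreover have "(1 + t) / real b * \<alpha> \<le> (1 + 2 * t) / real b * \<alpha>"
    using t \<alpha> by (intro mult_right_mono divide_right_mono) auto
  moreover have eq: "2 * \<tau> / sqrt b = 2 * t" by (simp add: t_def)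
  moreover have "(\<Sum>i=1..n. (norm (a i + c i))\<^sup>2) / real n / real b = (\<Sum>i=1..n. (norm (a i + c i))\<^sup>2) / (real n * real b)"
    by simp
  ultimately show ?thesis unfolding eq by linarith
qed

text \<open>The cross term \<open>2 \<beta> |e|\<close> is at most
  \<open>\<beta> (2 |e|^2 + 2)\<close>; this produces the growth factor \<open>1 + 2 \<beta>\<close>
  that the step size condition matches.\<close>

lemma norm_add_bias_squared_le:
  fixes e m :: "'a::real_inner"
  assumes "norm m \<le> \<beta>"
  shows "(norm (e + m))\<^sup>2 \<le> (1 + 2 * \<beta>) * (norm e)\<^sup>2 + 2 * \<beta> + \<beta>\<^sup>2"
proof -
  have \<beta>: "0 \<le> \<beta>" using assms norm_ge_zero by (rule order_trans[rotated])
  have "norm (e + m) \<le> norm e + \<beta>" using norm_triangle_ineq[of e m] assms by linarith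
  then have "(norm (e + m))\<^sup>2 \<le> (norm e + \<beta>)\<^sup>2" by (intro power_mono) auto
  also have "\<dots> = (norm e)\<^sup>2 + \<beta> * (2 * norm e) + \<beta>\<^sup>2" by (simp add: power2_eq_square algebra_simps)
  also have "\<beta> * (2 * norm e) \<le> \<beta> * (2 * (norm e)\<^sup>2 + 2)"
  proof (rule mult_left_mono[OF _ \<beta>])
    show "2 * norm e \<le> 2 * (norm e)\<^sup>2 + 2"
      using sum_squares_bound[of "norm e" 1] zero_le_power2[of "norm e"]
      unfolding power_one mult_1_right by linarith
  qed
  finally show ?thesis by (simp add: algebra_simps)
qed

definition square_integrable :: "'w measure \<Rightarrow> ('w \<Rightarrow> 'a::euclidean_space) \<Rightarrow> bool" where
  "square_integrable M f \<longleftrightarrow> f \<in> borel_measurable M \<and> integrable M (\<lambda>w. (norm (f w))\<^sup>2)"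

lemma square_integrableD:
  assumes "square_integrable M f"
  shows "f \<in> borel_measurable M" "integrable M (\<lambda>w. (norm (f w))\<^sup>2)"
  using assms by (auto simp: square_integrable_def)

lemma square_integrable_bound:
  assumes "square_integrable M f" "h \<in> borel_measurable M" "AE w in M. norm (h w) \<le> norm (f w)"
  shows "square_integrable M h"
  unfolding square_integrable_def
proof
  show "integrable M (\<lambda>w. (norm (h w))\<^sup>2)"
    by (rule Bochner_Integration.integrable_bound[OF square_integrableD(2)[OF assms(1)]])
      (use assms(2,3) in \<open>auto simp: power_mono elim!: eventually_mono\<close>)
qed fact

lemma square_integrable_cong_AE:
  assumes "square_integrable M f" "h \<in> borel_measurable M" "AE w in M. f w = h w"
  shows "square_integrable M h"
  by (rule square_integrable_bound[OF assms(1,2)]) (use assms(3) in \<open>auto elim: eventually_mono\<close>)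

lemma square_integrable_scaleR [intro]:
  assumes "square_integrable M f"
  shows "square_integrable M (\<lambda>w. c *\<^sub>R f w)"
  using assms by (auto simp: square_integrable_def power_mult_distrib)

lemma square_integrable_add [intro]:
  assumes "square_integrable M f" "square_integrable M h"
  shows "square_integrable M (\<lambda>w. f w + h w)"
proof -
  have "integrable M (\<lambda>w. 2 * (norm (f w))\<^sup>2 + 2 * (norm (h w))\<^sup>2)"
    using assms by (auto simp: square_integrable_def)
  then have "integrable M (\<lambda>w. (norm (f w + h w))\<^sup>2)"
    by (rule Bochner_Integration.integrable_bound)
      (use assms norm_add_squared_weighted_le[of 1] in \<open>auto simp: square_integrable_def\<close>)
  then show ?thesis using assms by (auto simp: square_integrable_def)
qed

lemma square_integrable_diff [intro]:
  assumes "square_integrable M f" "square_integrable M h"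
  shows "square_integrable M (\<lambda>w. f w - h w)"
  using square_integrable_add[OF assms(1) square_integrable_scaleR[OF assms(2), of "-1"]] by simp

lemma square_integrable_sum:
  assumes "\<And>i. i \<in> I \<Longrightarrow> square_integrable M (f i)"
  shows "square_integrable M (\<lambda>w. \<Sum>i\<in>I. f i w)"
  using assms
proof (induction I rule: infinite_finite_induct)
  case (insert i I)
  then show ?case by (simp add: square_integrable_add)
qed (simp_all add: square_integrable_def)

lemma integrable_inner_square_integrable:
  assumes "square_integrable M f" "square_integrable M h"
  shows "integrable M (\<lambda>w. f w \<bullet> h w)"
proof -
  have "integrable M (\<lambda>w. (norm (f w))\<^sup>2 + (norm (h w))\<^sup>2)"
    using assms by (auto simp: square_integrable_def)
  then show ?thesis
  proof (rule Bochner_Integration.integrable_bound)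
    have "\<bar>x \<bullet> y\<bar> \<le> (norm x)\<^sup>2 + (norm y)\<^sup>2" for x y :: 'b
      using Cauchy_Schwarz_ineq2[of x y] sum_squares_bound[of "norm x" "norm y"]
        mult_nonneg_nonneg[OF norm_ge_zero[of x] norm_ge_zero[of y]] by linarith
    then show "AE w in M. norm (f w \<bullet> h w) \<le> norm ((norm (f w))\<^sup>2 + (norm (h w))\<^sup>2)"
      by simp
  qed (use assms in \<open>auto simp: square_integrable_def\<close>)
qed

lemma integrable_mult_square_integrable:
  fixes f h :: "_ \<Rightarrow> real"
  assumes "square_integrable M f" "square_integrable M h"
  shows "integrable M (\<lambda>w. f w * h w)"
  using integrable_inner_square_integrable[OF assms] by simp

lemma square_integrable_indicator_scaleR [intro]:
  assumes "square_integrable M f" "A \<in> sets M"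
  shows "square_integrable M (\<lambda>w. indicator A w *\<^sub>R f w)"
  by (rule square_integrable_bound[OF assms(1)])
    (use assms in \<open>auto simp: square_integrable_def indicator_def\<close>)

lemma borel_measurable_vec_nth:
  fixes f :: "_ \<Rightarrow> real^'q"
  assumes "f \<in> borel_measurable M"
  shows "(\<lambda>w. f w $ a) \<in> borel_measurable M"
  using borel_measurable_inner[OF assms borel_measurable_const[of "axis a 1"]] by (simp add: inner_axis)

lemma square_integrable_nth:
  fixes f :: "_ \<Rightarrow> real^'q"
  assumes "square_integrable M f"
  shows "square_integrable M (\<lambda>w. f w $ a)"
  by (rule square_integrable_bound[OF assms borel_measurable_vec_nth[OF square_integrableD(1)[OF assms]]])
    (simp add: component_le_norm_cart)

lemma (in finite_measure) square_integrable_const: "square_integrable M (\<lambda>_. c)"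
  by (simp add: square_integrable_def)

lemma (in finite_measure) square_integrable_imp_integrable:
  assumes "square_integrable M f"
  shows "integrable M f"
proof -
  have "integrable M (\<lambda>w. 1 + (norm (f w))\<^sup>2)" using assms by (auto simp: square_integrable_def)
  then show ?thesis
  proof (rule Bochner_Integration.integrable_bound)
    have "x \<le> 1 + x\<^sup>2" if "0 \<le> x" for x :: real
      using sum_squares_bound[of x 1] that by (simp add: power2_eq_square)
    then show "AE w in M. norm (f w) \<le> norm (1 + (norm (f w))\<^sup>2)" by simp
  qed (use assms in \<open>auto simp: square_integrable_def\<close>)
qed

lemma borel_measurable_vec_lambda:
  fixes f :: "'q::finite \<Rightarrow> _ \<Rightarrow> real"
  assumes "\<And>a. f a \<in> borel_measurable M"
  shows "(\<lambda>w. (\<chi> a. f a w)) \<in> borel_measurable M"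
  unfolding borel_measurable_euclidean_space[of "\<lambda>w. (\<chi> a. f a w)"]
  using assms by (auto simp: Basis_vec_def inner_axis)

section \<open>The error recursion\<close>

text \<open>One inner step: \<open>Past\<close> is the history; \<open>Q\<close> and \<open>P\<close> are generated by the last two iterates,
  without and with the mini-batch \<open>Bt\<close>; \<open>d i\<close> is the exact increment of the \<open>i\<close>-th field between these
  iterates and \<open>D j i\<close> its approximation at the \<open>j\<close>-th draw; \<open>e\<close> is the error of the previous direction
  and \<open>x\<close> the length of the last move.\<close>

locale spider_error_step = prob_space M for M :: "'w measure" +
  fixes n b :: nat and repl :: bool and Past Q P Draw :: "'w measure" and Bt :: "'w \<Rightarrow> nat list"
    and D :: "nat \<Rightarrow> nat \<Rightarrow> 'w \<Rightarrow> real^'q" and d :: "nat \<Rightarrow> 'w \<Rightarrow> real^'q"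
    and e :: "'w \<Rightarrow> real^'q" and x :: "'w \<Rightarrow> real" and L :: "nat \<Rightarrow> real"
  defines "Draw \<equiv> vimage_algebra (space M) Bt (count_space UNIV)"
  assumes n: "1 \<le> n" and b: "1 \<le> b" and repl: "repl \<or> b \<le> n"
    and Past: "subalgebra M Past" and Q: "subalgebra Past Q"
    and P: "space P = space M" "sets P \<subseteq> sigma_sets (space M) (sets Past \<union> sets Draw)"
      "subalgebra P Q" "Bt \<in> measurable P (count_space UNIV)"
    and Bt: "Bt \<in> measurable M (count_space UNIV)"
      "distr M (count_space UNIV) Bt = measure_pmf (uniform_batch repl n b)"
      "indep_set (sets Draw) (sets Past)"
      "\<And>w. w \<in> space M \<Longrightarrow> length (Bt w) = b \<and> set (Bt w) \<subseteq> {1..n}"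
    and D: "\<And>j i. j < b \<Longrightarrow> i \<in> {1..n} \<Longrightarrow> D j i \<in> borel_measurable M"
    and ci: "cond_indep_set M Q
       (sigma_sets (space M) (\<Union>j<b. \<Union>i\<in>{1..n}. sets (vimage_algebra (space M) (D j i) borel)))
       (sigma_sets (space M) (sets Past \<union> sets Draw))"
    and ci_draws: "cond_indep_sets M P
       (\<lambda>j. sets (vimage_algebra (space M) (\<lambda>w. D j (Bt w ! j) w) borel)) {..<b}"
    and e: "e \<in> borel_measurable Past" "integrable M (\<lambda>w. (norm (e w))\<^sup>2)"
    and x: "x \<in> borel_measurable M" "integrable M (\<lambda>w. (x w)\<^sup>2)"
    and d: "\<And>i. i \<in> {1..n} \<Longrightarrow> d i \<in> borel_measurable Q"
      "\<And>i w. i \<in> {1..n} \<Longrightarrow> w \<in> space M \<Longrightarrow> norm (d i w) \<le> L i * x w"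
    and \<xi>_int: "\<And>j i. j < b \<Longrightarrow> i \<in> {1..n} \<Longrightarrow> integrable M (\<lambda>w. D j i w - d i w)"
begin

section \<open>Bias, noise and the generated sigma-algebras\<close>

definition \<mu> :: "nat \<Rightarrow> nat \<Rightarrow> 'w \<Rightarrow> real^'q" where
  "\<mu> j i = vec_cond_exp M P (\<lambda>w. D j i w - d i w)"

text \<open>A version of \<open>\<mu>\<close> that does not see the mini-batch: given the iterates, the approximations are
  independent of it.\<close>

definition bias :: "nat \<Rightarrow> 'w \<Rightarrow> real^'q" where
  "bias i w = (\<chi> a. real_cond_exp M Q (\<lambda>w. D 0 i w $ a) w) - d i w"

text \<open>Once \<open>bias\<close> is known to serve every draw, this is \<open>D j i\<close>
  minus its conditional expectation given the two iterates; the exact increment \<open>d i\<close>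
  cancels.\<close>

definition noise :: "nat \<Rightarrow> nat \<Rightarrow> 'w \<Rightarrow> real^'q" where
  "noise j i w = D j i w - d i w - bias i w"

abbreviation PD :: "'w measure" where
  "PD \<equiv> sigma (space M) (sets Past \<union> sets Draw)"

abbreviation \<D> :: "'w measure" where
  "\<D> \<equiv> sigma (space M) (\<Union>j<b. \<Union>i\<in>{1..n}. sets (vimage_algebra (space M) (D j i) borel))"

lemma sets_Draw: "sets Draw \<subseteq> events"
  unfolding Draw_def by (rule sets_vimage_algebra_subset[OF Bt(1) refl])

lemma gen_PD: "sets Past \<union> sets Draw \<subseteq> Pow (space M)"
  using Past sets_Draw sets.space_closed[of M] by (auto simp: subalgebra_def)

lemma gen_\<D>: "(\<Union>j<b. \<Union>i\<in>{1..n}. sets (vimage_algebra (space M) (D j i) borel)) \<subseteq> events"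
  using sets_vimage_algebra_subset[OF D refl] by blast

lemma sets_PD: "sets PD = sigma_sets (space M) (sets Past \<union> sets Draw)"
  using gen_PD by simp

lemma sets_\<D>: "sets \<D> = sigma_sets (space M) (\<Union>j<b. \<Union>i\<in>{1..n}. sets (vimage_algebra (space M) (D j i) borel))"
  using gen_\<D> sets.space_closed[of M] by (intro sets_measure_of) blast

lemma space_PD: "space PD = space M"
  by (simp add: space_measure_of_conv)

lemma space_\<D>: "space \<D> = space M"
  by (simp add: space_measure_of_conv)

lemma subalgebra_PD: "subalgebra M PD"
  unfolding subalgebra_def sets_PD space_PD
  using Past sets_Draw sets.sigma_sets_subset[of "sets Past \<union> sets Draw" M] by (simp add: subalgebra_def)

lemma subalgebra_\<D>: "subalgebra M \<D>"
  unfolding subalgebra_def sets_\<D> space_\<D>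
  using sets.sigma_sets_subset[OF gen_\<D>] by simp

lemma subalgebra_P: "subalgebra M P" "subalgebra PD P"
  using P(1,2) subalgebra_PD unfolding subalgebra_def sets_PD space_PD by auto

lemma subalgebra_Q: "subalgebra M Q" "subalgebra PD Q" "subalgebra P Q"
  using Past Q P(3) subalgebra_P unfolding subalgebra_def by auto

lemma subalgebra_PD_Past: "subalgebra PD Past"
  using Past unfolding subalgebra_def sets_PD space_PD by auto

lemma measurable_mono:
  "f \<in> borel_measurable Q \<Longrightarrow> f \<in> borel_measurable P"
  "f \<in> borel_measurable Q \<Longrightarrow> f \<in> borel_measurable Past"
  "f \<in> borel_measurable Q \<Longrightarrow> f \<in> borel_measurable PD"
  "f \<in> borel_measurable Q \<Longrightarrow> f \<in> borel_measurable M"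
  "f \<in> borel_measurable Past \<Longrightarrow> f \<in> borel_measurable PD"
  "f \<in> borel_measurable Past \<Longrightarrow> f \<in> borel_measurable M"
  "f \<in> borel_measurable PD \<Longrightarrow> f \<in> borel_measurable M"
  by (erule measurable_from_subalg[OF subalgebra_Q(3)] measurable_from_subalg[OF Q]
      measurable_from_subalg[OF subalgebra_Q(2)] measurable_from_subalg[OF subalgebra_Q(1)]
      measurable_from_subalg[OF subalgebra_PD_Past] measurable_from_subalg[OF Past]
      measurable_from_subalg[OF subalgebra_PD])+

sublocale Q: sigma_finite_subalgebra M Q by (rule subalgebra_sigma_finite[OF subalgebra_Q(1)])
sublocale P: sigma_finite_subalgebra M P by (rule subalgebra_sigma_finite[OF subalgebra_P(1)])
sublocale Past: sigma_finite_subalgebra M Past by (rule subalgebra_sigma_finite[OF Past])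

lemma Bt_PD: "Bt \<in> measurable PD (count_space UNIV)"
  using measurable_from_subalg[OF subalgebra_P(2) P(4)] .

lemma draw_event:
  shows "{w \<in> space M. R (Bt w)} \<in> sets Draw" "{w \<in> space M. R (Bt w)} \<in> sets P"
    "{w \<in> space M. R (Bt w)} \<in> sets PD" "{w \<in> space M. R (Bt w)} \<in> events"
proof -
  have eq: "{w \<in> space M. R (Bt w)} = Bt -` {l. R l} \<inter> space M" by auto
  show 1: "{w \<in> space M. R (Bt w)} \<in> sets Draw"
    unfolding eq Draw_def by (rule in_vimage_algebra) simp
  show "{w \<in> space M. R (Bt w)} \<in> sets P"
    using measurable_sets[OF P(4), of "{l. R l}"] P(1) unfolding eq by simp
  show "{w \<in> space M. R (Bt w)} \<in> sets PD" unfolding sets_PD using 1 by auto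
  show "{w \<in> space M. R (Bt w)} \<in> events" using 1 sets_Draw by auto
qed

section \<open>Averaging over the uniform batch\<close>

lemma batch_nonempty: "batch_lists repl n b \<noteq> {}" and card_batch: "0 < card (batch_lists repl n b)"
  using batch_lists_nonempty[OF n repl] finite_batch_lists by (auto simp: card_gt_0_iff)

lemma prob_draw: "prob {w \<in> space M. Bt w \<in> A} = measure_pmf.prob (uniform_batch repl n b) A"
proof -
  have "prob {w \<in> space M. Bt w \<in> A} = measure (distr M (count_space UNIV) Bt) A"
    using Bt(1) by (subst measure_distr) (auto intro!: arg_cong[where f = prob])
  then show ?thesis using Bt(2) by simp
qed

lemma uniform_batch_eq: "uniform_batch repl n b = pmf_of_set (batch_lists repl n b)"
  by (simp add: uniform_batch_def batch_lists_def)

lemma prob_draw_eq: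
  assumes "l \<in> batch_lists repl n b"
  shows "prob {w \<in> space M. Bt w = l} = 1 / real (card (batch_lists repl n b))"
  using prob_draw[of "{l}"] assms batch_nonempty finite_batch_lists
  by (simp add: uniform_batch_eq measure_pmf_single)

lemma AE_draw: "AE w in M. Bt w \<in> batch_lists repl n b"
proof -
  have "prob {w \<in> space M. Bt w \<in> batch_lists repl n b} = 1"
    unfolding prob_draw uniform_batch_eq
    using batch_nonempty finite_batch_lists by (simp add: measure_pmf_of_set card_batch[THEN gr_implies_not0])
  then show ?thesis
    using prob_Collect_eq_1[OF draw_event(4)[of "\<lambda>l. l \<in> batch_lists repl n b"]] by blast
qed

text \<open>Independence identifies the conditional probability of a batch event given the past as a
  constant; the defining property of conditional expectation then yields the product formula for all
  integrable \<open>Z\<close>.\<close>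

lemma expectation_draw_indep:
  fixes Z :: "'w \<Rightarrow> real"
  assumes Z: "Z \<in> borel_measurable Past" "integrable M Z"
  shows "(LINT w|M. Z w * indicator {w \<in> space M. R (Bt w)} w)
       = prob {w \<in> space M. R (Bt w)} * (LINT w|M. Z w)"
proof -
  let ?A = "{w \<in> space M. R (Bt w)}"
  have ev: "?A \<in> events" by (rule draw_event)
  have "AE w in M. real_cond_exp M Past (indicator ?A) w = prob ?A"
  proof (rule Past.real_cond_exp_charact)
    fix C assume C: "C \<in> sets Past"
    then have Ce: "C \<in> events" using Past by (auto simp: subalgebra_def)
    have "set_lebesgue_integral M C (indicator ?A) = (LINT w|M. indicator (?A \<inter> C) w :: real)"
      by (simp add: set_lebesgue_integral_def indicator_inter_arith mult.commute)
    also have "\<dots> = prob (?A \<inter> C)" using ev Ce by simp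
    also have "\<dots> = prob ?A * prob C" by (rule indep_setD[OF Bt(3) draw_event(1) C])
    also have "\<dots> = set_lebesgue_integral M C (\<lambda>_. prob ?A)"
      using Ce by (simp add: set_lebesgue_integral_def)
    finally show "set_lebesgue_integral M C (indicator ?A) = set_lebesgue_integral M C (\<lambda>_. prob ?A)" .
  qed (use ev in \<open>auto simp: emeasure_eq_measure\<close>)
  then have "(LINT w|M. Z w * real_cond_exp M Past (indicator ?A) w) = (LINT w|M. Z w * prob ?A)"
    by (intro integral_cong_AE) (use Z in auto)
  moreover have "(LINT w|M. Z w * real_cond_exp M Past (indicator ?A) w) = (LINT w|M. Z w * indicator ?A w)"
    by (rule Past.real_cond_exp_intg(2)) (use Z ev integrable_real_mult_indicator[OF ev Z(2)] in auto)
  ultimately show ?thesis by simp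
qed

text \<open>The batch is almost surely one of finitely many lists, and for each frozen list
  \<open>\<Phi> l\<close> depends on the past only, so independence applies list by list.\<close>

lemma expectation_draw:
  fixes \<Phi> :: "nat list \<Rightarrow> 'w \<Rightarrow> real"
  assumes \<Phi>: "\<And>l. l \<in> batch_lists repl n b \<Longrightarrow> \<Phi> l \<in> borel_measurable Past"
    "\<And>l. l \<in> batch_lists repl n b \<Longrightarrow> integrable M (\<Phi> l)"
    and meas: "(\<lambda>w. \<Phi> (Bt w) w) \<in> borel_measurable M"
  shows "integrable M (\<lambda>w. \<Phi> (Bt w) w)"
    and "(LINT w|M. \<Phi> (Bt w) w)
       = (\<Sum>l\<in>batch_lists repl n b. (LINT w|M. \<Phi> l w)) / real (card (batch_lists repl n b))"
proof -
  let ?L = "batch_lists repl n b"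
  let ?I = "\<lambda>l. indicator {w \<in> space M. Bt w = l} :: 'w \<Rightarrow> real"
  have int: "integrable M (\<lambda>w. \<Phi> l w * ?I l w)" if "l \<in> ?L" for l
    by (rule integrable_real_mult_indicator[OF draw_event(4) \<Phi>(2)[OF that]])
  then have ints: "integrable M (\<lambda>w. \<Sum>l\<in>?L. \<Phi> l w * ?I l w)" by (rule Bochner_Integration.integrable_sum)
  have AE: "AE w in M. (\<Sum>l\<in>?L. \<Phi> l w * ?I l w) = \<Phi> (Bt w) w"
    using AE_draw AE_space
  proof eventually_elim
    case (elim w)
    have "(\<Sum>l\<in>?L. \<Phi> l w * ?I l w) = (\<Sum>l\<in>?L. if l = Bt w then \<Phi> l w else 0)"
      using elim by (intro sum.cong) (auto simp: indicator_def)
    then show ?case using elim finite_batch_lists by simp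
  qed
  show "integrable M (\<lambda>w. \<Phi> (Bt w) w)"
    using integrable_cong_AE_imp[OF ints meas] AE by (auto elim: eventually_mono)
  have "(LINT w|M. \<Phi> (Bt w) w) = (LINT w|M. (\<Sum>l\<in>?L. \<Phi> l w * ?I l w))"
    by (rule integral_cong_AE) (use meas ints AE in \<open>auto elim: eventually_mono\<close>)
  also have "\<dots> = (\<Sum>l\<in>?L. (LINT w|M. \<Phi> l w * ?I l w))"
    by (rule Bochner_Integration.integral_sum[OF int])
  also have "\<dots> = (\<Sum>l\<in>?L. (LINT w|M. \<Phi> l w) / real (card ?L))"
  proof (intro sum.cong refl)
    fix l assume l: "l \<in> ?L"
    show "(LINT w|M. \<Phi> l w * ?I l w) = (LINT w|M. \<Phi> l w) / real (card ?L)"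
      using expectation_draw_indep[OF \<Phi>(1)[OF l] \<Phi>(2)[OF l], where R = "\<lambda>l'. l' = l"] prob_draw_eq[OF l] by simp
  qed
  finally show "(LINT w|M. \<Phi> (Bt w) w) = (\<Sum>l\<in>?L. (LINT w|M. \<Phi> l w)) / real (card ?L)"
    by (simp add: sum_divide_distrib)
qed


lemma measurable_draw:
  assumes N: "Bt \<in> measurable N (count_space UNIV)" "space N = space M"
    and F: "\<And>l. l \<in> batch_lists True n b \<Longrightarrow> F l \<in> borel_measurable N"
  shows "(\<lambda>w. F (Bt w) w) \<in> borel_measurable N"
  by (rule borel_measurable_select[OF N(1) _ countable_finite[OF finite_batch_lists] F])
    (use Bt(4) N(2) in \<open>auto simp: batch_lists_def\<close>)

abbreviation hit :: "nat \<Rightarrow> nat \<Rightarrow> 'w \<Rightarrow> real" where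
  "hit j i \<equiv> indicator {w \<in> space M. Bt w ! j = i}"

text \<open>A random index is traded for a finite sum of indicators, which reduces statements on
  drawn quantities to a fixed index \<open>i\<close>.\<close>

lemma draw_decomp:
  fixes F :: "nat \<Rightarrow> 'b::real_vector"
  assumes "w \<in> space M" "j < b"
  shows "F (Bt w ! j) = (\<Sum>i=1..n. hit j i w *\<^sub>R F i)"
proof -
  have "(\<Sum>i=1..n. hit j i w *\<^sub>R F i) = (\<Sum>i=1..n. if i = Bt w ! j then F i else 0)"
    using assms by (intro sum.cong) (auto simp: indicator_def)
  moreover have "Bt w ! j \<in> {1..n}" using Bt(4)[OF assms(1)] assms(2) nth_mem[of j "Bt w"] by blast
  ultimately show ?thesis by simp
qed

lemma hit_events: "{w \<in> space M. Bt w ! j = i} \<in> events" "{w \<in> space M. Bt w ! j = i} \<in> sets PD"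
  by (rule draw_event)+

lemma square_integrable_draw:
  fixes F :: "nat \<Rightarrow> 'w \<Rightarrow> 'b::euclidean_space"
  assumes j: "j < b" and F: "\<And>i. i \<in> {1..n} \<Longrightarrow> square_integrable M (F i)"
  shows "square_integrable M (\<lambda>w. F (Bt w ! j) w)"
proof -
  have F': "square_integrable M (\<lambda>w. \<Sum>i=1..n. hit j i w *\<^sub>R F i w)"
    using F hit_events by (intro square_integrable_sum square_integrable_indicator_scaleR) auto
  have eq: "(\<Sum>i=1..n. hit j i w *\<^sub>R F i w) = F (Bt w ! j) w" if "w \<in> space M" for w
    using draw_decomp[OF that j, of "\<lambda>i. F i w"] by simp
  then have "(\<lambda>w. F (Bt w ! j) w) \<in> borel_measurable M"
    using square_integrableD(1)[OF F'] by (simp cong: measurable_cong)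
  then show ?thesis
    by (rule square_integrable_cong_AE[OF F']) (use eq in auto)
qed

lemma x_L2: "square_integrable M x" and e_L2: "square_integrable M e"
  using x e measurable_mono by (auto simp: square_integrable_def)

lemma d_L2: "i \<in> {1..n} \<Longrightarrow> square_integrable M (d i)"
  by (rule square_integrable_bound[OF square_integrable_scaleR[OF x_L2, of "L i"]])
    (use d measurable_mono(4) in \<open>auto intro!: AE_I2 order_trans[OF d(2)]\<close>)

section \<open>Conditioning on the iterates in place of the batch\<close>

lemma nth_integrable:
  fixes f :: "'w \<Rightarrow> real^'q"
  assumes "integrable M f"
  shows "integrable M (\<lambda>w. f w $ a)"
  by (rule Bochner_Integration.integrable_bound[OF assms])
    (use assms in \<open>auto intro: borel_measurable_vec_nth component_le_norm_cart\<close>)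

lemma D_integrable:
  assumes "j < b" "i \<in> {1..n}"
  shows "integrable M (D j i)"
  using Bochner_Integration.integrable_add[OF \<xi>_int[OF assms]
      square_integrable_imp_integrable[OF d_L2[OF assms(2)]]] by simp

lemma D_\<D>:
  assumes "j < b" "i \<in> {1..n}"
  shows "D j i \<in> borel_measurable \<D>"
proof (rule measurableI)
  fix A :: "(real^'q) set" assume A: "A \<in> sets borel"
  have "D j i -` A \<inter> space M \<in> sets (vimage_algebra (space M) (D j i) borel)"
    using A by (rule in_vimage_algebra)
  then show "D j i -` A \<inter> space \<D> \<in> sets \<D>"
    unfolding sets_\<D> space_\<D> using assms by (intro sigma_sets.Basic) blast
qed simp

text \<open>The sampling assumption enters here: given the iterates, the approximations are
  independent of history and batch together.\<close>

lemma expectation_given_Q: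
  assumes X: "X \<in> borel_measurable \<D>" "integrable M X"
    and Y: "Y \<in> borel_measurable PD"
    and "integrable M (\<lambda>w. Y w * X w)" "integrable M (\<lambda>w. Y w * real_cond_exp M Q X w)"
  shows "(LINT w|M. Y w * X w) = (LINT w|M. Y w * real_cond_exp M Q X w)"
  by (rule cond_indep_expectation[OF subalgebra_Q(1) subalgebra_\<D> subalgebra_PD
        cond_indep_setD[OF ci[folded sets_\<D> sets_PD]]])
    (use assms in simp_all)

text \<open>\<open>P\<close> lies between \<open>Q\<close> and \<open>PD\<close>, so an event of
  \<open>P\<close> is an event of \<open>PD\<close>, against which \<open>X\<close> may be replaced
  by its conditional expectation given \<open>Q\<close>.\<close>

lemma cond_exp_P_eq_Q:
  assumes X: "X \<in> borel_measurable \<D>" "integrable M X"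
  shows "AE w in M. real_cond_exp M P X w = real_cond_exp M Q X w"
proof (rule P.real_cond_exp_charact)
  have intQ: "integrable M (real_cond_exp M Q X)" by (rule Q.real_cond_exp_int(1)[OF X(2)])
  fix A assume A: "A \<in> sets P"
  then have A': "A \<in> sets PD" "A \<in> events" using subalgebra_P by (auto simp: subalgebra_def)
  have "(LINT w|M. indicator A w * X w) = (LINT w|M. indicator A w * real_cond_exp M Q X w)"
    using integrable_real_mult_indicator[OF A'(2) X(2)] integrable_real_mult_indicator[OF A'(2) intQ]
    by (intro expectation_given_Q X) (use A' in \<open>auto simp: mult.commute\<close>)
  then show "set_lebesgue_integral M A X = set_lebesgue_integral M A (real_cond_exp M Q X)"
    by (simp add: set_lebesgue_integral_def)
qed (use X Q.real_cond_exp_int(1)[OF X(2)] in \<open>auto intro: measurable_mono(1)\<close>)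

lemma bias_Q: "i \<in> {1..n} \<Longrightarrow> bias i \<in> borel_measurable Q"
  unfolding bias_def
  by (intro borel_measurable_diff borel_measurable_vec_lambda d) auto

text \<open>\<open>d i\<close> is known given \<open>P\<close>, and for \<open>D j i\<close> the
  batch carries no information beyond the iterates.\<close>

lemma \<mu>_eq_cond_exp_Q:
  assumes j: "j < b" and i: "i \<in> {1..n}"
  shows "AE w in M. \<mu> j i w = (\<chi> a. real_cond_exp M Q (\<lambda>w. D j i w $ a) w) - d i w"
proof -
  have "AE w in M. real_cond_exp M P (\<lambda>w. (D j i w - d i w) $ a) w
      = real_cond_exp M Q (\<lambda>w. D j i w $ a) w - d i w $ a" for a
  proof -
    have Dint: "integrable M (\<lambda>w. D j i w $ a)" by (rule nth_integrable[OF D_integrable[OF j i]])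
    have dint: "integrable M (\<lambda>w. d i w $ a)"
      by (rule nth_integrable[OF square_integrable_imp_integrable[OF d_L2[OF i]]])
    have "AE w in M. real_cond_exp M P (\<lambda>w. D j i w $ a - d i w $ a) w
        = real_cond_exp M P (\<lambda>w. D j i w $ a) w - real_cond_exp M P (\<lambda>w. d i w $ a) w"
      by (rule P.real_cond_exp_diff[OF Dint dint])
    moreover have "AE w in M. real_cond_exp M P (\<lambda>w. d i w $ a) w = d i w $ a"
      by (rule P.real_cond_exp_F_meas[OF dint borel_measurable_vec_nth[OF measurable_mono(1)[OF d(1)[OF i]]]])
    moreover have "AE w in M. real_cond_exp M P (\<lambda>w. D j i w $ a) w
        = real_cond_exp M Q (\<lambda>w. D j i w $ a) w"
      by (rule cond_exp_P_eq_Q[OF borel_measurable_vec_nth[OF D_\<D>[OF j i]] Dint])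
    ultimately show ?thesis by eventually_elim simp
  qed
  then have "AE w in M. \<forall>a\<in>UNIV. real_cond_exp M P (\<lambda>w. (D j i w - d i w) $ a) w
      = real_cond_exp M Q (\<lambda>w. D j i w $ a) w - d i w $ a"
    by (intro AE_finite_allI) auto
  then show ?thesis
    by (rule eventually_mono) (simp add: \<mu>_def vec_cond_exp_def vec_eq_iff)
qed

end

text \<open>\<beta>, \<nu> and \<tau> stand for \<open>Cb / m\<close>, \<open>Cv / Mv\<close> and
  \<open>Cvb / Mbar\<close> at one step.\<close>

locale spider_error_bounds = spider_error_step +
  fixes \<beta> \<nu> \<tau> :: real
  assumes \<mu>_draw: "\<And>j j' i. j < b \<Longrightarrow> j' < b \<Longrightarrow> i \<in> {1..n} \<Longrightarrow> AE w in M. \<mu> j i w = \<mu> j' i w"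
    and \<mu>_mean: "\<And>j. j < b \<Longrightarrow> AE w in M. norm ((1 / real n) *\<^sub>R (\<Sum>i=1..n. \<mu> j i w)) \<le> \<beta>"
    and \<xi>_var: "\<And>j. j < b \<Longrightarrow> AE w in M.
        (\<Sum>i=1..n. nn_cond_exp M P (\<lambda>w. ennreal ((norm (D j i w - d i w - \<mu> j i w))\<^sup>2)) w) / of_nat n \<le> ennreal \<nu>"
    and \<mu>_spread: "\<And>j. j < b \<Longrightarrow> AE w in M.
        (\<Sum>i=1..n. (norm (\<mu> j i w - (1 / real n) *\<^sub>R (\<Sum>i=1..n. \<mu> j i w)))\<^sup>2) / real n \<le> \<tau>\<^sup>2"
    and \<nu>: "0 \<le> \<nu>" and \<tau>: "0 \<le> \<tau>"
begin

definition "bias_mean w = (1 / real n) *\<^sub>R (\<Sum>i=1..n. bias i w)"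

text \<open>\<open>bias\<close> is built from draw 0; \<open>\<mu>_draw\<close> carries it to every
  draw.\<close>

lemma \<mu>_eq_bias:
  assumes "j < b" "i \<in> {1..n}"
  shows "AE w in M. \<mu> j i w = bias i w"
proof -
  have "0 < b" using b by simp
  then show ?thesis
    using \<mu>_draw[OF assms(1) _ assms(2), of 0] \<mu>_eq_cond_exp_Q[of 0, OF _ assms(2)]
    by (auto simp: bias_def)
qed

lemma cond_exp_D:
  assumes "j < b" "i \<in> {1..n}"
  shows "AE w in M. real_cond_exp M Q (\<lambda>w. D j i w $ a) w = (bias i w + d i w) $ a"
  using \<mu>_eq_bias[OF assms] \<mu>_eq_cond_exp_Q[OF assms]
  by eventually_elim (auto simp: vec_eq_iff algebra_simps)

lemma \<mu>_eq_bias_all: "j < b \<Longrightarrow> AE w in M. \<forall>i\<in>{1..n}. \<mu> j i w = bias i w"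
  by (intro AE_finite_allI \<mu>_eq_bias) auto

lemma bias_mean_le: "AE w in M. norm (bias_mean w) \<le> \<beta>"
proof -
  have "0 < b" using b by simp
  from \<mu>_mean[OF this] \<mu>_eq_bias_all[OF this] show ?thesis
    by eventually_elim (simp add: bias_mean_def)
qed

lemma bias_spread_le:
  "AE w in M. (\<Sum>i=1..n. (norm (bias i w - bias_mean w))\<^sup>2) / real n \<le> \<tau>\<^sup>2"
proof -
  have "0 < b" using b by simp
  from \<mu>_spread[OF this] \<mu>_eq_bias_all[OF this] show ?thesis
    by eventually_elim (simp add: bias_mean_def)
qed

text \<open>The bias is even almost surely bounded: its mean by \<beta> and, as one term of the
  spread, each deviation by \<open>sqrt (n * \<tau>^2)\<close>.\<close>

lemma bias_L2:
  assumes i: "i \<in> {1..n}"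
  shows "square_integrable M (bias i)"
proof (rule square_integrable_bound[OF square_integrable_const[of "\<beta> + sqrt (real n * \<tau>\<^sup>2)"]])
  show "AE w in M. norm (bias i w) \<le> norm (\<beta> + sqrt (real n * \<tau>\<^sup>2))"
    using bias_mean_le bias_spread_le
  proof eventually_elim
    case (elim w)
    have "(norm (bias i w - bias_mean w))\<^sup>2 \<le> (\<Sum>i=1..n. (norm (bias i w - bias_mean w))\<^sup>2)"
      using i by (intro member_le_sum) auto
    also have "\<dots> \<le> real n * \<tau>\<^sup>2" using elim n by (simp add: field_simps)
    finally have "norm (bias i w - bias_mean w) \<le> sqrt (real n * \<tau>\<^sup>2)" by (rule real_le_rsqrt)
    then have "norm (bias i w) \<le> \<beta> + sqrt (real n * \<tau>\<^sup>2)"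
      using norm_triangle_sub[of "bias i w" "bias_mean w"] elim by linarith
    then show ?case by simp
  qed
qed (rule measurable_mono(4)[OF bias_Q[OF i]])

text \<open>Square integrability is extracted from the bound on the conditional variance. As an
  extended nonnegative conditional expectation it integrates to the second moment of the noise,
  finite or not, and the bound makes it finite.\<close>

lemma noise_L2_sum:
  assumes j: "j < b"
  shows "\<And>i. i \<in> {1..n} \<Longrightarrow> square_integrable M (noise j i)"
    and "(\<Sum>i=1..n. (LINT w|M. (norm (noise j i w))\<^sup>2)) \<le> real n * \<nu>"
proof -
  let ?f = "\<lambda>i w. ennreal ((norm (D j i w - d i w - \<mu> j i w))\<^sup>2)"
  have \<mu>M: "\<mu> j i \<in> borel_measurable M" for i
    unfolding \<mu>_def vec_cond_exp_def by (intro borel_measurable_vec_lambda borel_measurable_cond_exp2)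
  have dM: "d i \<in> borel_measurable M" if "i \<in> {1..n}" for i using d(1)[OF that] measurable_mono(4) by blast
  have noiseM: "noise j i \<in> borel_measurable M" if "i \<in> {1..n}" for i
    unfolding noise_def
    by (intro borel_measurable_diff D[OF j that] dM[OF that] measurable_mono(4)[OF bias_Q[OF that]])
  have fM: "?f i \<in> borel_measurable M" if "i \<in> {1..n}" for i
    using D[OF j that] dM[OF that] \<mu>M[of i] by measurable
  have eq: "(\<integral>\<^sup>+w. nn_cond_exp M P (?f i) w \<partial>M) = (\<integral>\<^sup>+w. ennreal ((norm (noise j i w))\<^sup>2) \<partial>M)"
    if i: "i \<in> {1..n}" for i
  proof -
    have "(\<integral>\<^sup>+w. nn_cond_exp M P (?f i) w \<partial>M) = (\<integral>\<^sup>+w. ?f i w \<partial>M)"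
      using P.nn_cond_exp_intg[of "\<lambda>_. 1" "?f i"] fM[OF i] by simp
    also have "\<dots> = (\<integral>\<^sup>+w. ennreal ((norm (noise j i w))\<^sup>2) \<partial>M)"
      by (rule nn_integral_cong_AE) (use \<mu>_eq_bias[OF j i] in \<open>auto simp: noise_def elim!: eventually_mono\<close>)
    finally show ?thesis .
  qed
  have "(\<Sum>i=1..n. (\<integral>\<^sup>+w. ennreal ((norm (noise j i w))\<^sup>2) \<partial>M))
      = (\<integral>\<^sup>+w. (\<Sum>i=1..n. nn_cond_exp M P (?f i) w) \<partial>M)"
    by (subst nn_integral_sum) (auto simp: eq)
  also have "\<dots> \<le> (\<integral>\<^sup>+w. ennreal (real n * \<nu>) \<partial>M)"
  proof (rule nn_integral_mono_AE)
    show "AE w in M. (\<Sum>i=1..n. nn_cond_exp M P (?f i) w) \<le> ennreal (real n * \<nu>)"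
      using \<xi>_var[OF j]
    proof eventually_elim
      case (elim w)
      have "(\<Sum>i=1..n. nn_cond_exp M P (?f i) w)
          = (\<Sum>i=1..n. nn_cond_exp M P (?f i) w) / of_nat n * of_nat n"
        using n by (simp add: ennreal_divide_times ennreal_divide_self of_nat_less_top)
      also have "\<dots> \<le> ennreal \<nu> * of_nat n" using elim by (rule mult_right_mono) simp
      finally show ?case using \<nu> by (simp add: ennreal_mult' ennreal_of_nat_eq_real_of_nat mult.commute)
    qed
  qed
  finally have sum_le: "(\<Sum>i=1..n. (\<integral>\<^sup>+w. ennreal ((norm (noise j i w))\<^sup>2) \<partial>M)) \<le> ennreal (real n * \<nu>)"
    by (simp add: emeasure_space_1)
  then have "(\<Sum>i=1..n. (\<integral>\<^sup>+w. ennreal ((norm (noise j i w))\<^sup>2) \<partial>M)) < \<infinity>"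
    by (rule le_less_trans) simp
  then have fin: "(\<integral>\<^sup>+w. ennreal ((norm (noise j i w))\<^sup>2) \<partial>M) < \<infinity>" if "i \<in> {1..n}" for i
    using that member_le_sum[of i "{1..n}" "\<lambda>i. \<integral>\<^sup>+w. ennreal ((norm (noise j i w))\<^sup>2) \<partial>M"]
    by (auto intro: le_less_trans)
  show L2: "square_integrable M (noise j i)" if i: "i \<in> {1..n}" for i
    unfolding square_integrable_def using noiseM[OF i] fin[OF i]
    by (auto intro!: integrableI_bounded)
  have "(\<Sum>i=1..n. (\<integral>\<^sup>+w. ennreal ((norm (noise j i w))\<^sup>2) \<partial>M))
      = (\<Sum>i=1..n. ennreal (LINT w|M. (norm (noise j i w))\<^sup>2))"
    using square_integrableD(2)[OF L2] by (intro sum.cong) (auto intro!: nn_integral_eq_integral)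
  also have "\<dots> = ennreal (\<Sum>i=1..n. (LINT w|M. (norm (noise j i w))\<^sup>2))"
    by (rule sum_ennreal) simp
  finally show "(\<Sum>i=1..n. (LINT w|M. (norm (noise j i w))\<^sup>2)) \<le> real n * \<nu>"
    using sum_le \<nu> by (simp add: ennreal_le_iff)
qed


lemma bias_d_L2: "i \<in> {1..n} \<Longrightarrow> square_integrable M (\<lambda>w. bias i w + d i w)"
  by (intro square_integrable_add bias_L2 d_L2)

lemma D_eq_noise: "D j i w = noise j i w + (bias i w + d i w)"
  by (simp add: noise_def)

lemma D_L2: "j < b \<Longrightarrow> i \<in> {1..n} \<Longrightarrow> square_integrable M (D j i)"
  using square_integrable_add[OF noise_L2_sum(1) bias_d_L2, of j i i]
  by (simp flip: D_eq_noise)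

text \<open>Conditional independence given \<open>Q\<close> makes \<open>bias i + d i\<close> act as
  the conditional expectation of \<open>D j i\<close> given history and batch, so the noise is
  centered given \<open>PD\<close>.\<close>

lemma noise_orthogonal_nth:
  assumes j: "j < b" and i: "i \<in> {1..n}" and Y: "Y \<in> borel_measurable PD" "square_integrable M Y"
  shows "(LINT w|M. Y w * (noise j i w $ a)) = 0"
proof -
  have D2: "square_integrable M (\<lambda>w. D j i w $ a)" by (intro square_integrable_nth D_L2 j i)
  have k2: "square_integrable M (\<lambda>w. (bias i w + d i w) $ a)" by (intro square_integrable_nth bias_d_L2 i)
  have YM: "Y \<in> borel_measurable M" using Y by (simp add: square_integrable_def)
  have ae: "AE w in M. Y w * (bias i w + d i w) $ a = Y w * real_cond_exp M Q (\<lambda>w. D j i w $ a) w"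
    using cond_exp_D[OF j i, of a] by eventually_elim simp
  have "(LINT w|M. Y w * D j i w $ a) = (LINT w|M. Y w * real_cond_exp M Q (\<lambda>w. D j i w $ a) w)"
  proof (rule expectation_given_Q)
    show "integrable M (\<lambda>w. Y w * real_cond_exp M Q (\<lambda>w. D j i w $ a) w)"
      by (rule integrable_cong_AE_imp[OF integrable_mult_square_integrable[OF Y(2) k2]])
        (use YM ae in auto)
  qed (use integrable_mult_square_integrable[OF Y(2) D2] square_integrable_imp_integrable[OF D2]
        borel_measurable_vec_nth[OF D_\<D>[OF j i]] Y in auto)
  also have "\<dots> = (LINT w|M. Y w * (bias i w + d i w) $ a)"
    by (rule integral_cong_AE) (use YM ae square_integrableD(1)[OF k2] in \<open>auto elim: eventually_mono\<close>)
  finally have "(LINT w|M. Y w * D j i w $ a - Y w * (bias i w + d i w) $ a) = 0"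
    using integrable_mult_square_integrable[OF Y(2) D2] integrable_mult_square_integrable[OF Y(2) k2] by simp
  then show ?thesis by (simp add: D_eq_noise algebra_simps)
qed

lemma noise_orthogonal:
  assumes j: "j < b" and i: "i \<in> {1..n}" and V: "V \<in> borel_measurable PD" "square_integrable M V"
  shows "(LINT w|M. V w \<bullet> noise j i w) = 0"
proof -
  have "(LINT w|M. V w \<bullet> noise j i w) = (LINT w|M. (\<Sum>a\<in>UNIV. V w $ a * noise j i w $ a))"
    by (simp add: inner_vec_def)
  also have "\<dots> = (\<Sum>a\<in>UNIV. (LINT w|M. V w $ a * noise j i w $ a))"
    by (intro Bochner_Integration.integral_sum integrable_mult_square_integrable square_integrable_nth
        V noise_L2_sum j i)
  also have "\<dots> = 0"
    by (intro sum.neutral ballI noise_orthogonal_nth j i borel_measurable_vec_nth V square_integrable_nth)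
  finally show ?thesis .
qed

text \<open>A conditional variance formula: under a bounded weight known from history and batch, the
  squared noise may be replaced by a function of the iterates, and such a function is independent of
  the batch.\<close>

lemma noise_nth_squared_hit:
  assumes j: "j < b" and i: "i \<in> {1..n}"
    and \<phi>: "\<phi> \<in> borel_measurable PD" "\<And>w. \<bar>\<phi> w\<bar> \<le> (1::real)"
  shows "(LINT w|M. \<phi> w * (noise j i w $ a)\<^sup>2)
    = (LINT w|M. \<phi> w * (real_cond_exp M Q (\<lambda>w. (D j i w $ a)\<^sup>2) w - ((bias i w + d i w) $ a)\<^sup>2))"
proof -
  let ?k = "\<lambda>w. (bias i w + d i w) $ a"
  let ?r = "real_cond_exp M Q (\<lambda>w. (D j i w $ a)\<^sup>2)"
  have D2: "square_integrable M (\<lambda>w. D j i w $ a)" by (intro square_integrable_nth D_L2 j i)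
  have k2: "square_integrable M ?k" by (intro square_integrable_nth bias_d_L2 i)
  have kPD: "?k \<in> borel_measurable PD"
    by (intro borel_measurable_vec_nth borel_measurable_add measurable_mono(3) bias_Q d(1) i)
  have \<phi>M: "\<phi> \<in> borel_measurable M" using measurable_mono(7)[OF \<phi>(1)] .
  have int\<phi>: "integrable M (\<lambda>w. \<phi> w * f w)" if "integrable M f" for f
    by (rule Bochner_Integration.integrable_bound[OF that])
      (use that \<phi>M \<phi>(2) in \<open>auto simp: abs_mult intro!: mult_left_le_one_le\<close>)
  have \<phi>k: "square_integrable M (\<lambda>w. \<phi> w * ?k w)"
    by (rule square_integrable_bound[OF k2])
      (use square_integrableD(1)[OF k2] \<phi>M \<phi>(2) in \<open>auto simp: abs_mult intro!: mult_left_le_one_le\<close>)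
  have DD: "integrable M (\<lambda>w. (D j i w $ a)\<^sup>2)" "integrable M (\<lambda>w. (?k w)\<^sup>2)"
    using square_integrableD(2)[OF D2] square_integrableD(2)[OF k2] by simp_all
  have rint: "integrable M ?r" by (rule Q.real_cond_exp_int(1)[OF DD(1)])
  \<comment> \<open>With \<open>D = noise + k\<close>, the squared noise is
    \<open>D^2 - k^2 - 2 k noise\<close>, and the last term is orthogonal to the weight.\<close>
  have "(LINT w|M. \<phi> w * (noise j i w $ a)\<^sup>2)
      = (LINT w|M. \<phi> w * (D j i w $ a)\<^sup>2 - \<phi> w * (?k w)\<^sup>2 - 2 * ((\<phi> w * ?k w) * noise j i w $ a))"
    by (rule Bochner_Integration.integral_cong) (simp_all add: D_eq_noise power2_eq_square algebra_simps)
  also have "\<dots> = (LINT w|M. \<phi> w * (D j i w $ a)\<^sup>2) - (LINT w|M. \<phi> w * (?k w)\<^sup>2)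
      - 2 * (LINT w|M. (\<phi> w * ?k w) * noise j i w $ a)"
    using int\<phi>[OF DD(1)] int\<phi>[OF DD(2)]
      integrable_mult_square_integrable[OF \<phi>k square_integrable_nth[OF noise_L2_sum(1)[OF j i]], of a]
    by simp
  also have "(LINT w|M. (\<phi> w * ?k w) * noise j i w $ a) = 0"
    by (intro noise_orthogonal_nth j i \<phi>k borel_measurable_times kPD \<phi>)
  also have "(LINT w|M. \<phi> w * (D j i w $ a)\<^sup>2) = (LINT w|M. \<phi> w * ?r w)"
    by (rule expectation_given_Q[OF _ DD(1) \<phi>(1) int\<phi>[OF DD(1)] int\<phi>[OF rint]])
      (intro borel_measurable_power borel_measurable_vec_nth D_\<D> j i)
  finally show ?thesis using int\<phi>[OF rint] int\<phi>[OF DD(2)] by (simp add: right_diff_distrib)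
qed

text \<open>Freeze the batch: the fraction of lists whose entry \<open>j\<close> equals
  \<open>i\<close> is \<open>1/n\<close> because a single draw is uniform.\<close>

lemma expectation_hit:
  assumes j: "j < b" and i: "i \<in> {1..n}" and Z: "Z \<in> borel_measurable Past" "integrable M Z"
  shows "(LINT w|M. hit j i w * Z w) = (LINT w|M. Z w) / real n"
proof -
  let ?\<Phi> = "\<lambda>l w. (if l ! j = i then 1 else 0) * Z w"
  have ZM: "Z \<in> borel_measurable M" using measurable_mono(6)[OF Z(1)] .
  have "(LINT w|M. hit j i w * Z w) = (LINT w|M. ?\<Phi> (Bt w) w)"
    by (rule Bochner_Integration.integral_cong) (auto simp: indicator_def)
  also have "\<dots> = (\<Sum>l\<in>batch_lists repl n b. (LINT w|M. ?\<Phi> l w)) / real (card (batch_lists repl n b))"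
  proof (rule expectation_draw(2))
    show "(\<lambda>w. ?\<Phi> (Bt w) w) \<in> borel_measurable M"
      by (rule measurable_draw[OF Bt(1)]) (use ZM in auto)
  qed (use Z in auto)
  also have "(\<Sum>l\<in>batch_lists repl n b. (LINT w|M. ?\<Phi> l w))
      = (\<Sum>l\<in>batch_lists repl n b. (if l ! j = i then 1 else 0) * (LINT w|M. Z w))"
    by (intro sum.cong) auto
  also have "\<dots> = (\<Sum>l\<in>batch_lists repl n b. (if l ! j = i then 1 else 0)) * (LINT w|M. Z w)"
    by (rule sum_distrib_right[symmetric])
  also have "(\<Sum>l\<in>batch_lists repl n b. (if l ! j = i then 1 else 0)) = real (card (batch_lists repl n b)) / real n"
    using sum_batch_coord[OF j n, of "\<lambda>i'. if i' = i then 1 else 0" repl] i by simp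
  finally show ?thesis using card_batch by simp
qed

end

context spider_error_bounds
begin

text \<open>The noise is not a function of the past, so the factor \<open>1/n\<close> does not
  follow from independence of the batch directly. The variance formula with weight
  \<open>hit j i\<close> replaces the squared noise by a function of the iterates, and with weight 1
  restores it.\<close>

lemma noise_squared_hit:
  assumes j: "j < b" and i: "i \<in> {1..n}"
  shows "(LINT w|M. hit j i w * (norm (noise j i w))\<^sup>2) = (LINT w|M. (norm (noise j i w))\<^sup>2) / real n"
proof -
  have int: "integrable M (\<lambda>w. (noise j i w $ a)\<^sup>2)" for a
    using square_integrableD(2)[OF square_integrable_nth[OF noise_L2_sum(1)[OF j i]]] by simp
  have inth: "integrable M (\<lambda>w. hit j i w * (noise j i w $ a)\<^sup>2)" for a
    using integrable_real_mult_indicator[OF hit_events(1) int] by (simp add: mult.commute)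
  have sq: "(norm (z :: real^_))\<^sup>2 = (\<Sum>a\<in>UNIV. (z $ a)\<^sup>2)" for z
    unfolding power2_norm_eq_inner inner_vec_def by (simp add: power2_eq_square)
  have nth: "(LINT w|M. hit j i w * (noise j i w $ a)\<^sup>2) = (LINT w|M. (noise j i w $ a)\<^sup>2) / real n" for a
  proof -
    let ?Z = "\<lambda>w. real_cond_exp M Q (\<lambda>w. (D j i w $ a)\<^sup>2) w - ((bias i w + d i w) $ a)\<^sup>2"
    have D2: "integrable M (\<lambda>w. (D j i w $ a)\<^sup>2)"
      using square_integrableD(2)[OF square_integrable_nth[OF D_L2[OF j i], of a]] by simp
    have k2: "integrable M (\<lambda>w. ((bias i w + d i w) $ a)\<^sup>2)"
      using square_integrableD(2)[OF square_integrable_nth[OF bias_d_L2[OF i], of a]] by simp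
    have Zint: "integrable M ?Z" using Q.real_cond_exp_int(1)[OF D2] k2 by simp
    have "?Z \<in> borel_measurable Q"
      by (intro borel_measurable_diff borel_measurable_power borel_measurable_vec_nth borel_measurable_add
          bias_Q d(1) i borel_measurable_cond_exp)
    then have ZP: "?Z \<in> borel_measurable Past" by (rule measurable_mono(2))
    have "(LINT w|M. hit j i w * (noise j i w $ a)\<^sup>2) = (LINT w|M. hit j i w * ?Z w)"
      by (intro noise_nth_squared_hit j i borel_measurable_indicator hit_events) (simp add: indicator_def)
    also have "\<dots> = (LINT w|M. ?Z w) / real n" by (rule expectation_hit[OF j i ZP Zint])
    also have "(LINT w|M. ?Z w) = (LINT w|M. (noise j i w $ a)\<^sup>2)"
      using noise_nth_squared_hit[OF j i, of "\<lambda>_. 1" a] by simp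
    finally show ?thesis .
  qed
  have "(LINT w|M. hit j i w * (norm (noise j i w))\<^sup>2) = (\<Sum>a\<in>UNIV. (LINT w|M. hit j i w * (noise j i w $ a)\<^sup>2))"
    unfolding sq sum_distrib_left by (rule Bochner_Integration.integral_sum[OF inth])
  also have "\<dots> = (\<Sum>a\<in>UNIV. (LINT w|M. (noise j i w $ a)\<^sup>2)) / real n"
    unfolding nth sum_divide_distrib ..
  also have "(\<Sum>a\<in>UNIV. (LINT w|M. (noise j i w $ a)\<^sup>2)) = (LINT w|M. (norm (noise j i w))\<^sup>2)"
    unfolding sq by (rule Bochner_Integration.integral_sum[OF int, symmetric])
  finally show ?thesis .
qed

section \<open>Noise at the drawn indices\<close>

definition draw_noise where
  "draw_noise j w = noise j (Bt w ! j) w"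

lemma draw_noise_decomp:
  assumes "w \<in> space M" "j < b"
  shows "draw_noise j w = (\<Sum>i=1..n. hit j i w *\<^sub>R noise j i w)"
  unfolding draw_noise_def by (rule draw_decomp[OF assms])

lemma draw_noise_L2: "j < b \<Longrightarrow> square_integrable M (draw_noise j)"
  using square_integrable_draw[of j "noise j"] noise_L2_sum(1) by (simp add: draw_noise_def[abs_def])

text \<open>\<open>hit j i\<close> is known given \<open>PD\<close> and can be absorbed into
  \<open>V\<close>, which leaves a fixed index.\<close>

lemma draw_noise_orthogonal:
  assumes j: "j < b" and V: "V \<in> borel_measurable PD" "square_integrable M V"
  shows "(LINT w|M. V w \<bullet> draw_noise j w) = 0"
proof -
  have h: "square_integrable M (\<lambda>w. hit j i w *\<^sub>R V w)" for i
    by (intro square_integrable_indicator_scaleR V hit_events)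
  have "(LINT w|M. V w \<bullet> draw_noise j w) = (LINT w|M. (\<Sum>i=1..n. (hit j i w *\<^sub>R V w) \<bullet> noise j i w))"
    by (rule Bochner_Integration.integral_cong) (simp_all add: draw_noise_decomp j inner_sum_right)
  also have "\<dots> = (\<Sum>i=1..n. (LINT w|M. (hit j i w *\<^sub>R V w) \<bullet> noise j i w))"
    by (intro Bochner_Integration.integral_sum integrable_inner_square_integrable h noise_L2_sum j)
  also have "\<dots> = 0"
    by (intro sum.neutral ballI noise_orthogonal j h borel_measurable_scaleR borel_measurable_indicator
        hit_events V)
  finally show ?thesis .
qed

text \<open>The uniform draw turns the second moment into the average over \<open>i\<close>, the
  quantity that \<nu> bounds.\<close>

lemma draw_noise_squared_le:
  assumes j: "j < b"
  shows "(LINT w|M. (norm (draw_noise j w))\<^sup>2) \<le> \<nu>"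
proof -
  have inth: "integrable M (\<lambda>w. hit j i w * (norm (noise j i w))\<^sup>2)" if "i \<in> {1..n}" for i
    using integrable_real_mult_indicator[OF hit_events(1) square_integrableD(2)[OF noise_L2_sum(1)[OF j that]]]
    by (simp add: mult.commute)
  have "(LINT w|M. (norm (draw_noise j w))\<^sup>2) = (LINT w|M. (\<Sum>i=1..n. hit j i w * (norm (noise j i w))\<^sup>2))"
  proof (rule Bochner_Integration.integral_cong)
    fix w assume "w \<in> space M"
    from draw_decomp[OF this j, of "\<lambda>i. (norm (noise j i w))\<^sup>2"]
    show "(norm (draw_noise j w))\<^sup>2 = (\<Sum>i=1..n. hit j i w * (norm (noise j i w))\<^sup>2)"
      by (simp add: draw_noise_def)
  qed simp
  also have "\<dots> = (\<Sum>i=1..n. (LINT w|M. hit j i w * (norm (noise j i w))\<^sup>2))"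
    by (intro Bochner_Integration.integral_sum inth)
  also have "\<dots> = (\<Sum>i=1..n. (LINT w|M. (norm (noise j i w))\<^sup>2)) / real n"
    using noise_squared_hit[OF j] by (simp add: sum_divide_distrib)
  also have "\<dots> \<le> (real n * \<nu>) / real n"
    by (intro divide_right_mono noise_L2_sum(2) j) simp
  finally show ?thesis using n by simp
qed

text \<open>Conditional independence between draws is assumed given \<open>P\<close>, so the drawn
  approximations have to be centered with respect to \<open>P\<close>. Their conditional mean is
  found by testing the drawn noise against events of \<open>P\<close>.\<close>

lemma cond_exp_draw:
  assumes j: "j < b"
  shows "AE w in M. real_cond_exp M P (\<lambda>w. D j (Bt w ! j) w $ a) w
      = (bias (Bt w ! j) w + d (Bt w ! j) w) $ a"
proof (rule P.real_cond_exp_charact)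
  have X: "square_integrable M (\<lambda>w. D j (Bt w ! j) w $ a)"
    by (rule square_integrable_nth[OF square_integrable_draw[OF j, of "D j", OF D_L2[OF j]]])
  have R: "square_integrable M (\<lambda>w. (bias (Bt w ! j) w + d (Bt w ! j) w) $ a)"
    by (rule square_integrable_nth[OF square_integrable_draw[OF j, of "\<lambda>i w. bias i w + d i w", OF bias_d_L2]])
  show "integrable M (\<lambda>w. D j (Bt w ! j) w $ a)"
    and "integrable M (\<lambda>w. (bias (Bt w ! j) w + d (Bt w ! j) w) $ a)"
    using X R by (auto intro: square_integrable_imp_integrable)
  show "(\<lambda>w. (bias (Bt w ! j) w + d (Bt w ! j) w) $ a) \<in> borel_measurable P"
  proof (rule measurable_draw[OF P(4,1), of "\<lambda>l w. (bias (l ! j) w + d (l ! j) w) $ a"])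
    fix l assume "l \<in> batch_lists True n b"
    then have "l ! j \<in> {1..n}" using batch_lists_nth j by blast
    then show "(\<lambda>w. (bias (l ! j) w + d (l ! j) w) $ a) \<in> borel_measurable P"
      by (intro borel_measurable_vec_nth borel_measurable_add measurable_mono(1) bias_Q d(1))
  qed
  fix A assume "A \<in> sets P"
  then have A: "A \<in> sets PD" "A \<in> events" using subalgebra_P by (auto simp: subalgebra_def)
  have "(LINT w|M. (indicator A w *\<^sub>R axis a 1) \<bullet> draw_noise j w) = 0"
    by (rule draw_noise_orthogonal[OF j])
      (use A square_integrable_indicator_scaleR[OF square_integrable_const A(2)] in auto)
  then have "(LINT w|M. indicator A w * D j (Bt w ! j) w $ a
      - indicator A w * (bias (Bt w ! j) w + d (Bt w ! j) w) $ a) = 0"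
    by (simp add: D_eq_noise draw_noise_def inner_commute[of "axis _ _"] inner_axis algebra_simps)
  moreover have "integrable M (\<lambda>w. indicator A w * D j (Bt w ! j) w $ a)"
    "integrable M (\<lambda>w. indicator A w * (bias (Bt w ! j) w + d (Bt w ! j) w) $ a)"
    using integrable_real_mult_indicator[OF A(2) square_integrable_imp_integrable[OF X]]
      integrable_real_mult_indicator[OF A(2) square_integrable_imp_integrable[OF R]]
    by (simp_all add: mult.commute)
  ultimately show "set_lebesgue_integral M A (\<lambda>w. D j (Bt w ! j) w $ a)
      = set_lebesgue_integral M A (\<lambda>w. (bias (Bt w ! j) w + d (Bt w ! j) w) $ a)"
    by (simp add: set_lebesgue_integral_def)
qed


text \<open>With \<open>X\<close> a component of the drawn approximation and \<open>R\<close> its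
  conditional mean given \<open>P\<close>, the noise component is \<open>X - R\<close>. In
  expectation, conditional independence turns \<open>X j' X j\<close> into \<open>X j' R j\<close>,
  and conditioning on \<open>P\<close> turns \<open>R j' X j\<close> into \<open>R j' R j\<close>,
  so the expanded product cancels in pairs.\<close>

lemma draw_noise_uncorrelated_nth:
  assumes j: "j < b" "j' < b" "j \<noteq> j'"
  shows "(LINT w|M. draw_noise j w $ a * draw_noise j' w $ a) = 0"
proof -
  define X where "X j w = D j (Bt w ! j) w $ a" for j w
  define R where "R j w = (bias (Bt w ! j) w + d (Bt w ! j) w) $ a" for j w
  let ?G = "\<lambda>j. vimage_algebra (space M) (\<lambda>w. D j (Bt w ! j) w) borel"
  have XL2: "square_integrable M (X j)" if "j < b" for j
    unfolding X_def by (rule square_integrable_nth[OF square_integrable_draw[OF that, of "D j", OF D_L2[OF that]]])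
  have RL2: "square_integrable M (R j)" if "j < b" for j
    unfolding R_def
    by (rule square_integrable_nth[OF square_integrable_draw[OF that, of "\<lambda>i w. bias i w + d i w", OF bias_d_L2]])
  have DM: "(\<lambda>w. D j (Bt w ! j) w) \<in> borel_measurable M" if "j < b" for j
    by (rule square_integrableD(1)[OF square_integrable_draw[OF that, of "D j", OF D_L2[OF that]]])
  have G: "subalgebra M (?G j)" if "j < b" for j
    unfolding subalgebra_def using sets_vimage_algebra_subset[OF DM[OF that] refl] by simp
  have XG: "X j \<in> borel_measurable (?G j)" for j
    unfolding X_def
    by (rule borel_measurable_vec_nth[of "\<lambda>w. D j (Bt w ! j) w"]) (rule measurable_vimage_algebra1, simp)
  have ce: "AE w in M. real_cond_exp M P (X j) w = R j w" if "j < b" for j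
    using cond_exp_draw[OF that, of a] unfolding X_def R_def .
  note int = integrable_mult_square_integrable
  note meas = XL2[THEN square_integrableD(1)] RL2[THEN square_integrableD(1)]
  have XX: "(LINT w|M. X j' w * X j w) = (LINT w|M. X j' w * R j w)"
  proof -
    have ae: "AE w in M. X j' w * R j w = X j' w * real_cond_exp M P (X j) w"
      using ce[OF j(1)] by eventually_elim simp
    have "(LINT w|M. X j' w * X j w) = (LINT w|M. X j' w * real_cond_exp M P (X j) w)"
    proof (rule cond_indep_expectation[OF subalgebra_P(1) G[OF j(1)] G[OF j(2)] _ XG _ XG])
      show "integrable M (\<lambda>w. X j' w * real_cond_exp M P (X j) w)"
        by (rule integrable_cong_AE_imp[OF int[OF XL2[OF j(2)] RL2[OF j(1)]]])
          (use meas j ae in auto)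
    qed (use cond_indep_setsD2[OF ci_draws, of j j'] j int[OF XL2[OF j(2)] XL2[OF j(1)]]
          square_integrable_imp_integrable[OF XL2[OF j(1)]] in auto)
    also have "\<dots> = (LINT w|M. X j' w * R j w)"
      by (rule integral_cong_AE) (use meas j ae in \<open>auto elim: eventually_mono\<close>)
    finally show ?thesis .
  qed
  \<comment> \<open>\<open>R i\<close> is exchanged for the conditional expectation itself, which is
    measurable for \<open>P\<close> by construction.\<close>
  have RX: "(LINT w|M. R i w * X k w) = (LINT w|M. R i w * R k w)" if i: "i < b" and k: "k < b" for i k
  proof -
    let ?r = "real_cond_exp M P (X i)"
    have "(LINT w|M. R i w * X k w) = (LINT w|M. ?r w * X k w)"
      by (rule integral_cong_AE) (use meas i k ce[OF i] in \<open>auto elim: eventually_mono\<close>)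
    also have "\<dots> = (LINT w|M. ?r w * real_cond_exp M P (X k) w)"
    proof (rule P.real_cond_exp_intg(2)[symmetric])
      show "integrable M (\<lambda>w. ?r w * X k w)"
        by (rule integrable_cong_AE_imp[OF int[OF RL2[OF i] XL2[OF k]]])
          (use meas i k ce[OF i] in \<open>auto elim: eventually_mono\<close>)
    qed (use meas k in auto)
    also have "\<dots> = (LINT w|M. R i w * R k w)"
      using ce[OF i] ce[OF k] by (intro integral_cong_AE) (use meas i k in \<open>auto elim: eventually_elim2\<close>)
    finally show ?thesis .
  qed
  have "(LINT w|M. draw_noise j w $ a * draw_noise j' w $ a)
      = (LINT w|M. X j' w * X j w - X j' w * R j w - (R j' w * X j w - R j' w * R j w))"
    by (rule Bochner_Integration.integral_cong)
      (simp_all add: draw_noise_def noise_def X_def R_def algebra_simps)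
  also have "\<dots> = ((LINT w|M. X j' w * X j w) - (LINT w|M. X j' w * R j w))
      - ((LINT w|M. R j' w * X j w) - (LINT w|M. R j' w * R j w))"
    using int[OF XL2[OF j(2)] XL2[OF j(1)]] int[OF XL2[OF j(2)] RL2[OF j(1)]]
      int[OF RL2[OF j(2)] XL2[OF j(1)]] int[OF RL2[OF j(2)] RL2[OF j(1)]] by simp
  also have "\<dots> = 0" using XX RX[OF j(2,1)] by simp
  finally show ?thesis .
qed

lemma draw_noise_uncorrelated:
  assumes j: "j < b" "j' < b" "j \<noteq> j'"
  shows "(LINT w|M. draw_noise j w \<bullet> draw_noise j' w) = 0"
proof -
  have "(LINT w|M. draw_noise j w \<bullet> draw_noise j' w)
      = (\<Sum>a\<in>UNIV. (LINT w|M. draw_noise j w $ a * draw_noise j' w $ a))"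
    unfolding inner_vec_def inner_real_def
    by (intro Bochner_Integration.integral_sum integrable_mult_square_integrable square_integrable_nth
        draw_noise_L2 j)
  then show ?thesis using draw_noise_uncorrelated_nth[OF j] by simp
qed

section \<open>Second moment of the next error\<close>

definition total_noise where
  "total_noise w = (1 / real b) *\<^sub>R (\<Sum>j<b. draw_noise j w)"

lemma total_noise_L2: "square_integrable M total_noise"
  unfolding total_noise_def[abs_def]
  by (intro square_integrable_scaleR square_integrable_sum draw_noise_L2) auto

text \<open>Different draws are uncorrelated, so only \<open>b\<close> diagonal terms survive under
  the factor \<open>1 / b^2\<close>.\<close>

lemma total_noise_squared_le: "(LINT w|M. (norm (total_noise w))\<^sup>2) \<le> \<nu> / real b"
proof -
  have "(LINT w|M. (norm (total_noise w))\<^sup>2)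
      = (LINT w|M. (1 / real b)\<^sup>2 * (\<Sum>j<b. \<Sum>j'<b. draw_noise j w \<bullet> draw_noise j' w))"
    by (simp add: total_noise_def power_mult_distrib power_divide flip: power2_norm_sum)
  also have "\<dots> = (1 / real b)\<^sup>2 * (\<Sum>j<b. \<Sum>j'<b. (LINT w|M. draw_noise j w \<bullet> draw_noise j' w))"
    by (subst integral_mult_right_zero,
        subst Bochner_Integration.integral_sum[OF Bochner_Integration.integrable_sum],
        auto intro!: integrable_inner_square_integrable draw_noise_L2 Bochner_Integration.integral_sum sum.cong)
  also have "\<dots> \<le> (1 / real b)\<^sup>2 * (\<Sum>j<b. \<Sum>j'<b. if j' = j then \<nu> else 0)"
  proof (intro mult_left_mono sum_mono)
    fix j j' assume "j \<in> {..<b}" "j' \<in> {..<b}"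
    then show "(LINT w|M. draw_noise j w \<bullet> draw_noise j' w) \<le> (if j' = j then \<nu> else 0)"
      using draw_noise_squared_le[of j] draw_noise_uncorrelated[of j j'] by (auto simp: power2_norm_eq_inner)
  qed simp
  also have "\<dots> = \<nu> / real b" using b by (simp add: power2_eq_square)
  finally show ?thesis .
qed

definition d_mean where
  "d_mean w = (1 / real n) *\<^sub>R (\<Sum>i=1..n. d i w)"

text \<open>The next error is \<open>drift\<close> at the drawn batch, a function of the past only, plus a noise that is
  centered given the past and the batch.\<close>

definition drift where
  "drift l w = (e w + bias_mean w)
     + (1 / real b) *\<^sub>R (\<Sum>j<b. (d (l ! j) w - d_mean w) + (bias (l ! j) w - bias_mean w))"

text \<open>\<open>e\<close> refers to the field at the earlier iterate and \<open>d_mean\<close> is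
  the increment of the mean field, so this is the updated direction minus the mean field at the
  later iterate.\<close>

definition next_error where
  "next_error w = e w + (1 / real b) *\<^sub>R (\<Sum>j<b. D j (Bt w ! j) w) - d_mean w"

text \<open>\<open>bias_mean\<close> is added once and subtracted in each of the \<open>b\<close>
  averaged terms, so that the batch average in \<open>drift\<close> runs over a centered
  family.\<close>

lemma next_error_eq: "next_error w = drift (Bt w) w + total_noise w"
  using b by (simp add: next_error_def drift_def total_noise_def draw_noise_def noise_def
      sum.distrib sum_subtractf scaleR_add_right scaleR_diff_right sum_constant_scaleR algebra_simps del: sum_constant)

lemma mean_L2: "square_integrable M d_mean" "square_integrable M bias_mean"
  unfolding d_mean_def[abs_def] bias_mean_def[abs_def]
  by (intro square_integrable_scaleR square_integrable_sum d_L2 bias_L2; simp)+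

lemma drift_L2: "l \<in> batch_lists True n b \<Longrightarrow> square_integrable M (drift l)"
  unfolding drift_def[abs_def]
  by (intro square_integrable_add square_integrable_scaleR square_integrable_sum square_integrable_diff
      e_L2 mean_L2 d_L2 bias_L2) (auto dest: batch_lists_nth)

lemma drift_Past: "l \<in> batch_lists True n b \<Longrightarrow> drift l \<in> borel_measurable Past"
  unfolding drift_def[abs_def] d_mean_def[abs_def] bias_mean_def[abs_def]
  by (intro borel_measurable_add borel_measurable_scaleR borel_measurable_sum borel_measurable_diff
      borel_measurable_const e(1) measurable_mono(2) d(1) bias_Q) (auto dest: batch_lists_nth)

lemma batch_lists_mono: "l \<in> batch_lists repl n b \<Longrightarrow> l \<in> batch_lists True n b"
  by (simp add: batch_lists_def)

text \<open>For a fixed outcome, averaging over lists separates \<open>e + bias_mean\<close> from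
  the centered batch terms. The first part pays the growth factor \<open>1 + 2 \<beta>\<close>; in
  the second, increments and bias deviations are split by the weighted Young inequality.\<close>

lemma drift_bound:
  "AE w in M. (\<Sum>l\<in>batch_lists repl n b. (norm (drift l w))\<^sup>2) / real (card (batch_lists repl n b))
     \<le> (1 + 2 * \<beta>) * (norm (e w))\<^sup>2
        + (1 + 2 * \<tau> / sqrt b) / real b * ((\<Sum>i=1..n. (L i)\<^sup>2) / real n * (x w)\<^sup>2)
        + (2 * \<beta> + \<beta>\<^sup>2 + 2 * \<tau> / sqrt b + \<tau>\<^sup>2 / real b)"
  using bias_mean_le bias_spread_le AE_space
proof eventually_elim
  case (elim w)
  let ?c = "\<lambda>i. (d i w - d_mean w) + (bias i w - bias_mean w)"
  have sum0: "(\<Sum>i=1..n. f i - (1 / real n) *\<^sub>R (\<Sum>i=1..n. f i)) = 0" for f :: "nat \<Rightarrow> real^_"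
    using n by (simp add: sum_subtractf sum_constant_scaleR del: sum_constant)
  have "(\<Sum>i=1..n. ?c i) = 0"
    using sum0[of "\<lambda>i. d i w"] sum0[of "\<lambda>i. bias i w"] by (simp add: sum.distrib d_mean_def bias_mean_def)
  from batch_mean_square[OF n b this, where u = "e w + bias_mean w" and repl = repl]
  have "(\<Sum>l\<in>batch_lists repl n b. (norm (drift l w))\<^sup>2) / real (card (batch_lists repl n b))
      \<le> (norm (e w + bias_mean w))\<^sup>2 + (\<Sum>i=1..n. (norm (?c i))\<^sup>2) / (real n * real b)"
    using card_batch by (simp add: drift_def divide_le_eq mult.commute)
  also have "(norm (e w + bias_mean w))\<^sup>2 \<le> (1 + 2 * \<beta>) * (norm (e w))\<^sup>2 + 2 * \<beta> + \<beta>\<^sup>2"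
    by (rule norm_add_bias_squared_le[OF elim(1)])
  also have "(\<Sum>i=1..n. (norm (?c i))\<^sup>2) / (real n * real b)
      \<le> (1 + 2 * \<tau> / sqrt b) / real b * ((\<Sum>i=1..n. (L i)\<^sup>2) / real n * (x w)\<^sup>2)
        + 2 * \<tau> / sqrt b + \<tau>\<^sup>2 / real b"
  proof (rule sum_norm_add_squared_le[OF n b \<tau> _ elim(2)])
    have "(\<Sum>i=1..n. (norm (d i w - d_mean w))\<^sup>2) \<le> (\<Sum>i=1..n. (norm (d i w))\<^sup>2)"
      unfolding d_mean_def by (rule sum_norm_centered_le[OF n])
    also have "\<dots> \<le> (\<Sum>i=1..n. (L i * x w)\<^sup>2)"
      by (intro sum_mono power_mono d(2)) (use elim in auto)
    finally show "(\<Sum>i=1..n. (norm (d i w - d_mean w))\<^sup>2) / real n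
        \<le> (\<Sum>i=1..n. (L i)\<^sup>2) / real n * (x w)\<^sup>2"
      using n by (simp add: power_mult_distrib divide_right_mono flip: sum_distrib_right)
  qed
  finally show ?case by simp
qed

text \<open>Freezing the batch turns the second moment into the expected average over lists, to
  which the pointwise bound applies.\<close>

lemma draw_drift_L2: "square_integrable M (\<lambda>w. drift (Bt w) w)"
  and draw_drift_PD: "(\<lambda>w. drift (Bt w) w) \<in> borel_measurable PD"
  and draw_drift_squared_le: "(LINT w|M. (norm (drift (Bt w) w))\<^sup>2)
    \<le> (1 + 2 * \<beta>) * (LINT w|M. (norm (e w))\<^sup>2)
        + (1 + 2 * \<tau> / sqrt b) / real b * ((\<Sum>i=1..n. (L i)\<^sup>2) / real n * (LINT w|M. (x w)\<^sup>2))
        + (2 * \<beta> + \<beta>\<^sup>2 + 2 * \<tau> / sqrt b + \<tau>\<^sup>2 / real b)"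
    (is "?drift \<le> ?rhs")
proof -
  let ?L = "batch_lists repl n b"
  show PD: "(\<lambda>w. drift (Bt w) w) \<in> borel_measurable PD"
    by (rule measurable_draw[OF Bt_PD space_PD measurable_mono(5)[OF drift_Past]])
  have meas: "(\<lambda>w. drift (Bt w) w) \<in> borel_measurable M" by (rule measurable_mono(7)[OF PD])
  have sq: "(\<lambda>w. (norm (drift l w))\<^sup>2) \<in> borel_measurable Past" "integrable M (\<lambda>w. (norm (drift l w))\<^sup>2)"
    if "l \<in> ?L" for l
    using drift_Past[OF batch_lists_mono[OF that]] square_integrableD(2)[OF drift_L2[OF batch_lists_mono[OF that]]]
    by auto
  have measq: "(\<lambda>w. (norm (drift (Bt w) w))\<^sup>2) \<in> borel_measurable M" using meas by simp
  note ex = expectation_draw[where \<Phi> = "\<lambda>l w. (norm (drift l w))\<^sup>2", OF sq measq]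
  show "square_integrable M (\<lambda>w. drift (Bt w) w)"
    unfolding square_integrable_def using meas ex(1) by simp
  have "(LINT w|M. (norm (drift (Bt w) w))\<^sup>2)
      = (LINT w|M. (\<Sum>l\<in>?L. (norm (drift l w))\<^sup>2) / real (card ?L))"
    using ex(2) Bochner_Integration.integral_sum[of ?L M "\<lambda>l w. (norm (drift l w))\<^sup>2", OF sq(2)] by simp
  also have "\<dots> \<le> (LINT w|M. (1 + 2 * \<beta>) * (norm (e w))\<^sup>2
        + (1 + 2 * \<tau> / sqrt b) / real b * ((\<Sum>i=1..n. (L i)\<^sup>2) / real n * (x w)\<^sup>2)
        + (2 * \<beta> + \<beta>\<^sup>2 + 2 * \<tau> / sqrt b + \<tau>\<^sup>2 / real b))"
    by (rule integral_mono_AE[OF _ _ drift_bound])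
      (use e(2) x(2) in \<open>auto intro!: integrable_divide Bochner_Integration.integrable_sum sq\<close>)
  also have "\<dots> = (1 + 2 * \<beta>) * (LINT w|M. (norm (e w))\<^sup>2)
        + (1 + 2 * \<tau> / sqrt b) / real b * ((\<Sum>i=1..n. (L i)\<^sup>2) / real n * (LINT w|M. (x w)\<^sup>2))
        + (2 * \<beta> + \<beta>\<^sup>2 + 2 * \<tau> / sqrt b + \<tau>\<^sup>2 / real b)"
    using e(2) x(2) by (simp add: prob_space)
  finally show "?drift \<le> ?rhs" .
qed

text \<open>Pythagoras: the drift at the drawn batch is known given \<open>PD\<close>, and the noise
  of each draw is orthogonal to everything known given \<open>PD\<close>.\<close>

theorem next_error_bound:
  shows "square_integrable M next_error"
    and "(LINT w|M. (norm (next_error w))\<^sup>2)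
    \<le> (1 + 2 * \<beta>) * (LINT w|M. (norm (e w))\<^sup>2)
        + (1 + 2 * \<tau> / sqrt b) / real b * ((\<Sum>i=1..n. (L i)\<^sup>2) / real n * (LINT w|M. (x w)\<^sup>2))
        + (2 * \<beta> + \<beta>\<^sup>2 + \<nu> / real b + 2 * \<tau> / sqrt b + \<tau>\<^sup>2 / real b)"
    (is "?next \<le> ?rhs")
proof -
  let ?V = "\<lambda>w. drift (Bt w) w"
  show "square_integrable M next_error"
    using square_integrable_add[OF draw_drift_L2 total_noise_L2] by (simp add: next_error_eq[abs_def])
  have VN: "integrable M (\<lambda>w. ?V w \<bullet> draw_noise j w)" if "j < b" for j
    by (rule integrable_inner_square_integrable[OF draw_drift_L2 draw_noise_L2[OF that]])
  have "(LINT w|M. ?V w \<bullet> total_noise w) = (1 / real b) * (\<Sum>j<b. (LINT w|M. ?V w \<bullet> draw_noise j w))"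
    unfolding total_noise_def inner_scaleR_right inner_sum_right
    by (subst integral_mult_right_zero, subst Bochner_Integration.integral_sum) (use VN in auto)
  also have "\<dots> = 0"
    using draw_noise_orthogonal[OF _ draw_drift_PD draw_drift_L2] by simp
  finally have cross: "(LINT w|M. ?V w \<bullet> total_noise w) = 0" .
  have "(LINT w|M. (norm (next_error w))\<^sup>2)
      = (LINT w|M. (norm (?V w))\<^sup>2 + 2 * (?V w \<bullet> total_noise w) + (norm (total_noise w))\<^sup>2)"
    unfolding next_error_eq power2_norm_eq_inner
    by (simp add: inner_add_left inner_add_right inner_commute algebra_simps)
  also have "\<dots> = (LINT w|M. (norm (?V w))\<^sup>2) + (LINT w|M. (norm (total_noise w))\<^sup>2)"
    using cross integrable_inner_square_integrable[OF draw_drift_L2 total_noise_L2]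
      square_integrableD(2)[OF draw_drift_L2] square_integrableD(2)[OF total_noise_L2] by simp
  finally show "?next \<le> ?rhs"
    using draw_drift_squared_le total_noise_squared_le by linarith
qed

end

section \<open>Accumulation of the errors\<close>

text \<open>The step condition absorbs the growth factor \<open>1 + c\<close>, so
  \<open>\<gamma> k * a k\<close> grows only by the increments \<open>r k\<close>. In the double sum
  the increment at \<open>j\<close> is counted once for each \<open>k\<close> from \<open>j\<close>
  to \<open>K\<close>, hence the weight \<open>K - j + 1\<close>.\<close>

lemma accumulated_recursion:
  fixes a X U q \<theta> \<gamma> :: "nat \<Rightarrow> real"
  assumes \<gamma>: "\<And>k. k \<le> K \<Longrightarrow> 0 < \<gamma> k" "\<And>k. k < K \<Longrightarrow> \<gamma> (Suc k) * (1 + c (Suc k)) \<le> \<gamma> k"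
      "\<And>k. k < K \<Longrightarrow> \<gamma> (Suc k) \<le> \<gamma> k"
    and a: "\<And>k. k \<le> K \<Longrightarrow> 0 \<le> a k"
    and rec: "\<And>k. k < K \<Longrightarrow> a (Suc k) \<le> (1 + c (Suc k)) * a k + q (Suc k) * X k + U (Suc k)"
    and q: "\<And>k. 0 \<le> q (Suc k)"
    and X: "X 0 = 0" "\<And>k. 1 \<le> k \<Longrightarrow> k \<le> K \<Longrightarrow> X k \<le> \<theta> k" "\<And>k. 1 \<le> k \<Longrightarrow> k \<le> K \<Longrightarrow> 0 \<le> \<theta> k"
  shows "(\<Sum>k=1..K. \<gamma> k * a k) \<le> real K * (\<gamma> 0 * a 0)
      + (\<Sum>k=1..K. (real K - real k + 1) * \<gamma> k * U k) + (\<Sum>k=1..K. \<gamma> k * (real K * q (Suc k) * \<theta> k))"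
proof -
  define r where "r k = \<gamma> k * (q k * X (k - 1) + U k)" for k
  have step: "\<gamma> k * a k \<le> \<gamma> 0 * a 0 + (\<Sum>j=1..k. r j)" if "k \<le> K" for k
    using that
  proof (induction k)
    case (Suc k)
    have "\<gamma> (Suc k) * a (Suc k) \<le> \<gamma> (Suc k) * ((1 + c (Suc k)) * a k + q (Suc k) * X k + U (Suc k))"
      using \<gamma>(1)[of "Suc k"] rec[of k] Suc.prems by (intro mult_left_mono) auto
    also have "\<dots> = \<gamma> (Suc k) * (1 + c (Suc k)) * a k + r (Suc k)" by (simp add: r_def algebra_simps)
    also have "\<gamma> (Suc k) * (1 + c (Suc k)) * a k \<le> \<gamma> k * a k"
      using \<gamma>(2)[of k] a[of k] Suc.prems by (intro mult_right_mono) auto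
    also have "\<gamma> k * a k \<le> \<gamma> 0 * a 0 + (\<Sum>j=1..k. r j)" using Suc by simp
    finally show ?case by simp
  qed simp
  have tri: "(\<Sum>k=1..J. \<gamma> 0 * a 0 + (\<Sum>j=1..k. r j)) = real J * (\<gamma> 0 * a 0) + (\<Sum>j=1..J. (real J - real j + 1) * r j)" for J
  proof (induction J)
    case (Suc J)
    have "(\<Sum>j=1..Suc J. (real (Suc J) - real j + 1) * r j)
        = (\<Sum>j=1..Suc J. r j + (real J - real j + 1) * r j)"
      by (intro sum.cong) (auto simp: algebra_simps)
    also have "\<dots> = (\<Sum>j=1..Suc J. r j) + (\<Sum>j=1..J. (real J - real j + 1) * r j)"
      by (simp add: sum.distrib)
    finally show ?case using Suc by (simp add: algebra_simps)
  qed simp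
  have "(\<Sum>k=1..K. \<gamma> k * a k) \<le> (\<Sum>k=1..K. \<gamma> 0 * a 0 + (\<Sum>j=1..k. r j))"
    using step by (intro sum_mono) auto
  moreover have "(\<Sum>j=1..K. (real K - real j + 1) * r j)
      = (\<Sum>k=1..K. (real K - real k + 1) * \<gamma> k * U k)
        + (\<Sum>k=1..K. (real K - real k + 1) * (\<gamma> k * (q k * X (k - 1))))"
    unfolding r_def sum.distrib[symmetric] by (intro sum.cong) (auto simp: algebra_simps)
  \<comment> \<open>The move at \<open>k - 1\<close> drives the error at \<open>k\<close>. Shifting
    the index turns the weight into \<open>K - k\<close>, which is at most \<open>K\<close>, and
    \<open>\<gamma> (Suc k)\<close> is bounded by \<open>\<gamma> k\<close>.\<close>
  moreover have "(\<Sum>k=1..K. (real K - real k + 1) * (\<gamma> k * (q k * X (k - 1))))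
      \<le> (\<Sum>k=1..K. \<gamma> k * (real K * q (Suc k) * \<theta> k))"
  proof (cases K)
    case (Suc K')
    have "(\<Sum>k=1..K. (real K - real k + 1) * (\<gamma> k * (q k * X (k - 1))))
        = (\<Sum>k=0..K'. (real K - real k) * (\<gamma> (Suc k) * (q (Suc k) * X k)))"
      unfolding Suc using sum.shift_bounds_cl_Suc_ivl[of "\<lambda>k. (real (Suc K') - real k + 1) * (\<gamma> k * (q k * X (k - 1)))" 0 K']
      by (simp add: algebra_simps)
    \<comment> \<open>No move precedes the first inner step, so the term at 0 vanishes.\<close>
    also have "\<dots> = (\<Sum>k=1..K'. (real K - real k) * (\<gamma> (Suc k) * (q (Suc k) * X k)))"
      using X(1) by (simp add: sum.atLeast_Suc_atMost)
    also have "\<dots> \<le> (\<Sum>k=1..K'. \<gamma> k * (real K * q (Suc k) * \<theta> k))"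
    proof (rule sum_mono)
      fix k assume "k \<in> {1..K'}"
      then have k: "1 \<le> k" "k < K" "k \<le> K" using Suc by auto
      have "(real K - real k) * (\<gamma> (Suc k) * (q (Suc k) * X k)) \<le> (real K - real k) * (\<gamma> (Suc k) * (q (Suc k) * \<theta> k))"
        using k X(2)[of k] q[of k] \<gamma>(1)[of "Suc k"] by (intro mult_left_mono) auto
      also have "\<dots> \<le> real K * (\<gamma> k * (q (Suc k) * \<theta> k))"
        using k \<gamma>(3)[of k] X(3)[of k] q[of k] \<gamma>(1)[of "Suc k"] \<gamma>(1)[of k]
        by (intro mult_mono mult_right_mono mult_nonneg_nonneg) auto
      finally show "(real K - real k) * (\<gamma> (Suc k) * (q (Suc k) * X k)) \<le> \<gamma> k * (real K * q (Suc k) * \<theta> k)"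
        by (simp add: algebra_simps)
    qed
    \<comment> \<open>The nonnegative term at \<open>k = K\<close> is added to reach the summation
      range of the descent.\<close>
    also have "\<dots> \<le> (\<Sum>k=1..K. \<gamma> k * (real K * q (Suc k) * \<theta> k))"
      unfolding Suc using \<gamma>(1)[of K] q[of K] X(3)[of K] Suc by simp
    finally show ?thesis .
  qed simp
  ultimately show ?thesis using tri[of K] by linarith
qed

section \<open>Iterates as functions of the directions\<close>

lemma spider_iter_in_domain:
  fixes g :: "real^'q \<Rightarrow> ereal"
  assumes g: "proper_fun g" "lower_semicontinuous g" "convex_ereal_fun g"
    and v: "0 < v" "\<And>s x. g s < \<infinity> \<Longrightarrow> v * (norm x)\<^sup>2 \<le> sqnorm_wrt (B s) x"
    and \<gamma>: "\<And>t k. t \<in> {1..kout} \<Longrightarrow> k \<le> kin t \<Longrightarrow> 0 < \<gamma> t k"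
    and init: "g Sinit < \<infinity>"
    and "t \<le> kout" "t = 0 \<or> k \<le> kin t"
  shows "g (spider_iter g B kin \<gamma> Sinit S t k) < \<infinity>"
  using \<open>t \<le> kout\<close> \<open>t = 0 \<or> k \<le> kin t\<close>
proof (induction t arbitrary: k)
  case 0
  then show ?case using init by simp
next
  case (Suc t)
  from Suc.prems show ?case
  proof (induction k)
    case 0
    then show ?case using Suc.IH[of "kin t"] by simp
  next
    case (Suc k)
    then have IH: "g (spider_iter g B kin \<gamma> Sinit S (Suc t) k) < \<infinity>" by simp
    show ?case
      unfolding spider_iter.simps Let_def
      by (rule prox_in_domain[OF g v(1) v(2)[OF IH]]) (use \<gamma>[of "Suc t" "Suc k"] Suc.prems in auto)
  qed
qed

lemma borel_measurable_compose_restrict: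
  assumes "f \<in> borel_measurable N" "\<And>w. w \<in> space N \<Longrightarrow> f w \<in> T" "h \<in> borel_measurable (restrict_space borel T)"
  shows "(\<lambda>w. h (f w)) \<in> borel_measurable N"
  using measurable_compose[OF measurable_restrict_space2[OF _ assms(1)] assms(3)] assms(2) by auto

text \<open>The sigma-algebra \<open>N\<close> is free and only the directions up to
  \<open>(t, k)\<close> have to be measurable for it; with \<open>N\<close> the history this shows
  that the iterates are adapted.\<close>

lemma borel_measurable_spider_iter:
  fixes g :: "real^'q \<Rightarrow> ereal"
  assumes g: "proper_fun g" "lower_semicontinuous g" "convex_ereal_fun g"
    and v: "0 < v" "\<And>s x. g s < \<infinity> \<Longrightarrow> v * (norm x)\<^sup>2 \<le> sqnorm_wrt (B s) x"
    and B: "\<And>s. g s < \<infinity> \<Longrightarrow> transpose (B s) = B s" "B \<in> borel_measurable (restrict_space borel {s. g s < \<infinity>})"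
    and \<gamma>: "\<And>t k. t \<in> {1..kout} \<Longrightarrow> k \<le> kin t \<Longrightarrow> 0 < \<gamma> t k"
    and init: "g Sinit < \<infinity>"
    and tk: "t \<le> kout" "t = 0 \<or> k \<le> kin t"
    and S: "\<And>t' k'. 1 \<le> t' \<Longrightarrow> t' < t \<and> k' \<le> kin t' \<or> t' = t \<and> k' \<le> k \<Longrightarrow> S t' k' \<in> borel_measurable N"
  shows "(\<lambda>w. spider_iter g B kin \<gamma> Sinit (\<lambda>t k. S t k w) t k) \<in> borel_measurable N"
  using tk S
proof (induction t arbitrary: k)
  case (Suc t)
  from Suc.prems show ?case
  proof (induction k)
    case 0
    have "(\<lambda>w. spider_iter g B kin \<gamma> Sinit (\<lambda>t k. S t k w) t (kin t)) \<in> borel_measurable N"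
    proof (rule Suc.IH)
      fix t' k' assume "1 \<le> t'" "t' < t \<and> k' \<le> kin t' \<or> t' = t \<and> k' \<le> kin t"
      then show "S t' k' \<in> borel_measurable N" using 0(3)[of t' k'] by auto
    qed (use 0 in auto)
    then show ?case by simp
  next
    case (Suc k)
    have IH: "(\<lambda>w. spider_iter g B kin \<gamma> Sinit (\<lambda>t k. S t k w) (Suc t) k) \<in> borel_measurable N"
      by (rule Suc.IH) (use Suc.prems in auto)
    have dom: "g (spider_iter g B kin \<gamma> Sinit (\<lambda>t k. S t k w) (Suc t) k) < \<infinity>" for w
      by (rule spider_iter_in_domain[OF g v \<gamma> init]) (use Suc.prems in auto)
    have SN: "S (Suc t) (Suc k) \<in> borel_measurable N" using Suc.prems by simp
    show ?case
      unfolding spider_iter.simps Let_def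
    proof (rule borel_measurable_prox[OF g _ v(1)])
      show "0 < \<gamma> (Suc t) (Suc k)" using \<gamma> Suc.prems by simp
      show "(\<lambda>w. B (spider_iter g B kin \<gamma> Sinit (\<lambda>t k. S t k w) (Suc t) k)) \<in> borel_measurable N"
        by (rule borel_measurable_compose_restrict[OF IH _ B(2)]) (use dom in auto)
    qed (use B(1)[OF dom] v(2)[OF dom] IH SN in auto)
  qed
qed simp

section \<open>The algorithm\<close>

text \<open>\<open>S\<close>, \<open>Shat\<close> and \<open>\<mu>\<close> are parameters tied down
  by equations, so that the locally defined constants of the theorem can be supplied directly.
  \<open>step_small\<close> is the share of the condition on \<Lambda> that makes the descent
  coefficients positive.\<close>

locale spider =
  fixes M :: "'w measure"
    and n kout b :: nat and kin b' :: "nat \<Rightarrow> nat" and repl :: bool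
    and g :: "real^'q \<Rightarrow> ereal" and W :: "real^'q \<Rightarrow> real"
    and G :: "nat \<Rightarrow> real^'q \<Rightarrow> real^'q" and B :: "real^'q \<Rightarrow> real^'q^'q"
    and \<gamma> :: "nat \<Rightarrow> nat \<Rightarrow> real" and Sinit :: "real^'q"
    and batch :: "nat \<Rightarrow> nat \<Rightarrow> 'w \<Rightarrow> nat list"
    and \<delta> :: "nat \<Rightarrow> nat \<Rightarrow> nat \<Rightarrow> nat \<Rightarrow> 'w \<Rightarrow> real^'q"
    and L :: "nat \<Rightarrow> real" and LW vmin vmax Cb Cv Cvb :: real
    and m Mv Mbar :: "nat \<Rightarrow> nat \<Rightarrow> real"
    and S Shat :: "nat \<Rightarrow> nat \<Rightarrow> 'w \<Rightarrow> real^'q" and \<mu> :: "nat \<Rightarrow> nat \<Rightarrow> nat \<Rightarrow> nat \<Rightarrow> 'w \<Rightarrow> real^'q"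
  assumes S_def: "S = (\<lambda>t k w. spider_dir b b' (\<lambda>t k. batch t k w) (\<lambda>t k j i. \<delta> t k j i w) t k)"
    and Shat_def: "Shat = (\<lambda>t k w. spider_iter g B kin \<gamma> Sinit (\<lambda>t k. S t k w) t k)"
    and \<mu>_def: "\<mu> = (\<lambda>t k j i. vec_cond_exp M (spider_half M batch Shat t k)
       (\<lambda>w. \<delta> t (k+1) j i w - hbar_i B G i (Shat t k w) + hbar_i B G i (Shat t (k-1) w)))"
    and prob: "prob_space M"
    and n: "1 \<le> n"
    and B_pd: "\<And>s. g s < \<infinity> \<Longrightarrow> pos_def_matrix (B s)"
    and B_meas: "B \<in> borel_measurable (restrict_space borel {s. g s < \<infinity>})"
    and sizes: "1 \<le> b" "repl \<or> b \<le> n" "\<And>t. t \<in> {1..kout} \<Longrightarrow> 1 \<le> kin t"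
    and steps: "\<And>t k. t \<in> {1..kout} \<Longrightarrow> k \<le> kin t \<Longrightarrow> 0 < \<gamma> t k"
    and init: "g Sinit < \<infinity>"
    and batches: "\<And>t k. t \<in> {1..kout} \<Longrightarrow> k \<le> kin t \<Longrightarrow>
           batch t k \<in> measurable M (count_space UNIV)
           \<and> (\<forall>w\<in>space M. length (batch t k w) = batch_size b b' t k \<and> set (batch t k w) \<subseteq> {1..n})"
    and \<delta>_meas: "\<And>t k j i. t \<in> {1..kout} \<Longrightarrow> k \<le> kin t \<Longrightarrow> j < batch_size b b' t k \<Longrightarrow> i \<in> {1..n}
           \<Longrightarrow> \<delta> t k j i \<in> borel_measurable M"
    and sampling: "\<And>t k. t \<in> {1..kout} \<Longrightarrow> k < kin t \<Longrightarrow>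
           spider_sampling M repl n kin b b' batch \<delta> Shat t k"
    and A1: "proper_fun g" "lower_semicontinuous g" "convex_ereal_fun g"
    and A2: "\<And>i. i \<in> {1..n} \<Longrightarrow> (L i)-lipschitz_on {s. g s < \<infinity>} (hbar_i B G i)"
    and A3a: "\<And>s. g s < \<infinity> \<Longrightarrow> GDERIV W s :> (1 / real n) *\<^sub>R (\<Sum>i=1..n. G i s)"
    and A3b: "LW-lipschitz_on {s. g s < \<infinity>} (\<lambda>s. (1 / real n) *\<^sub>R (\<Sum>i=1..n. G i s))"
    and A3c: "0 < vmin" "vmin \<le> vmax"
             "\<And>s x. g s < \<infinity> \<Longrightarrow> vmin * (norm x)\<^sup>2 \<le> sqnorm_wrt (B s) x
                              \<and> sqnorm_wrt (B s) x \<le> vmax * (norm x)\<^sup>2"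
    and \<xi>_int: "\<And>t k j i. t \<in> {1..kout} \<Longrightarrow> k < kin t \<Longrightarrow> j < b \<Longrightarrow> i \<in> {1..n} \<Longrightarrow>
           integrable M (\<lambda>w. \<delta> t (k+1) j i w - hbar_i B G i (Shat t k w) + hbar_i B G i (Shat t (k-1) w))"
    and \<mu>_draw: "\<And>t k j j' i. t \<in> {1..kout} \<Longrightarrow> k < kin t \<Longrightarrow> j < b \<Longrightarrow> j' < b \<Longrightarrow> i \<in> {1..n}
           \<Longrightarrow> AE w in M. \<mu> t k j i w = \<mu> t k j' i w"
    and A4a: "\<And>t k. t \<in> {1..kout} \<Longrightarrow> k < kin t \<Longrightarrow>
           cond_indep_sets M (spider_half M batch Shat t k)
             (\<lambda>j. sets (vimage_algebra (space M)
                    (\<lambda>w. \<delta> t (k+1) j (batch t (k+1) w ! j) w) borel)) {..<b}"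
    and A4_const: "0 \<le> Cb" "0 \<le> Cv" "0 \<le> Cvb"
    and A4_seq: "\<And>t k. t \<in> {1..kout} \<Longrightarrow> 1 \<le> k \<Longrightarrow> 0 < m t k \<and> 0 < Mv t k \<and> 0 < Mbar t k"
    and A4b: "\<And>t k j. t \<in> {1..kout} \<Longrightarrow> k < kin t \<Longrightarrow> j < b \<Longrightarrow>
           AE w in M. norm ((1 / real n) *\<^sub>R (\<Sum>i=1..n. \<mu> t k j i w)) \<le> Cb / m t (k+1)"
    and A4c: "\<And>t k j. t \<in> {1..kout} \<Longrightarrow> k < kin t \<Longrightarrow> j < b \<Longrightarrow>
           AE w in M. (\<Sum>i=1..n. nn_cond_exp M (spider_half M batch Shat t k)
             (\<lambda>w. ennreal ((norm (\<delta> t (k+1) j i w - hbar_i B G i (Shat t k w)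
                + hbar_i B G i (Shat t (k-1) w) - \<mu> t k j i w))\<^sup>2)) w) / of_nat n \<le> ennreal (Cv / Mv t (k+1))"
           "\<And>t k j. t \<in> {1..kout} \<Longrightarrow> k < kin t \<Longrightarrow> j < b \<Longrightarrow>
           AE w in M. (\<Sum>i=1..n. (norm (\<mu> t k j i w - (1 / real n) *\<^sub>R (\<Sum>i=1..n. \<mu> t k j i w)))\<^sup>2) / real n
                        \<le> Cvb\<^sup>2 / (Mbar t (k+1))\<^sup>2"
    and step_decr: "\<And>t k. t \<in> {1..kout} \<Longrightarrow> k < kin t \<Longrightarrow>
           \<gamma> t (k+1) * (1 + 2 * Cb / m t (k+1)) \<le> \<gamma> t k"
    and step_small: "\<And>t k. t \<in> {1..kout} \<Longrightarrow> k < kin t \<Longrightarrow> \<gamma> t k * LW / vmin < 1/2"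
begin

sublocale prob_space M by (rule prob)

abbreviation past :: "nat \<Rightarrow> nat \<Rightarrow> 'w measure" where
  "past t k \<equiv> spider_past M kin b b' batch \<delta> t k"

abbreviation h where "h i \<equiv> hbar_i B G i"

text \<open>By truncated subtraction \<open>err t 0\<close> compares the initial direction with the
  field at \<open>Shat t 0\<close>, which is the initial error of outer iteration \<open>t\<close>.
  For \<open>k \<ge> 1\<close> the direction \<open>S t k\<close> estimates the field at the iterate
  from which the step starts.\<close>

definition err :: "nat \<Rightarrow> nat \<Rightarrow> 'w \<Rightarrow> real^'q" where
  "err t k w = S t k w - hbar n B G (Shat t (k-1) w)"

lemma vmax: "0 < vmax" using A3c by linarith

lemma A3c_lower: "g s < \<infinity> \<Longrightarrow> vmin * (norm x)\<^sup>2 \<le> sqnorm_wrt (B s) x"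
  and A3c_upper: "g s < \<infinity> \<Longrightarrow> sqnorm_wrt (B s) x \<le> vmax * (norm x)\<^sup>2"
  using A3c(3) by auto

lemma B_sym: "g s < \<infinity> \<Longrightarrow> transpose (B s) = B s"
  using B_pd by (simp add: pos_def_matrix_def)

lemma step_mono:
  assumes "t \<in> {1..kout}" "k < kin t"
  shows "\<gamma> t (Suc k) \<le> \<gamma> t k"
proof -
  have "0 < \<gamma> t (Suc k)" "0 \<le> 2 * Cb / m t (Suc k)"
    using steps[of t "Suc k"] A4_const(1) A4_seq[of t "Suc k"] assms by auto
  then have "\<gamma> t (Suc k) * 1 \<le> \<gamma> t (Suc k) * (1 + 2 * Cb / m t (Suc k))"
    by (intro mult_left_mono) auto
  then show ?thesis using step_decr[OF assms] by simp
qed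

lemma Shat_dom: "t \<le> kout \<Longrightarrow> t = 0 \<or> k \<le> kin t \<Longrightarrow> g (Shat t k w) < \<infinity>"
  unfolding Shat_def by (rule spider_iter_in_domain[OF A1 A3c(1) A3c_lower steps init])

lemma measurable_on_domain:
  assumes "f \<in> borel_measurable N" "\<And>w. g (f w) < \<infinity>"
  shows "i \<in> {1..n} \<Longrightarrow> (\<lambda>w. h i (f w)) \<in> borel_measurable N"
    and "(\<lambda>w. B (f w)) \<in> borel_measurable N"
    and "(\<lambda>w. hbar n B G (f w)) \<in> borel_measurable N"
proof -
  show 1: "(\<lambda>w. h i (f w)) \<in> borel_measurable N" if "i \<in> {1..n}" for i
    by (rule borel_measurable_compose_restrict[OF assms(1) _
          borel_measurable_continuous_on_restrict[OF lipschitz_on_continuous_on[OF A2[OF that]]]])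
      (use assms(2) in auto)
  show "(\<lambda>w. B (f w)) \<in> borel_measurable N"
    by (rule borel_measurable_compose_restrict[OF assms(1) _ B_meas]) (use assms(2) in auto)
  show "(\<lambda>w. hbar n B G (f w)) \<in> borel_measurable N"
    unfolding hbar_def using 1 by (intro borel_measurable_scaleR borel_measurable_sum) auto
qed

section \<open>Measurability with respect to the history\<close>

definition gen :: "nat \<Rightarrow> nat \<Rightarrow> 'w set set" where
  "gen t k = sets (vimage_algebra (space M) (batch t k) (count_space UNIV))
     \<union> (\<Union>j<batch_size b b' t k. sets (vimage_algebra (space M) (\<lambda>w. \<delta> t k j (batch t k w ! j) w) borel))"

lemma past_eq: "past t k = sigma (space M)
    (\<Union>(t', k') \<in> {(t', k'). 1 \<le> t' \<and> (t' < t \<and> k' \<le> kin t' \<or> t' = t \<and> k' \<le> k)}. gen t' k')"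
  by (simp add: spider_past_def gen_def)

lemma gen_space: "gen t k \<subseteq> Pow (space M)"
  unfolding gen_def using sets.space_closed by (fastforce simp: space_vimage_algebra)

lemma sets_past: "sets (past t k) = sigma_sets (space M)
    (\<Union>(t', k') \<in> {(t', k'). 1 \<le> t' \<and> (t' < t \<and> k' \<le> kin t' \<or> t' = t \<and> k' \<le> k)}. gen t' k')"
  unfolding past_eq using gen_space by (intro sets_measure_of) blast

lemma space_past: "space (past t k) = space M"
  by (simp add: past_eq space_measure_of_conv)

lemma batch_nth_in:
  assumes "t \<in> {1..kout}" "k \<le> kin t" "w \<in> space M" "j < batch_size b b' t k"
  shows "batch t k w ! j \<in> {1..n}"
  using batches[OF assms(1,2)] assms(3,4) nth_mem[of j "batch t k w"] by fastforce

lemma \<delta>_draw_measurable: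
  assumes t: "t \<in> {1..kout}" "k \<le> kin t" and j: "j < batch_size b b' t k"
  shows "(\<lambda>w. \<delta> t k j (batch t k w ! j) w) \<in> borel_measurable M"
proof (rule borel_measurable_select[where I = "{1..n}"])
  show "(\<lambda>w. batch t k w ! j) \<in> measurable M (count_space UNIV)"
    using measurable_compose[of "batch t k" M "count_space UNIV" "\<lambda>l. l ! j"] batches[OF t] by simp
qed (use batch_nth_in[OF t _ j] \<delta>_meas[OF t j] in auto)

lemma gen_events:
  assumes t: "t \<in> {1..kout}" "k \<le> kin t"
  shows "gen t k \<subseteq> events"
  unfolding gen_def
  using sets_vimage_algebra_subset[of "batch t k" M "count_space UNIV"] batches[OF t]
    sets_vimage_algebra_subset[OF \<delta>_draw_measurable[OF t] refl] by blast

lemma subalgebra_past: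
  assumes "t \<in> {1..kout}" "k \<le> kin t"
  shows "subalgebra M (past t k)"
  unfolding subalgebra_def space_past sets_past
proof (intro conjI sets.sigma_sets_subset)
  have "gen t' k' \<subseteq> events" if "1 \<le> t'" "t' < t \<and> k' \<le> kin t' \<or> t' = t \<and> k' \<le> k" for t' k'
    by (rule gen_events) (use that assms in auto)
  then show "(\<Union>(t', k') \<in> {(t', k'). 1 \<le> t' \<and> (t' < t \<and> k' \<le> kin t' \<or> t' = t \<and> k' \<le> k)}. gen t' k') \<subseteq> events"
    by blast
qed simp

lemma S_past:
  assumes "1 \<le> t'" "t' < t \<and> k' \<le> kin t' \<or> t' = t \<and> k' \<le> k"
  shows "S t' k' \<in> borel_measurable (past t k)"
proof -
  have \<delta>: "(\<lambda>w. \<delta> t' l j (batch t' l w ! j) w) \<in> borel_measurable (past t k)"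
    if l: "l \<le> k'" "j < batch_size b b' t' l" for l j
  proof (rule measurableI)
    fix A :: "(real^'q) set" assume A: "A \<in> sets borel"
    have "(\<lambda>w. \<delta> t' l j (batch t' l w ! j) w) -` A \<inter> space M \<in> gen t' l"
      unfolding gen_def using l(2) in_vimage_algebra[OF A, of "\<lambda>w. \<delta> t' l j (batch t' l w ! j) w" "space M"] by blast
    moreover have "1 \<le> t' \<and> (t' < t \<and> l \<le> kin t' \<or> t' = t \<and> l \<le> k)" using assms l(1) by auto
    ultimately show "(\<lambda>w. \<delta> t' l j (batch t' l w ! j) w) -` A \<inter> space (past t k) \<in> sets (past t k)"
      unfolding sets_past space_past by (intro sigma_sets.Basic) blast
  qed simp
  have "S t' l \<in> borel_measurable (past t k)" if "l \<le> k'" for l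
    using that
  proof (induction l)
    case 0
    then show ?case unfolding S_def spider_dir.simps
      by (intro borel_measurable_scaleR borel_measurable_sum borel_measurable_const \<delta>) (auto simp: batch_size_def)
  next
    case (Suc l)
    then have "S t' l \<in> borel_measurable (past t k)" by simp
    then show ?case using Suc.prems unfolding S_def spider_dir.simps
      by (intro borel_measurable_add borel_measurable_scaleR borel_measurable_sum borel_measurable_const \<delta>)
        (auto simp: batch_size_def)
  qed
  then show ?thesis by simp
qed

lemma Shat_past:
  assumes "t \<in> {1..kout}" "k \<le> kin t" "k' \<le> k"
  shows "Shat t k' \<in> borel_measurable (past t k)"
  unfolding Shat_def
proof (rule borel_measurable_spider_iter[OF A1 A3c(1) A3c_lower B_sym B_meas steps init])
  fix t' l assume "1 \<le> t'" "t' < t \<and> l \<le> kin t' \<or> t' = t \<and> l \<le> k'"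
  then show "S t' l \<in> borel_measurable (past t k)" using assms(3) by (intro S_past) auto
qed (use assms in auto)

lemma Shat_M: "t \<in> {1..kout} \<Longrightarrow> k \<le> kin t \<Longrightarrow> Shat t k \<in> borel_measurable M"
  using measurable_from_subalg[OF subalgebra_past Shat_past] by blast

lemma err_past:
  assumes "t \<in> {1..kout}" "k \<le> kin t"
  shows "err t k \<in> borel_measurable (past t k)"
  unfolding err_def[abs_def]
  by (intro borel_measurable_diff S_past measurable_on_domain(3) Shat_past assms Shat_dom)
    (use assms in auto)

lemma err_M: "t \<in> {1..kout} \<Longrightarrow> k \<le> kin t \<Longrightarrow> err t k \<in> borel_measurable M"
  using measurable_from_subalg[OF subalgebra_past err_past] by blast

text \<open>This is the constant \<open>L^2\<close>, with \<open>L\<close> the quadratic mean of the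
  Lipschitz constants.\<close>

definition lip where "lip = (\<Sum>i=1..n. (L i)\<^sup>2) / real n"

definition U where
  "U t k = 2 * (Cb / m t k) + (Cb / m t k)\<^sup>2 + (Cv / Mv t k) / real b + 2 * (Cvb / Mbar t k) / sqrt b
     + (Cvb / Mbar t k)\<^sup>2 / real b"

text \<open>An instance of the abstract step: the iterates generate \<open>Q\<close> inside the
  history, the batch is added to form \<open>P\<close>, and history and batch together contain
  \<open>P\<close>. The increments of the fields are controlled by the length of the last move
  through their Lipschitz constants.\<close>

lemma err_step:
  assumes t: "t \<in> {1..kout}" and k: "k < kin t"
    and L2: "square_integrable M (err t k)"
    and move: "integrable M (\<lambda>w. (norm (Shat t k w - Shat t (k-1) w))\<^sup>2)"
  shows "square_integrable M (err t (Suc k))"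
    and "(LINT w|M. (norm (err t (Suc k) w))\<^sup>2)
      \<le> (1 + 2 * Cb / m t (Suc k)) * (LINT w|M. (norm (err t k w))\<^sup>2)
        + (1 + 2 * (Cvb / Mbar t (Suc k)) / sqrt b) / real b * lip
            * (LINT w|M. (norm (Shat t k w - Shat t (k-1) w))\<^sup>2) + U t (Suc k)"
    (is "?next \<le> ?rhs")
proof -
  let ?P = "spider_half M batch Shat t k"
  let ?Q = "vimage_algebra (space M) (\<lambda>w. (Shat t k w, Shat t (k-1) w)) (borel \<Otimes>\<^sub>M borel)"
  let ?Bt = "batch t (k+1)"
  let ?Draw = "vimage_algebra (space M) ?Bt (count_space UNIV)"
  let ?d = "\<lambda>i w. h i (Shat t k w) - h i (Shat t (k-1) w)"
  have kk: "k \<le> kin t" "k - 1 \<le> kin t" "k + 1 \<le> kin t" using k by auto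
  have smp: "distr M (count_space UNIV) ?Bt = measure_pmf (uniform_batch repl n b)"
    "indep_set (sets ?Draw) (sets (past t k))"
    "cond_indep_set M ?Q
       (sigma_sets (space M) (\<Union>j<b. \<Union>i\<in>{1..n}. sets (vimage_algebra (space M) (\<delta> t (k+1) j i) borel)))
       (sigma_sets (space M) (sets (past t k) \<union> sets ?Draw))"
    using sampling[OF t k] unfolding spider_sampling_def Let_def by auto
  have dom: "g (Shat t k w) < \<infinity>" "g (Shat t (k-1) w) < \<infinity>" for w
    by (rule Shat_dom; use t kk in auto)+
  have pair: "(\<lambda>w. (Shat t k w, Shat t (k-1) w)) \<in> measurable (past t k) (borel \<Otimes>\<^sub>M borel)"
    by (intro measurable_Pair Shat_past t kk) auto
  have sigPD: "sets (past t k) \<union> sets ?Draw \<subseteq> Pow (space M)"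
    using sets.space_closed[of "past t k"] sets.space_closed[of ?Draw] by (auto simp: space_past)
  let ?PD = "sigma (space M) (sets (past t k) \<union> sets ?Draw)"
  have setsPD: "sets ?PD = sigma_sets (space M) (sets (past t k) \<union> sets ?Draw)"
    using sigPD by simp
  have spPD: "space ?PD = space M" by (simp add: space_measure_of_conv)
  have subPD: "subalgebra ?PD (past t k)"
    unfolding subalgebra_def setsPD spPD space_past by auto
  have BtPD: "?Bt \<in> measurable ?PD (count_space UNIV)"
  proof (rule measurableI)
    fix A :: "nat list set"
    have "?Bt -` A \<inter> space M \<in> sets ?Draw" by (rule in_vimage_algebra) simp
    then show "?Bt -` A \<inter> space ?PD \<in> sets ?PD" unfolding setsPD spPD by auto
  qed simp
  have trip: "(\<lambda>w. (?Bt w, Shat t k w, Shat t (k-1) w))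
      \<in> measurable ?PD (count_space UNIV \<Otimes>\<^sub>M borel \<Otimes>\<^sub>M borel)"
    by (rule measurable_Pair[OF BtPD measurable_from_subalg[OF subPD pair]])
  have P_id: "(\<lambda>w. (?Bt w, Shat t k w, Shat t (k-1) w))
      \<in> measurable ?P (count_space UNIV \<Otimes>\<^sub>M borel \<Otimes>\<^sub>M borel)"
    unfolding spider_half_def by (rule measurable_vimage_algebra1) (simp add: space_pair_measure)
  have Q_id: "(\<lambda>w. (Shat t k w, Shat t (k-1) w)) \<in> measurable ?Q (borel \<Otimes>\<^sub>M borel)"
    by (rule measurable_vimage_algebra1) (simp add: space_pair_measure)
  have ShatQ: "Shat t k \<in> borel_measurable ?Q" "Shat t (k-1) \<in> borel_measurable ?Q"
    using measurable_compose[OF Q_id measurable_fst] measurable_compose[OF Q_id measurable_snd] by simp_all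
  have spP: "space ?P = space M" by (simp add: spider_half_def)
  have subQ: "subalgebra (past t k) ?Q"
    unfolding subalgebra_def using sets_vimage_algebra_subset[OF pair space_past] by (simp add: space_past)
  have PQ: "(\<lambda>w. (Shat t k w, Shat t (k-1) w)) \<in> measurable ?P (borel \<Otimes>\<^sub>M borel)"
    using measurable_compose[OF P_id measurable_snd] by simp
  have subPQ: "subalgebra ?P ?Q"
    unfolding subalgebra_def using sets_vimage_algebra_subset[OF PQ spP] by (simp add: spP)
  have setsP: "sets ?P \<subseteq> sigma_sets (space M) (sets (past t k) \<union> sets ?Draw)"
    unfolding setsPD[symmetric] unfolding spider_half_def by (rule sets_vimage_algebra_subset[OF trip spPD])
  have BtP: "?Bt \<in> measurable ?P (count_space UNIV)"
    using measurable_compose[OF P_id measurable_fst] by simp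
  have bt: "batch_size b b' t (k+1) = b" by (simp add: batch_size_def)
  have eq: "\<delta> t (k+1) j i w - ?d i w = \<delta> t (k+1) j i w - h i (Shat t k w) + h i (Shat t (k-1) w)" for j i w
    by simp
  interpret E: spider_error_step M n b repl "past t k" ?Q ?P ?Draw ?Bt "\<delta> t (k+1)" ?d "err t k"
    "\<lambda>w. norm (Shat t k w - Shat t (k-1) w)" L
  proof (unfold_locales)
    show "subalgebra M (past t k)" by (rule subalgebra_past[OF t kk(1)])
    show "err t k \<in> borel_measurable (past t k)" by (rule err_past[OF t kk(1)])
    show "integrable M (\<lambda>w. (norm (err t k w))\<^sup>2)" by (rule square_integrableD(2)[OF L2])
    show "(\<lambda>w. norm (Shat t k w - Shat t (k-1) w)) \<in> borel_measurable M"
      using Shat_M[OF t kk(1)] Shat_M[OF t kk(2)] by simp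
    show "?d i \<in> borel_measurable ?Q" if "i \<in> {1..n}" for i
      by (intro borel_measurable_diff measurable_on_domain(1) ShatQ dom that)
    show "norm (?d i w) \<le> L i * norm (Shat t k w - Shat t (k-1) w)" if "i \<in> {1..n}" for i w
      using lipschitz_onD[OF A2[OF that], of "Shat t k w" "Shat t (k-1) w"] dom by (simp add: dist_norm)
    show "length (?Bt w) = b \<and> set (?Bt w) \<subseteq> {1..n}" if "w \<in> space M" for w
      using batches[OF t kk(3)] that bt by simp
    show "?Bt \<in> measurable M (count_space UNIV)" using batches[OF t kk(3)] by simp
    show "\<delta> t (k+1) j i \<in> borel_measurable M" if "j < b" "i \<in> {1..n}" for j i
      using \<delta>_meas[OF t kk(3) _ that(2), of j] that bt by simp
    show "integrable M (\<lambda>w. \<delta> t (k+1) j i w - ?d i w)" if "j < b" "i \<in> {1..n}" for j i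
      unfolding eq by (rule \<xi>_int[OF t k that])
  qed (use n sizes smp subQ spP setsP subPQ BtP A4a[OF t k] move in \<open>simp_all\<close>)
  have \<mu>: "E.\<mu> j i = \<mu> t k j i" for j i
    unfolding E.\<mu>_def \<mu>_def eq ..
  interpret E: spider_error_bounds M n b repl "past t k" ?Q ?P ?Draw ?Bt "\<delta> t (k+1)" ?d "err t k"
    "\<lambda>w. norm (Shat t k w - Shat t (k-1) w)" L "Cb / m t (k+1)" "Cv / Mv t (k+1)" "Cvb / Mbar t (k+1)"
  proof (unfold_locales, unfold \<mu> eq)
    show "0 \<le> Cv / Mv t (k+1)" "0 \<le> Cvb / Mbar t (k+1)" using A4_const A4_seq[OF t, of "k+1"] by auto
  qed (use \<mu>_draw[OF t k] A4b[OF t k] A4c[OF t k] in \<open>simp_all add: power_divide\<close>)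
  \<comment> \<open>The field at \<open>Shat t (k-1)\<close> cancels between \<open>err t k\<close>
    and the mean increment; for \<open>k = 0\<close> the two iterates coincide and the increment is
    0.\<close>
  have next_eq: "E.next_error = err t (Suc k)"
  proof
    fix w
    have S_Suc: "S t (Suc k) w = S t k w + (1 / real b) *\<^sub>R (\<Sum>j<b. \<delta> t (Suc k) j (batch t (Suc k) w ! j) w)"
      by (simp add: S_def)
    have d_mean: "E.d_mean w = hbar n B G (Shat t k w) - hbar n B G (Shat t (k-1) w)"
      unfolding E.d_mean_def hbar_def by (simp add: sum_subtractf scaleR_diff_right)
    show "E.next_error w = err t (Suc k) w"
      unfolding E.next_error_def d_mean err_def S_Suc by simp
  qed
  show "square_integrable M (err t (Suc k))" using E.next_error_bound(1) unfolding next_eq .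
  show "?next \<le> ?rhs"
    using E.next_error_bound(2) unfolding next_eq U_def lip_def by (simp add: mult.assoc)
qed

section \<open>Pathwise descent of the objective\<close>

definition \<Delta>star :: "nat \<Rightarrow> nat \<Rightarrow> 'w \<Rightarrow> real" where
  "\<Delta>star t k w = sqnorm_wrt (B (Shat t (k-1) w))
     (prox (B (Shat t (k-1) w)) (\<gamma> t k) g (Shat t (k-1) w + \<gamma> t k *\<^sub>R hbar n B G (Shat t (k-1) w))
       - Shat t (k-1) w) / (\<gamma> t k)\<^sup>2"

definition Dstar :: "nat \<Rightarrow> nat \<Rightarrow> 'w \<Rightarrow> real" where
  "Dstar t k w = sqnorm_wrt (B (Shat t (k-1) w)) (Shat t k w
     - prox (B (Shat t (k-1) w)) (\<gamma> t k) g (Shat t (k-1) w + \<gamma> t k *\<^sub>R hbar n B G (Shat t (k-1) w)))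
       / (\<gamma> t k)\<^sup>2"

definition obj :: "real^'q \<Rightarrow> real" where
  "obj s = W s + real_of_ereal (g s)"

text \<open>The descent coefficient before the accumulated errors are charged to it; the charge
  turns it into \<open>\<gamma> t k * (1/2 - \<Lambda> t (k+1))\<close>.\<close>

definition wgt :: "nat \<Rightarrow> nat \<Rightarrow> real" where
  "wgt t k = \<gamma> t k * (1/2 - \<gamma> t k * LW / vmin)"

lemma Shat_Suc:
  assumes "1 \<le> t" "1 \<le> k"
  shows "Shat t k w = prox (B (Shat t (k-1) w)) (\<gamma> t k) g (Shat t (k-1) w + \<gamma> t k *\<^sub>R S t k w)"
proof -
  obtain t' k' where "t = Suc t'" "k = Suc k'" using assms by (metis Suc_le_D One_nat_def)
  then show ?thesis by (simp add: Shat_def Let_def)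
qed

text \<open>Positive definiteness makes \<open>B s\<close> injective, hence invertible, so that the
  averaged field is the preconditioned negative gradient of \<open>W\<close>.\<close>

lemma gradient_eq:
  assumes "g s < \<infinity>"
  shows "(1 / real n) *\<^sub>R (\<Sum>i=1..n. G i s) = - (B s *v hbar n B G s)"
proof -
  have "invertible (B s)"
    unfolding invertible_left_inverse matrix_left_invertible_ker
  proof (intro allI impI)
    fix x assume "B s *v x = 0"
    then show "x = 0" using B_pd[OF assms] unfolding pos_def_matrix_def by (metis inner_zero_left less_irrefl)
  qed
  then have "B s ** matrix_inv (B s) = mat 1"
    unfolding invertible_def matrix_inv_def by (rule someI2_ex) simp
  then have "B s *v (matrix_inv (B s) *v y) = y" for y
    by (simp add: matrix_vector_mul_assoc)
  then have "B s *v h i s = - G i s" for i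
    using matrix_vector_mult_diff_distrib[of "B s" 0 "matrix_inv (B s) *v G i s"] by (simp add: hbar_i_def)
  then have "B s *v (\<Sum>i=1..n. h i s) = - (\<Sum>i=1..n. G i s)"
    by (simp add: linear_sum[OF matrix_vector_mul_linear] sum_negf)
  then show ?thesis
    unfolding hbar_def matrix_vector_mult_scaleR by simp
qed

lemma star_nonneg:
  assumes "t \<in> {1..kout}" "k \<in> {1..kin t}"
  shows "0 \<le> \<Delta>star t k w" "0 \<le> Dstar t k w"
proof -
  have dom: "g (Shat t (k-1) w) < \<infinity>" by (rule Shat_dom) (use assms in auto)
  have "0 \<le> sqnorm_wrt (B (Shat t (k-1) w)) x" for x
    by (rule order_trans[OF _ A3c_lower[OF dom]]) (simp add: A3c(1) less_imp_le)
  then show "0 \<le> \<Delta>star t k w" "0 \<le> Dstar t k w" by (simp_all add: \<Delta>star_def Dstar_def)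
qed

lemma descent_step:
  assumes t: "t \<in> {1..kout}" and k: "k \<in> {1..kin t}"
  shows "obj (Shat t k w) + wgt t k * (\<Delta>star t k w + Dstar t k w)
    \<le> obj (Shat t (k-1) w) + \<gamma> t k * vmax * (norm (err t k w))\<^sup>2"
proof -
  let ?s = "Shat t (k-1) w"
  have dom: "g ?s < \<infinity>" by (rule Shat_dom) (use t k in auto)
  have \<gamma>: "0 < \<gamma> t k" using steps t k by simp
  have t1: "1 \<le> t" and k1: "1 \<le> k" using t k by auto
  show ?thesis
    unfolding obj_def wgt_def \<Delta>star_def Dstar_def err_def
      Shat_Suc[OF t1 k1, of w]
    by (rule prox_gradient_descent[OF A1 \<gamma> B_sym[OF dom] A3c(1) A3c_lower[OF dom] A3c_upper[OF dom] dom
          A3a A3b gradient_eq[OF dom]])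
qed

lemma move_le:
  assumes t: "t \<in> {1..kout}" and k: "k \<in> {1..kin t}"
  shows "(norm (Shat t k w - Shat t (k-1) w))\<^sup>2 \<le> 2 * (\<gamma> t k)\<^sup>2 / vmin * (\<Delta>star t k w + Dstar t k w)"
proof -
  have dom: "g (Shat t (k-1) w) < \<infinity>" by (rule Shat_dom) (use t k in auto)
  have \<gamma>: "0 < \<gamma> t k" using steps t k by simp
  show ?thesis
    unfolding \<Delta>star_def Dstar_def by (rule prox_step_length[OF B_sym[OF dom] A3c(1) A3c_lower[OF dom] \<gamma>])
qed

text \<open>\<open>step_small\<close> covers the step sizes with inner index below
  \<open>kin t\<close>; since step sizes do not increase, the bound at \<open>k - 1\<close> passes
  to \<open>k\<close>, in particular to \<open>k = kin t\<close>.\<close>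

lemma wgt_pos:
  assumes t: "t \<in> {1..kout}" and k: "k \<in> {1..kin t}"
  shows "0 < wgt t k"
proof -
  have LW: "0 \<le> LW" using A3b by (rule lipschitz_on_nonneg)
  have "\<gamma> t k \<le> \<gamma> t (k-1)" using step_mono[OF t, of "k-1"] k by (cases k) auto
  then have "\<gamma> t k * LW / vmin \<le> \<gamma> t (k-1) * LW / vmin"
    using LW A3c(1) by (intro divide_right_mono mult_right_mono) auto
  moreover have "\<gamma> t (k-1) * LW / vmin < 1/2" using k by (intro step_small t) auto
  ultimately have "0 < 1/2 - \<gamma> t k * LW / vmin" by linarith
  then show ?thesis using steps[of t k] t k by (simp add: wgt_def)
qed

lemma descent_inner:
  assumes t: "t \<in> {1..kout}" and k: "k \<le> kin t"
  shows "obj (Shat t k w) + (\<Sum>l=1..k. wgt t l * (\<Delta>star t l w + Dstar t l w))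
    \<le> obj (Shat t 0 w) + vmax * (\<Sum>l=1..k. \<gamma> t l * (norm (err t l w))\<^sup>2)"
  using k
proof (induction k)
  case (Suc k)
  then show ?case using descent_step[OF t, of "Suc k" w] by (simp add: algebra_simps)
qed simp

text \<open>The inner telescopes chain up because each outer iteration starts where the previous one
  ended.\<close>

lemma descent_outer:
  assumes "t \<le> kout"
  shows "obj (Shat t (kin t) w) + (\<Sum>t'=1..t. \<Sum>l=1..kin t'. wgt t' l * (\<Delta>star t' l w + Dstar t' l w))
    \<le> obj Sinit + vmax * (\<Sum>t'=1..t. \<Sum>l=1..kin t'. \<gamma> t' l * (norm (err t' l w))\<^sup>2)"
  using assms
proof (induction t)
  case (Suc t)
  have "Shat (Suc t) 0 w = Shat t (kin t) w" by (simp add: Shat_def)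
  then show ?case using descent_inner[of "Suc t" "kin (Suc t)" w] Suc by (simp add: algebra_simps)
qed (simp add: Shat_def)

lemma star_measurable:
  assumes t: "t \<in> {1..kout}" and k: "k \<in> {1..kin t}"
  shows "\<Delta>star t k \<in> borel_measurable M" "Dstar t k \<in> borel_measurable M"
proof -
  have kk: "k \<le> kin t" "k - 1 \<le> kin t" using k by auto
  have dom: "g (Shat t (k-1) w) < \<infinity>" for w by (rule Shat_dom) (use t k in auto)
  note s = Shat_M[OF t kk(2)] Shat_M[OF t kk(1)]
  note Bm = measurable_on_domain(2)[OF s(1) dom]
  have p: "(\<lambda>w. prox (B (Shat t (k-1) w)) (\<gamma> t k) g (Shat t (k-1) w + \<gamma> t k *\<^sub>R hbar n B G (Shat t (k-1) w)))
      \<in> borel_measurable M"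
    using measurable_on_domain(3)[OF s(1) dom] s steps[OF t kk(1)]
    by (intro borel_measurable_prox[OF A1 _ A3c(1) B_sym[OF dom] A3c_lower[OF dom] Bm]) auto
  have sq: "(\<lambda>w. sqnorm_wrt (B (Shat t (k-1) w)) (f w)) \<in> borel_measurable M" if "f \<in> borel_measurable M" for f
  proof -
    have "continuous_on UNIV (\<lambda>x :: (real^'q^'q) \<times> (real^'q). sqnorm_wrt (fst x) (snd x))"
      unfolding sqnorm_wrt_def continuous_on_def
      by (intro ballI tendsto_inner tendsto_matrix_vector_mult tendsto_fst tendsto_snd tendsto_ident_at)
    from measurable_compose[OF borel_measurable_Pair[OF Bm that] borel_measurable_continuous_onI[OF this]]
    show ?thesis by simp
  qed
  show "\<Delta>star t k \<in> borel_measurable M"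
    unfolding \<Delta>star_def[abs_def] by (intro borel_measurable_divide sq borel_measurable_diff p s borel_measurable_const)
  show "Dstar t k \<in> borel_measurable M"
    unfolding Dstar_def[abs_def] by (intro borel_measurable_divide sq borel_measurable_diff p s borel_measurable_const)
qed

end

section \<open>Integrability and the expected bound\<close>

lemma expect_eq_integral:
  assumes "integrable M X" "\<And>w. w \<in> space M \<Longrightarrow> 0 \<le> X w"
  shows "expect M X = ereal (LINT w|M. X w)"
proof -
  have "0 \<le> (LINT w|M. X w)" using assms(2) by (rule Bochner_Integration.integral_nonneg)
  then show ?thesis
    unfolding expect_def using nn_integral_eq_integral[OF assms(1)] assms(2) by (simp add: enn2ereal_ennreal)
qed

lemma integrable_if_expect_finite:
  assumes "X \<in> borel_measurable M" "\<And>w. w \<in> space M \<Longrightarrow> 0 \<le> X w" "expect M X \<noteq> \<infinity>"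
  shows "integrable M X"
proof (rule integrableI_nonneg[OF assms(1)])
  show "(\<integral>\<^sup>+w. ennreal (X w) \<partial>M) < \<infinity>"
    using assms(3) unfolding expect_def by (auto simp: less_top[symmetric])
qed (use assms(2) in auto)

context spider
begin

abbreviation star where "star t k w \<equiv> \<Delta>star t k w + Dstar t k w"

text \<open>All weighted criteria in the pathwise descent are nonnegative and the final objective is
  at least \<open>Fs\<close>, so a single \<open>star t k\<close> is dominated by the errors met up
  to inner step \<open>k\<close> of outer iteration \<open>t\<close>. Asking only for those errors
  to be square integrable is what allows an induction along the trajectory.\<close>

lemma star_integrable:
  assumes Fs: "\<And>s. g s < \<infinity> \<Longrightarrow> Fs \<le> obj s"
    and t: "t \<in> {1..kout}" and k: "k \<in> {1..kin t}"
    and L2: "\<And>t' l. t' \<in> {1..t} \<Longrightarrow> l \<in> {1..kin t'} \<Longrightarrow> t' < t \<or> l \<le> k \<Longrightarrow> square_integrable M (err t' l)"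
  shows "integrable M (star t k)"
proof -
  define R where "R w = (obj Sinit - Fs + vmax * (\<Sum>t'=1..t-1. \<Sum>l=1..kin t'. \<gamma> t' l * (norm (err t' l w))\<^sup>2)
      + vmax * (\<Sum>l=1..k. \<gamma> t l * (norm (err t l w))\<^sup>2)) / wgt t k" for w
  note w = wgt_pos[OF t k]
  have "integrable M (\<lambda>w. \<Sum>t'=1..t-1. \<Sum>l=1..kin t'. \<gamma> t' l * (norm (err t' l w))\<^sup>2)"
    using t by (intro Bochner_Integration.integrable_sum integrable_mult_right square_integrableD(2) L2) auto
  moreover have "integrable M (\<lambda>w. \<Sum>l=1..k. \<gamma> t l * (norm (err t l w))\<^sup>2)"
    using t k by (intro Bochner_Integration.integrable_sum integrable_mult_right square_integrableD(2) L2) auto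
  ultimately have Rint: "integrable M R" unfolding R_def[abs_def] by simp
  have le: "star t k w \<le> R w" for w
  proof -
    have eq: "Shat t 0 w = Shat (t-1) (kin (t-1)) w" using t by (cases t) (simp_all add: Shat_def)
    have "0 \<le> (\<Sum>t'=1..t-1. \<Sum>l=1..kin t'. wgt t' l * star t' l w)"
    proof (intro sum_nonneg mult_nonneg_nonneg add_nonneg_nonneg less_imp_le[OF wgt_pos] star_nonneg)
      fix t' l assume "t' \<in> {1..t-1}" "l \<in> {1..kin t'}"
      then show "t' \<in> {1..kout}" "l \<in> {1..kin t'}" using t by auto
    qed (use t in auto)
    then have 1: "obj (Shat t 0 w) \<le> obj Sinit + vmax * (\<Sum>t'=1..t-1. \<Sum>l=1..kin t'. \<gamma> t' l * (norm (err t' l w))\<^sup>2)"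
      using descent_outer[of "t-1" w] t unfolding eq by (smt (verit) atLeastAtMost_iff diff_le_self le_trans)
    have "wgt t k * star t k w \<le> (\<Sum>l=1..k. wgt t l * star t l w)"
    proof (rule member_le_sum)
      fix l assume "l \<in> {1..k} - {k}"
      then have "l \<in> {1..kin t}" using k by auto
      then show "0 \<le> wgt t l * star t l w" using wgt_pos[OF t, of l] star_nonneg[OF t, of l w] by simp
    qed (use k in auto)
    moreover have "Fs \<le> obj (Shat t k w)" by (intro Fs Shat_dom) (use t k in auto)
    ultimately have "wgt t k * star t k w \<le> obj Sinit - Fs
        + vmax * (\<Sum>t'=1..t-1. \<Sum>l=1..kin t'. \<gamma> t' l * (norm (err t' l w))\<^sup>2)
        + vmax * (\<Sum>l=1..k. \<gamma> t l * (norm (err t l w))\<^sup>2)"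
      using descent_inner[OF t, of k w] 1 k by simp
    then show ?thesis unfolding R_def using w by (simp add: pos_le_divide_eq mult.commute)
  qed
  show ?thesis
  proof (rule Bochner_Integration.integrable_bound[OF Rint])
    show "AE w in M. norm (star t k w) \<le> norm (R w)"
      using le star_nonneg[OF t k] by (intro AE_I2) (smt (verit) real_norm_def)
  qed (use star_measurable[OF t k] in simp)
qed

lemma move_integrable:
  assumes t: "t \<in> {1..kout}" and k: "k \<in> {1..kin t}" and T: "integrable M (star t k)"
  shows "integrable M (\<lambda>w. (norm (Shat t k w - Shat t (k-1) w))\<^sup>2)"
    and "(LINT w|M. (norm (Shat t k w - Shat t (k-1) w))\<^sup>2) \<le> 2 * (\<gamma> t k)\<^sup>2 / vmin * (LINT w|M. star t k w)"
proof -
  have int: "integrable M (\<lambda>w. 2 * (\<gamma> t k)\<^sup>2 / vmin * star t k w)" using T by simp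
  have meas: "Shat t k \<in> borel_measurable M" "Shat t (k-1) \<in> borel_measurable M"
    using Shat_M[OF t] k by auto
  show 1: "integrable M (\<lambda>w. (norm (Shat t k w - Shat t (k-1) w))\<^sup>2)"
  proof (rule Bochner_Integration.integrable_bound[OF int])
    show "AE w in M. norm ((norm (Shat t k w - Shat t (k-1) w))\<^sup>2) \<le> norm (2 * (\<gamma> t k)\<^sup>2 / vmin * star t k w)"
      using move_le[OF t k] by (intro AE_I2) (smt (verit) real_norm_def zero_le_power2)
  qed (use meas in simp)
  show "(LINT w|M. (norm (Shat t k w - Shat t (k-1) w))\<^sup>2) \<le> 2 * (\<gamma> t k)\<^sup>2 / vmin * (LINT w|M. star t k w)"
    using integral_mono[OF 1 int move_le[OF t k]] by simp
qed

text \<open>Errors up to \<open>k\<close> make \<open>star t k\<close> integrable, hence the squared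
  move at \<open>k\<close>, hence the squared error at \<open>k + 1\<close>. Earlier outer
  iterations are supplied by the outer induction, and the initial error of each by
  assumption.\<close>

lemma err_L2:
  assumes Fs: "\<And>s. g s < \<infinity> \<Longrightarrow> Fs \<le> obj s"
    and init: "\<And>t. t \<in> {1..kout} \<Longrightarrow> square_integrable M (err t 0)"
    and t: "t \<in> {1..kout}" and k: "k \<le> kin t"
  shows "square_integrable M (err t k)"
  using t k
proof (induction t arbitrary: k rule: less_induct)
  case (less t)
  \<comment> \<open>All indices up to \<open>k\<close> are carried along, because the domination of
    \<open>star t k\<close> involves every earlier error.\<close>
  have "k \<le> kin t \<Longrightarrow> l \<le> k \<Longrightarrow> square_integrable M (err t l)" for k l
  proof (induction k arbitrary: l)
    case 0
    then show ?case using init less.prems by simp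
  next
    case (Suc k)
    have IH: "square_integrable M (err t l)" if "l \<le> k" for l using Suc.IH[of l] Suc.prems that by simp
    \<comment> \<open>For \<open>k = 0\<close> the two iterates coincide and the move is zero;
      otherwise it is controlled by \<open>star t k\<close>.\<close>
    have "integrable M (\<lambda>w. (norm (Shat t k w - Shat t (k-1) w))\<^sup>2)"
    proof (cases "k = 0")
      case False
      then have k: "k \<in> {1..kin t}" using Suc.prems by simp
      have "integrable M (star t k)"
      proof (rule star_integrable[OF Fs less.prems(1) k])
        fix t' l assume "t' \<in> {1..t}" "l \<in> {1..kin t'}" "t' < t \<or> l \<le> k"
        then show "square_integrable M (err t' l)"
          using less.IH[of t' l] IH[of l] less.prems(1) by (cases "t' < t") auto
      qed
      then show ?thesis by (rule move_integrable(1)[OF less.prems(1) k])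
    qed simp
    then have "square_integrable M (err t (Suc k))"
      using Suc.prems by (intro err_step(1) less.prems IH) auto
    then show ?case using IH[of l] Suc.prems by (cases "l = Suc k") auto
  qed
  then show ?case using less.prems by blast
qed

definition \<Lambda> :: "nat \<Rightarrow> nat \<Rightarrow> real" where
  "\<Lambda> t k = \<gamma> t (k-1) * LW / vmin
      + (\<gamma> t (k-1))\<^sup>2 * lip * (2 * vmax * real (kin t) / (vmin * real b)) * (1 + 2 * Cvb / (sqrt (real b) * Mbar t k))"

text \<open>Integrating the pathwise descent leaves the weighted squared errors. The recursion
  bounds them by the initial errors, the terms \<open>U\<close> and multiples of the criteria, and
  the last of these are moved to the left-hand side.\<close>

lemma total_bound:
  assumes Fs: "\<And>s. g s < \<infinity> \<Longrightarrow> Fs \<le> obj s"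
    and init: "\<And>t. t \<in> {1..kout} \<Longrightarrow> square_integrable M (err t 0)"
  shows "(\<Sum>t=1..kout. \<Sum>k=1..kin t. \<gamma> t k * (1/2 - \<Lambda> t (k+1)) * (LINT w|M. star t k w))
    \<le> obj Sinit - Fs + vmax * (\<Sum>t=1..kout. \<gamma> t 0 * real (kin t) * (LINT w|M. (norm (err t 0 w))\<^sup>2))
      + vmax * (\<Sum>t=1..kout. \<Sum>k=1..kin t. (real (kin t) - real k + 1) * \<gamma> t k * U t k)"
proof -
  have L2: "square_integrable M (err t k)" if "t \<in> {1..kout}" "k \<le> kin t" for t k
    using err_L2[OF Fs init that] .
  have T: "integrable M (star t k)" if "t \<in> {1..kout}" "k \<in> {1..kin t}" for t k
    by (rule star_integrable[OF Fs that]) (use L2 that in auto)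
  let ?E = "\<lambda>t k. (LINT w|M. (norm (err t k w))\<^sup>2)"
  let ?T = "\<lambda>t k. (LINT w|M. star t k w)"
  let ?q = "\<lambda>t k. (1 + 2 * (Cvb / Mbar t k) / sqrt b) / real b * lip"
  have intT: "integrable M (\<lambda>w. \<Sum>t=1..kout. \<Sum>k=1..kin t. wgt t k * star t k w)"
    using T by (intro Bochner_Integration.integrable_sum integrable_mult_right) auto
  have intE: "integrable M (\<lambda>w. \<Sum>t=1..kout. \<Sum>k=1..kin t. \<gamma> t k * (norm (err t k w))\<^sup>2)"
    by (intro Bochner_Integration.integrable_sum integrable_mult_right square_integrableD(2) L2) auto
  have "(LINT w|M. (\<Sum>t=1..kout. \<Sum>k=1..kin t. wgt t k * star t k w))
      \<le> (LINT w|M. (obj Sinit - Fs) + vmax * (\<Sum>t=1..kout. \<Sum>k=1..kin t. \<gamma> t k * (norm (err t k w))\<^sup>2))"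
  proof (rule integral_mono[OF intT])
    fix w
    have "Fs \<le> obj (Shat kout (kin kout) w)" by (intro Fs Shat_dom) auto
    then show "(\<Sum>t=1..kout. \<Sum>k=1..kin t. wgt t k * star t k w)
        \<le> (obj Sinit - Fs) + vmax * (\<Sum>t=1..kout. \<Sum>k=1..kin t. \<gamma> t k * (norm (err t k w))\<^sup>2)"
      using descent_outer[of kout w] by simp
  qed (use intE in simp)
  also have "\<dots> = (obj Sinit - Fs) + vmax * (\<Sum>t=1..kout. \<Sum>k=1..kin t. \<gamma> t k * ?E t k)"
  proof -
    have "(LINT w|M. (\<Sum>t=1..kout. \<Sum>k=1..kin t. \<gamma> t k * (norm (err t k w))\<^sup>2))
        = (\<Sum>t=1..kout. \<Sum>k=1..kin t. (LINT w|M. \<gamma> t k * (norm (err t k w))\<^sup>2))"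
      using square_integrableD(2)[OF L2]
      by (subst Bochner_Integration.integral_sum)
        (auto intro!: Bochner_Integration.integrable_sum Bochner_Integration.integral_sum sum.cong)
    then show ?thesis using intE by (simp add: prob_space)
  qed
  also have "(LINT w|M. (\<Sum>t=1..kout. \<Sum>k=1..kin t. wgt t k * star t k w))
      = (\<Sum>t=1..kout. \<Sum>k=1..kin t. wgt t k * ?T t k)"
  proof -
    have "(LINT w|M. (\<Sum>t=1..kout. \<Sum>k=1..kin t. wgt t k * star t k w))
        = (\<Sum>t=1..kout. \<Sum>k=1..kin t. (LINT w|M. wgt t k * star t k w))"
      using T by (subst Bochner_Integration.integral_sum)
        (auto intro!: Bochner_Integration.integrable_sum Bochner_Integration.integral_sum sum.cong)
    then show ?thesis by simp
  qed
  finally have main: "(\<Sum>t=1..kout. \<Sum>k=1..kin t. wgt t k * ?T t k)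
      \<le> (obj Sinit - Fs) + vmax * (\<Sum>t=1..kout. \<Sum>k=1..kin t. \<gamma> t k * ?E t k)" .
  have acc: "(\<Sum>k=1..kin t. \<gamma> t k * ?E t k) \<le> real (kin t) * (\<gamma> t 0 * ?E t 0)
      + (\<Sum>k=1..kin t. (real (kin t) - real k + 1) * \<gamma> t k * U t k)
      + (\<Sum>k=1..kin t. \<gamma> t k * (real (kin t) * ?q t (Suc k) * (2 * (\<gamma> t k)\<^sup>2 / vmin * ?T t k)))"
    if t: "t \<in> {1..kout}" for t
  proof (rule accumulated_recursion[where c = "\<lambda>k. 2 * Cb / m t k"
        and X = "\<lambda>k. (LINT w|M. (norm (Shat t k w - Shat t (k-1) w))\<^sup>2)"])
    show "0 < \<gamma> t k" if "k \<le> kin t" for k by (rule steps[OF t that])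
    show "\<gamma> t (Suc k) * (1 + 2 * Cb / m t (Suc k)) \<le> \<gamma> t k" if "k < kin t" for k
      using step_decr[OF t that] by simp
    show "\<gamma> t (Suc k) \<le> \<gamma> t k" if "k < kin t" for k by (rule step_mono[OF t that])
    show "?E t (Suc k) \<le> (1 + 2 * Cb / m t (Suc k)) * ?E t k
        + ?q t (Suc k) * (LINT w|M. (norm (Shat t k w - Shat t (k-1) w))\<^sup>2) + U t (Suc k)"
      if "k < kin t" for k
    proof (rule err_step(2)[OF t that])
      show "square_integrable M (err t k)" using L2[OF t] that by simp
      show "integrable M (\<lambda>w. (norm (Shat t k w - Shat t (k-1) w))\<^sup>2)"
        using move_integrable(1)[OF t _ T[OF t], of k] that by (cases "k = 0") auto
    qed
    show "0 \<le> ?q t (Suc k)" for k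
      using A4_const A4_seq[OF t, of "Suc k"] by (simp add: lip_def sum_nonneg)
    show "(LINT w|M. (norm (Shat t k w - Shat t (k-1) w))\<^sup>2) \<le> 2 * (\<gamma> t k)\<^sup>2 / vmin * ?T t k"
      if "1 \<le> k" "k \<le> kin t" for k
      using that by (intro move_integrable(2) T t) auto
    show "0 \<le> 2 * (\<gamma> t k)\<^sup>2 / vmin * ?T t k" if "1 \<le> k" "k \<le> kin t" for k
      using that star_nonneg[OF t, of k] A3c(1)
      by (intro mult_nonneg_nonneg Bochner_Integration.integral_nonneg) auto
  qed simp_all
  \<comment> \<open>Charging \<open>vmax\<close> times the accumulated moves to the descent
    coefficient yields exactly the factor \<open>1/2 - \<Lambda>\<close>.\<close>
  have wgt: "wgt t k * ?T t k - vmax * (\<gamma> t k * (real (kin t) * ?q t (Suc k) * (2 * (\<gamma> t k)\<^sup>2 / vmin * ?T t k)))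
      = \<gamma> t k * (1/2 - \<Lambda> t (k+1)) * ?T t k" for t k
  proof -
    have "2 * (Cvb / Mbar t (Suc k)) / sqrt b = 2 * Cvb / (sqrt (real b) * Mbar t (Suc k))"
      by (simp add: mult.commute)
    then show ?thesis unfolding wgt_def \<Lambda>_def by (simp add: algebra_simps power2_eq_square)
  qed
  have "(\<Sum>t=1..kout. \<Sum>k=1..kin t. \<gamma> t k * ?E t k)
      \<le> (\<Sum>t=1..kout. real (kin t) * (\<gamma> t 0 * ?E t 0)
      + (\<Sum>k=1..kin t. (real (kin t) - real k + 1) * \<gamma> t k * U t k)
      + (\<Sum>k=1..kin t. \<gamma> t k * (real (kin t) * ?q t (Suc k) * (2 * (\<gamma> t k)\<^sup>2 / vmin * ?T t k))))"
    by (intro sum_mono acc)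
  then have "vmax * (\<Sum>t=1..kout. \<Sum>k=1..kin t. \<gamma> t k * ?E t k)
      \<le> vmax * (\<Sum>t=1..kout. real (kin t) * (\<gamma> t 0 * ?E t 0)
      + (\<Sum>k=1..kin t. (real (kin t) - real k + 1) * \<gamma> t k * U t k)
      + (\<Sum>k=1..kin t. \<gamma> t k * (real (kin t) * ?q t (Suc k) * (2 * (\<gamma> t k)\<^sup>2 / vmin * ?T t k))))"
    using vmax by (intro mult_left_mono) auto
  also have "\<dots> = vmax * (\<Sum>t=1..kout. \<gamma> t 0 * real (kin t) * ?E t 0)
      + vmax * (\<Sum>t=1..kout. \<Sum>k=1..kin t. (real (kin t) - real k + 1) * \<gamma> t k * U t k)
      + (\<Sum>t=1..kout. \<Sum>k=1..kin t. vmax * (\<gamma> t k * (real (kin t) * ?q t (Suc k) * (2 * (\<gamma> t k)\<^sup>2 / vmin * ?T t k))))"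
  proof -
    have eq: "real (kin t) * (\<gamma> t 0 * ?E t 0) = \<gamma> t 0 * real (kin t) * ?E t 0" for t by simp
    show ?thesis unfolding eq sum.distrib distrib_left sum_distrib_left[symmetric] by simp
  qed
  finally show ?thesis using main unfolding wgt[symmetric] sum_subtractf by linarith
qed

lemma expect_star:
  assumes t: "t \<in> {1..kout}" and k: "k \<in> {1..kin t}" and T: "integrable M (star t k)"
  shows "expect M (\<Delta>star t k) + expect M (Dstar t k) = ereal (LINT w|M. star t k w)"
proof -
  note nn = star_nonneg[OF t k]
  have 1: "integrable M (\<Delta>star t k)"
    by (rule Bochner_Integration.integrable_bound[OF T star_measurable(1)[OF t k]])
      (use nn in \<open>simp add: abs_of_nonneg add_nonneg_nonneg\<close>)
  have 2: "integrable M (Dstar t k)"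
    by (rule Bochner_Integration.integrable_bound[OF T star_measurable(2)[OF t k]])
      (use nn in \<open>simp add: abs_of_nonneg add_nonneg_nonneg\<close>)
  show ?thesis using expect_eq_integral[OF 1 nn(1)] expect_eq_integral[OF 2 nn(2)] 1 2 by simp
qed

theorem expected_bound:
  "(\<Sum>t=1..kout. \<Sum>k=1..kin t. ereal (\<gamma> t k * (1/2 - \<Lambda> t (k+1))) * (expect M (\<Delta>star t k) + expect M (Dstar t k)))
    \<le> ereal (obj Sinit) - (INF s\<in>{s. g s < \<infinity>}. ereal (W s) + g s)
      + ereal vmax * (\<Sum>t=1..kout. ereal (\<gamma> t 0 * real (kin t)) * expect M (\<lambda>w. (norm (err t 0 w))\<^sup>2))
      + ereal (vmax * (\<Sum>t=1..kout. \<Sum>k=1..kin t. (real (kin t) - real k + 1) * \<gamma> t k * U t k))"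
    (is "?lhs \<le> _ - ?inf + _ * ?errs + ereal ?c")
proof -
  let ?e = "\<lambda>t. expect M (\<lambda>w. (norm (err t 0 w))\<^sup>2)"
  have obj: "ereal (W s) + g s = ereal (obj s)" if "g s < \<infinity>" for s
    using that A1(1) by (cases "g s") (auto simp: obj_def proper_fun_def)
  have e0: "0 \<le> ?e t" for t by (simp add: expect_def)
  \<comment> \<open>Since \<open>Sinit\<close> lies in the domain, the infimum is never plus
    infinity.\<close>
  have inf_le: "?inf \<le> ereal (obj Sinit)"
    using INF_lower[of Sinit "{s. g s < \<infinity>}" "\<lambda>s. ereal (W s) + g s"] init obj by simp
  \<comment> \<open>If the infimum or some initial error is infinite, so is the right-hand side.\<close>
  show ?thesis
  proof (cases "?inf = -\<infinity>")
    case False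
    then obtain Fs where Fs: "?inf = ereal Fs" using inf_le by (cases ?inf) auto
    have Fs_le: "Fs \<le> obj s" if "g s < \<infinity>" for s
      using INF_lower[of s "{s. g s < \<infinity>}" "\<lambda>s. ereal (W s) + g s"] that obj Fs by simp
    show ?thesis
    proof (cases "\<exists>t\<in>{1..kout}. ?e t = \<infinity>")
      case True
      then obtain t where t: "t \<in> {1..kout}" "?e t = \<infinity>" by blast
      \<comment> \<open>One infinite summand suffices because its coefficient is positive and the
        others are nonnegative.\<close>
      have "(\<Sum>t\<in>{t}. ereal (\<gamma> t 0 * real (kin t)) * ?e t) \<le> ?errs"
      proof (rule sum_mono2)
        fix t' assume "t' \<in> {1..kout} - {t}"
        then have "0 \<le> \<gamma> t' 0 * real (kin t')" using steps[of t' 0] by simp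
        then show "0 \<le> ereal (\<gamma> t' 0 * real (kin t')) * ?e t'" by (intro ereal_0_le_mult e0) simp
      qed (use t in auto)
      then have "?errs = \<infinity>" using t steps[of t 0] sizes(3)[OF t(1)] by simp
      then show ?thesis using vmax Fs by simp
    next
      case False
      then have err0: "square_integrable M (err t 0)" if "t \<in> {1..kout}" for t
        unfolding square_integrable_def using err_M[of t 0] that
        by (auto intro!: integrable_if_expect_finite)
      have L2: "square_integrable M (err t k)" if "t \<in> {1..kout}" "k \<le> kin t" for t k
        using err_L2[OF Fs_le err0 that] .
      have T: "integrable M (star t k)" if "t \<in> {1..kout}" "k \<in> {1..kin t}" for t k
        by (rule star_integrable[OF Fs_le that]) (use L2 that in auto)
      have "?lhs = (\<Sum>t=1..kout. \<Sum>k=1..kin t. ereal (\<gamma> t k * (1/2 - \<Lambda> t (k+1)) * (LINT w|M. star t k w)))"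
        by (intro sum.cong refl) (simp add: expect_star T)
      then have lhs: "?lhs = ereal (\<Sum>t=1..kout. \<Sum>k=1..kin t. \<gamma> t k * (1/2 - \<Lambda> t (k+1)) * (LINT w|M. star t k w))"
        by simp
      have "?errs = (\<Sum>t=1..kout. ereal (\<gamma> t 0 * real (kin t) * (LINT w|M. (norm (err t 0 w))\<^sup>2)))"
        by (intro sum.cong refl) (simp add: expect_eq_integral square_integrableD(2)[OF err0])
      then have errs: "?errs = ereal (\<Sum>t=1..kout. \<gamma> t 0 * real (kin t) * (LINT w|M. (norm (err t 0 w))\<^sup>2))"
        by simp
      show ?thesis
        unfolding lhs errs Fs using total_bound[OF Fs_le err0] by simp
    qed
  qed simp
qed

end

section \<open>The bound in the notation of the statement\<close>

theorem theorem4p1: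
  fixes M :: "'w measure"
    and n kout b :: nat and kin b' :: "nat \<Rightarrow> nat" and repl :: bool
    and g :: "real^'q \<Rightarrow> ereal" and W :: "real^'q \<Rightarrow> real"
    and G :: "nat \<Rightarrow> real^'q \<Rightarrow> real^'q" and B :: "real^'q \<Rightarrow> real^'q^'q"
    and \<gamma> :: "nat \<Rightarrow> nat \<Rightarrow> real" and Sinit :: "real^'q"
    and batch :: "nat \<Rightarrow> nat \<Rightarrow> 'w \<Rightarrow> nat list"
    and \<delta> :: "nat \<Rightarrow> nat \<Rightarrow> nat \<Rightarrow> nat \<Rightarrow> 'w \<Rightarrow> real^'q"
    and L :: "nat \<Rightarrow> real" and LW vmin vmax Cb Cv Cvb :: real
    and m Mv Mbar :: "nat \<Rightarrow> nat \<Rightarrow> real"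
  defines "\<S> \<equiv> {s. g s < \<infinity>}"
    and "S \<equiv> \<lambda>t k \<omega>. spider_dir b b' (\<lambda>t k. batch t k \<omega>) (\<lambda>t k j i. \<delta> t k j i \<omega>) t k"
  defines "Shat \<equiv> \<lambda>t k \<omega>. spider_iter g B kin \<gamma> Sinit (\<lambda>t k. S t k \<omega>) t k"
  defines "\<xi> \<equiv> \<lambda>t k j i \<omega>. \<delta> t (k+1) j i \<omega>
                 - hbar_i B G i (Shat t k \<omega>) + hbar_i B G i (Shat t (k-1) \<omega>)"
  defines "\<mu> \<equiv> \<lambda>t k j i. vec_cond_exp M (spider_half M batch Shat t k) (\<xi> t k j i)"
  defines "\<sigma>2 \<equiv> \<lambda>t k j i. nn_cond_exp M (spider_half M batch Shat t k)
                  (\<lambda>\<omega>. ennreal ((norm (\<xi> t k j i \<omega> - \<mu> t k j i \<omega>))\<^sup>2))"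
  defines "\<mu>bar \<equiv> \<lambda>t k j \<omega>. (1 / real n) *\<^sub>R (\<Sum>i=1..n. \<mu> t k j i \<omega>)"
  defines "p \<equiv> \<lambda>t k \<omega>. prox (B (Shat t k \<omega>)) (\<gamma> t (k+1)) g
                 (Shat t k \<omega> + \<gamma> t (k+1) *\<^sub>R hbar n B G (Shat t k \<omega>))"
  defines "\<Delta>star \<equiv> \<lambda>t k \<omega>. sqnorm_wrt (B (Shat t (k-1) \<omega>))
                 (p t (k-1) \<omega> - Shat t (k-1) \<omega>) / (\<gamma> t k)\<^sup>2"
    and "Dstar \<equiv> \<lambda>t k \<omega>. sqnorm_wrt (B (Shat t (k-1) \<omega>))
                 (Shat t k \<omega> - p t (k-1) \<omega>) / (\<gamma> t k)\<^sup>2"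
    and "Err \<equiv> \<lambda>t \<omega>. S t 0 \<omega> - hbar n B G (Shat t 0 \<omega>)"
    and "\<Lambda> \<equiv> \<lambda>t k. \<gamma> t (k-1) * LW / vmin
            + (\<gamma> t (k-1))\<^sup>2 * ((\<Sum>i=1..n. (L i)\<^sup>2) / real n)
                * (2 * vmax * real (kin t) / (vmin * real b))
                * (1 + 2 * Cvb / (sqrt (real b) * Mbar t k))"
    and "U \<equiv> \<lambda>t k. 2 * Cb / m t k + Cb\<^sup>2 / (m t k)\<^sup>2 + Cv / (real b * Mv t k)
            + 2 * Cvb / (sqrt (real b) * Mbar t k) + Cvb\<^sup>2 / (real b * (Mbar t k)\<^sup>2)"
  assumes prob: "prob_space M"
    and n: "1 \<le> n"
    and B_pd: "\<And>s. s \<in> \<S> \<Longrightarrow> pos_def_matrix (B s)"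
    and B_meas: "B \<in> borel_measurable (restrict_space borel \<S>)"
    and sizes: "1 \<le> kout" "1 \<le> b" "repl \<or> b \<le> n"
               "\<And>t. t \<in> {1..kout} \<Longrightarrow> 1 \<le> kin t \<and> 1 \<le> b' t"
    and steps: "\<And>t k. t \<in> {1..kout} \<Longrightarrow> k \<le> kin t \<Longrightarrow> 0 < \<gamma> t k"
    and init: "Sinit \<in> \<S>"
    and batches: "\<And>t k. t \<in> {1..kout} \<Longrightarrow> k \<le> kin t \<Longrightarrow>
           batch t k \<in> measurable M (count_space UNIV)
           \<and> (\<forall>\<omega>\<in>space M. length (batch t k \<omega>) = batch_size b b' t k \<and> set (batch t k \<omega>) \<subseteq> {1..n})"
    and \<delta>_meas: "\<And>t k j i. t \<in> {1..kout} \<Longrightarrow> k \<le> kin t \<Longrightarrow> j < batch_size b b' t k \<Longrightarrow> i \<in> {1..n}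
           \<Longrightarrow> \<delta> t k j i \<in> borel_measurable M"
    and sampling: "\<And>t k. t \<in> {1..kout} \<Longrightarrow> k < kin t \<Longrightarrow>
           spider_sampling M repl n kin b b' batch \<delta> Shat t k"
    and A1: "proper_fun g" "lower_semicontinuous g" "convex_ereal_fun g"
    and A2: "\<And>i. i \<in> {1..n} \<Longrightarrow> 0 < L i \<and> (L i)-lipschitz_on \<S> (hbar_i B G i)"
    and A3a: "\<And>s. s \<in> \<S> \<Longrightarrow> GDERIV W s :> (1 / real n) *\<^sub>R (\<Sum>i=1..n. G i s)"
             "continuous_on \<S> (\<lambda>s. (1 / real n) *\<^sub>R (\<Sum>i=1..n. G i s))"
    and A3b: "LW-lipschitz_on \<S> (\<lambda>s. (1 / real n) *\<^sub>R (\<Sum>i=1..n. G i s))"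
    and A3c: "0 < vmin" "vmin \<le> vmax"
             "\<And>s x. s \<in> \<S> \<Longrightarrow> vmin * (norm x)\<^sup>2 \<le> sqnorm_wrt (B s) x
                              \<and> sqnorm_wrt (B s) x \<le> vmax * (norm x)\<^sup>2"
    and \<xi>_int: "\<And>t k j i. t \<in> {1..kout} \<Longrightarrow> k < kin t \<Longrightarrow> j < b \<Longrightarrow> i \<in> {1..n}
           \<Longrightarrow> integrable M (\<xi> t k j i)"
    and \<mu>_draw: "\<And>t k j j' i. t \<in> {1..kout} \<Longrightarrow> k < kin t \<Longrightarrow> j < b \<Longrightarrow> j' < b \<Longrightarrow> i \<in> {1..n}
           \<Longrightarrow> AE \<omega> in M. \<mu> t k j i \<omega> = \<mu> t k j' i \<omega>"
    and A4a: "\<And>t k. t \<in> {1..kout} \<Longrightarrow> k < kin t \<Longrightarrow>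
           cond_indep_sets M (spider_half M batch Shat t k)
             (\<lambda>j. sets (vimage_algebra (space M)
                    (\<lambda>\<omega>. \<delta> t (k+1) j (batch t (k+1) \<omega> ! j) \<omega>) borel)) {..<b}"
    and A4_const: "0 \<le> Cb" "0 \<le> Cv" "0 \<le> Cvb"
    and A4_seq: "\<And>t. t \<in> {1..kout} \<Longrightarrow>
             mono_on {1..} (m t) \<and> mono_on {1..} (Mv t) \<and> mono_on {1..} (Mbar t)"
           "\<And>t k. t \<in> {1..kout} \<Longrightarrow> 1 \<le> k \<Longrightarrow> 0 < m t k \<and> 0 < Mv t k \<and> 0 < Mbar t k"
    and A4b: "\<And>t k j. t \<in> {1..kout} \<Longrightarrow> k < kin t \<Longrightarrow> j < b \<Longrightarrow>
           AE \<omega> in M. norm (\<mu>bar t k j \<omega>) \<le> Cb / m t (k+1)"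
    and A4c: "\<And>t k j. t \<in> {1..kout} \<Longrightarrow> k < kin t \<Longrightarrow> j < b \<Longrightarrow>
           AE \<omega> in M. (\<Sum>i=1..n. \<sigma>2 t k j i \<omega>) / of_nat n \<le> ennreal (Cv / Mv t (k+1))"
           "\<And>t k j. t \<in> {1..kout} \<Longrightarrow> k < kin t \<Longrightarrow> j < b \<Longrightarrow>
           AE \<omega> in M. (\<Sum>i=1..n. (norm (\<mu> t k j i \<omega> - \<mu>bar t k j \<omega>))\<^sup>2) / real n
                        \<le> Cvb\<^sup>2 / (Mbar t (k+1))\<^sup>2"
    and step_decr: "\<And>t k. t \<in> {1..kout} \<Longrightarrow> k < kin t \<Longrightarrow>
           \<gamma> t (k+1) * (1 + 2 * Cb / m t (k+1)) \<le> \<gamma> t k"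
    and \<Lambda>_range: "\<And>t k. t \<in> {1..kout} \<Longrightarrow> k < kin t \<Longrightarrow> \<Lambda> t (k+1) \<in> {0<..<1/2}"
  shows "(\<Sum>t=1..kout. \<Sum>k=1..kin t.
            ereal (\<gamma> t k * (1/2 - \<Lambda> t (k+1))) * (expect M (\<Delta>star t k) + expect M (Dstar t k)))
         \<le> ereal (\<integral>\<omega>. W (Shat 1 0 \<omega>) + real_of_ereal (g (Shat 1 0 \<omega>)) \<partial>M)
             - (INF s\<in>\<S>. ereal (W s) + g s)
           + ereal vmax * (\<Sum>t=1..kout. ereal (\<gamma> t 0 * real (kin t))
                              * expect M (\<lambda>\<omega>. (norm (Err t \<omega>))\<^sup>2))
           + ereal (vmax * (\<Sum>t=1..kout. \<Sum>k=1..kin t.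
                              (real (kin t) - real k + 1) * \<gamma> t k * U t k))"
proof -
  have m_nonneg: "0 < m t (k+1)" "0 < Mbar t (k+1)" if "t \<in> {1..kout}" for t k
    using A4_seq(2)[OF that, of "k+1"] by auto
  interpret R: spider M n kout b kin b' repl g W G B \<gamma> Sinit batch \<delta> L LW vmin vmax Cb Cv Cvb m Mv Mbar S Shat \<mu>
  proof (rule spider.intro)
    \<comment> \<open>The second summand of \<Lambda> is nonnegative, so the first alone stays below
      1/2.\<close>
    show "\<gamma> t k * LW / vmin < 1/2" if t: "t \<in> {1..kout}" and k: "k < kin t" for t k
    proof -
      have "0 \<le> (\<gamma> t k)\<^sup>2 * ((\<Sum>i=1..n. (L i)\<^sup>2) / real n) * (2 * vmax * real (kin t) / (vmin * real b))
          * (1 + 2 * Cvb / (sqrt (real b) * Mbar t (k+1)))"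
        using A3c(1,2) A4_const(3) m_nonneg[OF t, of k]
        by (intro mult_nonneg_nonneg divide_nonneg_nonneg add_nonneg_nonneg sum_nonneg) auto
      then show ?thesis using \<Lambda>_range[OF t k] unfolding \<Lambda>_def by simp
    qed
    show "AE \<omega> in M. (\<Sum>i=1..n. nn_cond_exp M (spider_half M batch Shat t k)
             (\<lambda>\<omega>. ennreal ((norm (\<delta> t (k+1) j i \<omega> - hbar_i B G i (Shat t k \<omega>)
                + hbar_i B G i (Shat t (k-1) \<omega>) - \<mu> t k j i \<omega>))\<^sup>2)) \<omega>) / of_nat n \<le> ennreal (Cv / Mv t (k+1))"
      if "t \<in> {1..kout}" "k < kin t" "j < b" for t k j
      using A4c(1)[OF that] unfolding \<sigma>2_def \<xi>_def .
    show "AE \<omega> in M. norm ((1 / real n) *\<^sub>R (\<Sum>i=1..n. \<mu> t k j i \<omega>)) \<le> Cb / m t (k+1)"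
      if "t \<in> {1..kout}" "k < kin t" "j < b" for t k j
      using A4b[OF that] unfolding \<mu>bar_def .
    show "AE \<omega> in M. (\<Sum>i=1..n. (norm (\<mu> t k j i \<omega> - (1 / real n) *\<^sub>R (\<Sum>i=1..n. \<mu> t k j i \<omega>)))\<^sup>2) / real n
        \<le> Cvb\<^sup>2 / (Mbar t (k+1))\<^sup>2" if "t \<in> {1..kout}" "k < kin t" "j < b" for t k j
      using A4c(2)[OF that] unfolding \<mu>bar_def .
    show "integrable M (\<lambda>\<omega>. \<delta> t (k+1) j i \<omega> - hbar_i B G i (Shat t k \<omega>) + hbar_i B G i (Shat t (k-1) \<omega>))"
      if "t \<in> {1..kout}" "k < kin t" "j < b" "i \<in> {1..n}" for t k j i
      using \<xi>_int[OF that] unfolding \<xi>_def .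
    show "S = (\<lambda>t k \<omega>. spider_dir b b' (\<lambda>t k. batch t k \<omega>) (\<lambda>t k j i. \<delta> t k j i \<omega>) t k)"
      by (simp only: S_def)
    show "Shat = (\<lambda>t k \<omega>. spider_iter g B kin \<gamma> Sinit (\<lambda>t k. S t k \<omega>) t k)" by (simp only: Shat_def)
    show "\<mu> = (\<lambda>t k j i. vec_cond_exp M (spider_half M batch Shat t k)
       (\<lambda>\<omega>. \<delta> t (k+1) j i \<omega> - hbar_i B G i (Shat t k \<omega>) + hbar_i B G i (Shat t (k-1) \<omega>)))"
      by (simp only: \<mu>_def \<xi>_def)
  qed (fact prob n sizes A1 A3c(1,2) A4_const steps batches \<delta>_meas sampling \<mu>_draw A4a A4_seq(2) step_decr
      B_pd[unfolded \<S>_def mem_Collect_eq] B_meas[unfolded \<S>_def] init[unfolded \<S>_def mem_Collect_eq]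
      A2[THEN conjunct2, unfolded \<S>_def] A3a(1)[unfolded \<S>_def mem_Collect_eq] A3b[unfolded \<S>_def]
      A3c(3)[unfolded \<S>_def mem_Collect_eq] sizes(4)[THEN conjunct1])+
  \<comment> \<open>For \<open>k \<ge> 1\<close> the index \<open>k - 1 + 1\<close> in the step size
    of \<open>p t (k-1)\<close> is \<open>k\<close>; at \<open>k = 0\<close> truncated subtraction
    would break this.\<close>
  have \<Delta>: "\<Delta>star t k = R.\<Delta>star t k" and D: "Dstar t k = R.Dstar t k" if "k \<in> {1..kin t}" for t k
    using that unfolding \<Delta>star_def Dstar_def p_def R.\<Delta>star_def R.Dstar_def by (auto simp: fun_eq_iff)
  have \<Lambda>: "\<Lambda> t k = R.\<Lambda> t k" for t k
    by (simp only: \<Lambda>_def R.\<Lambda>_def R.lip_def)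
  have U: "U t k = R.U t k" for t k
    unfolding U_def R.U_def by (simp add: power_divide mult.commute)
  have Err: "Err t = R.err t 0" for t
    by (simp add: Err_def R.err_def fun_eq_iff)
  \<comment> \<open>The first iterate is deterministic, so its expected objective is a
    constant.\<close>
  have "Shat 1 0 \<omega> = Sinit" for \<omega> by (simp add: Shat_def)
  then have start: "(\<integral>\<omega>. W (Shat 1 0 \<omega>) + real_of_ereal (g (Shat 1 0 \<omega>)) \<partial>M) = R.obj Sinit"
    by (simp add: R.obj_def R.prob_space)
  have lhs: "(\<Sum>t=1..kout. \<Sum>k=1..kin t. ereal (\<gamma> t k * (1/2 - \<Lambda> t (k+1))) * (expect M (\<Delta>star t k) + expect M (Dstar t k)))
      = (\<Sum>t=1..kout. \<Sum>k=1..kin t. ereal (\<gamma> t k * (1/2 - R.\<Lambda> t (k+1))) * (expect M (R.\<Delta>star t k) + expect M (R.Dstar t k)))"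
    by (intro sum.cong refl) (simp only: \<Delta> D \<Lambda>)
  show ?thesis
    unfolding lhs start Err U \<S>_def by (rule R.expected_bound)
qed

end
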